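(* Let $\mathfrak A$ be a $C^*$-algebra and $J$ an index set. The algebraic actions $g\mapsto\beta^{(0)}_g$ and (if $\mathfrak A$ is unital) $g\mapsto\gamma^{(0)}_g$ of $\mathbb P_J$ on the algebraic free products $\mathfrak B^{(0)}$ and $\mathfrak C^{(0)}$ uniquely extend to actions $$g\in\mathbb P_J\mapsto\beta_g\in\mathrm{Aut}(\mathfrak B),\qquad g\in\mathbb P_J\mapsto\gamma_g\in\mathrm{Aut}(\mathfrak C)$$ on the free product $C^*$-algebras $\mathfrak B$ and $\mathfrak C$, respectively. In addition, for $\mathfrak A$ unital, the projection map $\rho^{(0)}:\mathfrak B^{(0)}\to\mathfrak C^{(0)}$ uniquely extends to a surjective $*$-homomorphism $\rho:\mathfrak B\to\mathfrak C$ satisfying $$\rho\circ\beta_g=\gamma_g\circ\rho,\qquad g\in\mathbb P_J.$$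
   Context: $\mathfrak B^{(0)}$ is the algebraic free product of $|J|$ copies of $\mathfrak A$ in the category of (not necessarily unital) $*$-algebras: as a vector space $\bigoplus_{n\ge1}\bigoplus_{i_1\neq i_2\neq\cdots\neq i_n}V_{i_1}\otimes\cdots\otimes V_{i_n}$ with $V_i=\mathfrak A$ (consecutive indices distinct), with the concatenation product (merging adjacent letters with the same index by multiplication in $\mathfrak A$) and the reversed-order adjoint. If $\mathfrak A$ is unital, $\mathfrak C^{(0)}$ is the algebraic free product of $|J|$ copies of $\mathfrak A$ in the category of unital $*$-algebras. Both have canonical embeddings $i_j$ of $\mathfrak A$, $j\in J$, and the usual universal properties. $\rho^{(0)}:\mathfrak B^{(0)}\to\mathfrak C^{(0)}$ is the surjective $*$-homomorphism with $\rho^{(0)}(i_j(A))=i_j(A)$, $A\in\mathfrak A$, $j\in J$. On $\mathfrak B^{(0)}$ and $\mathfrak C^{(0)}$ consider the seminorm $\|X\|=\sup\{\|\pi(X)\|\mid\pi\text{ a }*\text{-representation on a Hilbert space}\}$ (finite on all elements). $\mathfrak B$ and $\mathfrak C$ are the enveloping $C^*$-algebras, i.e. the completions of the quotients by the null ideals; they are the free product $C^*$-algebra and the unital free product $C^*$-algebra of the copies of $\mathfrak A$. "Extend" is meant with respect to the canonical maps $\mathfrak B^{(0)}\to\mathfrak B$ and $\mathfrak C^{(0)}\to\mathfrak C$. $\mathbb P_J$ is the group of permutations of $J$ moving only finitely many elements; $\beta^{(0)}_g$ and $\gamma^{(0)}_g$ are the $*$-automorphisms of $\mathfrak B^{(0)}$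 and $\mathfrak C^{(0)}$ determined by $i_j(A)\mapsto i_{g(j)}(A)$. *)

theory Defs
  imports
    Complex_Main
    "HOL-Library.Poly_Mapping"
    "HOL-Combinatorics.Permutations"
    "HOL-Algebra.Bij"
begin

section \<open>Star-algebras and C*-algebras\<close>

record 'v cvec = "'v partial_object" +
  vadd :: "'v \<Rightarrow> 'v \<Rightarrow> 'v" (infixl \<open>\<oplus>\<index>\<close> 65)
  vzero :: 'v (\<open>\<zero>\<index>\<close>)
  vscale :: "complex \<Rightarrow> 'v \<Rightarrow> 'v" (infixr \<open>\<odot>\<index>\<close> 75)

definition vdiff :: "('v, 'm) cvec_scheme \<Rightarrow> 'v \<Rightarrow> 'v \<Rightarrow> 'v" (infixl \<open>\<ominus>\<index>\<close> 65)
  where "x \<ominus>\<^bsub>V\<^esub> y = x \<oplus>\<^bsub>V\<^esub> (-1) \<odot>\<^bsub>V\<^esub> y"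

locale complex_vector_space =
  fixes V :: "('v, 'm) cvec_scheme" (structure)
  assumes add_comm_group:
      "comm_group \<lparr>carrier = carrier V, mult = vadd V, one = vzero V\<rparr>"
    and scale_closed: "x \<in> carrier V \<Longrightarrow> c \<odot> x \<in> carrier V"
    and scale_add_right: "\<lbrakk>x \<in> carrier V; y \<in> carrier V\<rbrakk> \<Longrightarrow> c \<odot> (x \<oplus> y) = c \<odot> x \<oplus> c \<odot> y"
    and scale_add_left: "x \<in> carrier V \<Longrightarrow> (c + d) \<odot> x = c \<odot> x \<oplus> d \<odot> x"
    and scale_scale: "x \<in> carrier V \<Longrightarrow> c \<odot> (d \<odot> x) = (c * d) \<odot> x"
    and scale_one: "x \<in> carrier V \<Longrightarrow> 1 \<odot> x = x"

record 'a star_alg = "'a cvec" +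
  amult :: "'a \<Rightarrow> 'a \<Rightarrow> 'a" (infixl \<open>\<otimes>\<index>\<close> 70)
  adj :: "'a \<Rightarrow> 'a" (\<open>(_\<^sup>\<star>\<index>)\<close> [1000] 999)

no_notation mult (infixl \<open>\<otimes>\<index>\<close> 70)

locale star_algebra = complex_vector_space A
  for A :: "('a, 'm) star_alg_scheme" (structure) +
  assumes mult_closed: "\<lbrakk>x \<in> carrier A; y \<in> carrier A\<rbrakk> \<Longrightarrow> x \<otimes> y \<in> carrier A"
    and mult_assoc:
      "\<lbrakk>x \<in> carrier A; y \<in> carrier A; z \<in> carrier A\<rbrakk> \<Longrightarrow> (x \<otimes> y) \<otimes> z = x \<otimes> (y \<otimes> z)"
    and mult_add_left:
      "\<lbrakk>x \<in> carrier A; y \<in> carrier A; z \<in> carrier A\<rbrakk> \<Longrightarrow> (x \<oplus> y) \<otimes> z = x \<otimes> z \<oplus> y \<otimes> z"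
    and mult_add_right:
      "\<lbrakk>x \<in> carrier A; y \<in> carrier A; z \<in> carrier A\<rbrakk> \<Longrightarrow> x \<otimes> (y \<oplus> z) = x \<otimes> y \<oplus> x \<otimes> z"
    and scale_mult_left:
      "\<lbrakk>x \<in> carrier A; y \<in> carrier A\<rbrakk> \<Longrightarrow> (c \<odot> x) \<otimes> y = c \<odot> (x \<otimes> y)"
    and scale_mult_right:
      "\<lbrakk>x \<in> carrier A; y \<in> carrier A\<rbrakk> \<Longrightarrow> x \<otimes> (c \<odot> y) = c \<odot> (x \<otimes> y)"
    and adj_closed: "x \<in> carrier A \<Longrightarrow> x\<^sup>\<star> \<in> carrier A"
    and adj_adj: "x \<in> carrier A \<Longrightarrow> (x\<^sup>\<star>)\<^sup>\<star> = x"
    and adj_add: "\<lbrakk>x \<in> carrier A; y \<in> carrier A\<rbrakk> \<Longrightarrow> (x \<oplus> y)\<^sup>\<star> = x\<^sup>\<star> \<oplus> y\<^sup>\<star>"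
    and adj_scale: "x \<in> carrier A \<Longrightarrow> (c \<odot> x)\<^sup>\<star> = cnj c \<odot> x\<^sup>\<star>"
    and adj_mult: "\<lbrakk>x \<in> carrier A; y \<in> carrier A\<rbrakk> \<Longrightarrow> (x \<otimes> y)\<^sup>\<star> = y\<^sup>\<star> \<otimes> x\<^sup>\<star>"

definition is_unit :: "('a, 'm) star_alg_scheme \<Rightarrow> 'a \<Rightarrow> bool"
  where "is_unit A e \<longleftrightarrow>
    e \<in> carrier A \<and> (\<forall>x\<in>carrier A. e \<otimes>\<^bsub>A\<^esub> x = x \<and> x \<otimes>\<^bsub>A\<^esub> e = x)"

definition unital :: "('a, 'm) star_alg_scheme \<Rightarrow> bool"
  where "unital A \<longleftrightarrow> (\<exists>e. is_unit A e)"

definition unit_of :: "('a, 'm) star_alg_scheme \<Rightarrow> 'a"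
  where "unit_of A = (THE e. is_unit A e)"

record 'a normed_star_alg = "'a star_alg" +
  nrm :: "'a \<Rightarrow> real"

locale cstar_algebra = star_algebra A
  for A :: "('a, 'm) normed_star_alg_scheme" (structure) +
  assumes norm_nonneg: "x \<in> carrier A \<Longrightarrow> 0 \<le> nrm A x"
    and norm_eq_zero: "x \<in> carrier A \<Longrightarrow> nrm A x = 0 \<longleftrightarrow> x = \<zero>"
    and norm_scale: "x \<in> carrier A \<Longrightarrow> nrm A (c \<odot> x) = cmod c * nrm A x"
    and norm_triangle:
      "\<lbrakk>x \<in> carrier A; y \<in> carrier A\<rbrakk> \<Longrightarrow> nrm A (x \<oplus> y) \<le> nrm A x + nrm A y"
    and norm_mult:
      "\<lbrakk>x \<in> carrier A; y \<in> carrier A\<rbrakk> \<Longrightarrow> nrm A (x \<otimes> y) \<le> nrm A x * nrm A y"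
    and cstar_identity: "x \<in> carrier A \<Longrightarrow> nrm A (x\<^sup>\<star> \<otimes> x) = (nrm A x)\<^sup>2"
    and complete:
      "\<lbrakk>\<forall>n. s n \<in> carrier A;
        \<forall>e>0. \<exists>N. \<forall>m\<ge>N. \<forall>n\<ge>N. nrm A (s m \<ominus> s n) < e\<rbrakk>
       \<Longrightarrow> \<exists>x\<in>carrier A. (\<lambda>n. nrm A (s n \<ominus> x)) \<longlonglongrightarrow> 0"

definition star_hom ::
    "('a, 'm) star_alg_scheme \<Rightarrow> ('b, 'n) star_alg_scheme \<Rightarrow> ('a \<Rightarrow> 'b) set"
  where "star_hom A B = {f \<in> carrier A \<rightarrow> carrier B.
    (\<forall>x\<in>carrier A. \<forall>y\<in>carrier A.
       f (x \<oplus>\<^bsub>A\<^esub> y) = f x \<oplus>\<^bsub>B\<^esub> f y \<and> f (x \<otimes>\<^bsub>A\<^esub> y) = f x \<otimes>\<^bsub>B\<^esub> f y) \<and>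
    (\<forall>x\<in>carrier A. (\<forall>c. f (c \<odot>\<^bsub>A\<^esub> x) = c \<odot>\<^bsub>B\<^esub> f x) \<and> f (x\<^sup>\<star>\<^bsub>A\<^esub>) = (f x)\<^sup>\<star>\<^bsub>B\<^esub>)}"

definition star_Aut :: "('a, 'm) star_alg_scheme \<Rightarrow> ('a \<Rightarrow> 'a) monoid"
  where "star_Aut A = BijGroup (carrier A) \<lparr>carrier := star_hom A A \<inter> Bij (carrier A)\<rparr>"

definition quotient_alg :: "('v, 'm) star_alg_scheme \<Rightarrow> ('v \<times> 'v) set \<Rightarrow> 'v set star_alg"
  where "quotient_alg A R =
    \<lparr>carrier = carrier A // R,
     vadd = \<lambda>X Y. \<Union>x\<in>X. \<Union>y\<in>Y. R `` {x \<oplus>\<^bsub>A\<^esub> y},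
     vzero = R `` {\<zero>\<^bsub>A\<^esub>},
     vscale = \<lambda>c X. \<Union>x\<in>X. R `` {c \<odot>\<^bsub>A\<^esub> x},
     amult = \<lambda>X Y. \<Union>x\<in>X. \<Union>y\<in>Y. R `` {x \<otimes>\<^bsub>A\<^esub> y},
     adj = \<lambda>X. \<Union>x\<in>X. R `` {x\<^sup>\<star>\<^bsub>A\<^esub>}\<rparr>"


section \<open>Representations on Hilbert spaces\<close>

record 'h hilb = "'h cvec" +
  hinner :: "'h \<Rightarrow> 'h \<Rightarrow> complex"

definition hnorm :: "('h, 'm) hilb_scheme \<Rightarrow> 'h \<Rightarrow> real"
  where "hnorm H x = sqrt (Re (hinner H x x))"

locale hilbert_space = complex_vector_space H
  for H :: "('h, 'm) hilb_scheme" (structure) +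
  assumes inner_add_left:
      "\<lbrakk>x \<in> carrier H; y \<in> carrier H; z \<in> carrier H\<rbrakk>
       \<Longrightarrow> hinner H (x \<oplus> y) z = hinner H x z + hinner H y z"
    and inner_scale_left:
      "\<lbrakk>x \<in> carrier H; y \<in> carrier H\<rbrakk> \<Longrightarrow> hinner H (c \<odot> x) y = c * hinner H x y"
    and inner_commute:
      "\<lbrakk>x \<in> carrier H; y \<in> carrier H\<rbrakk> \<Longrightarrow> hinner H y x = cnj (hinner H x y)"
    and inner_nonneg: "x \<in> carrier H \<Longrightarrow> 0 \<le> Re (hinner H x x)"
    and inner_eq_zero: "\<lbrakk>x \<in> carrier H; hinner H x x = 0\<rbrakk> \<Longrightarrow> x = \<zero>"
    and complete:
      "\<lbrakk>\<forall>n. s n \<in> carrier H;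
        \<forall>e>0. \<exists>N. \<forall>m\<ge>N. \<forall>n\<ge>N. hnorm H (s m \<ominus> s n) < e\<rbrakk>
       \<Longrightarrow> \<exists>x\<in>carrier H. (\<lambda>n. hnorm H (s n \<ominus> x)) \<longlonglongrightarrow> 0"

definition bounded_op :: "('h, 'm) hilb_scheme \<Rightarrow> ('h \<Rightarrow> 'h) \<Rightarrow> bool"
  where "bounded_op H T \<longleftrightarrow> T \<in> carrier H \<rightarrow> carrier H \<and>
    (\<forall>x\<in>carrier H. \<forall>y\<in>carrier H. T (x \<oplus>\<^bsub>H\<^esub> y) = T x \<oplus>\<^bsub>H\<^esub> T y) \<and>
    (\<forall>x\<in>carrier H. \<forall>c. T (c \<odot>\<^bsub>H\<^esub> x) = c \<odot>\<^bsub>H\<^esub> T x) \<and>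
    (\<exists>C. \<forall>x\<in>carrier H. hnorm H (T x) \<le> C * hnorm H x)"

definition op_norm :: "('h, 'm) hilb_scheme \<Rightarrow> ('h \<Rightarrow> 'h) \<Rightarrow> real"
  where "op_norm H T = Sup {hnorm H (T x) |x. x \<in> carrier H \<and> hnorm H x \<le> 1}"

definition star_rep ::
    "('b, 'm) star_alg_scheme \<Rightarrow> ('h, 'n) hilb_scheme \<Rightarrow> ('b \<Rightarrow> 'h \<Rightarrow> 'h) \<Rightarrow> bool"
  where "star_rep B H \<pi> \<longleftrightarrow> hilbert_space H \<and>
    (\<forall>X\<in>carrier B. bounded_op H (\<pi> X)) \<and>
    (\<forall>X\<in>carrier B. \<forall>Y\<in>carrier B. \<forall>\<xi>\<in>carrier H.
       \<pi> (X \<oplus>\<^bsub>B\<^esub> Y) \<xi> = \<pi> X \<xi> \<oplus>\<^bsub>H\<^esub> \<pi> Y \<xi> \<and> \<pi> (X \<otimes>\<^bsub>B\<^esub> Y) \<xi> = \<pi> X (\<pi> Y \<xi>)) \<and>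
    (\<forall>X\<in>carrier B. \<forall>c. \<forall>\<xi>\<in>carrier H. \<pi> (c \<odot>\<^bsub>B\<^esub> X) \<xi> = c \<odot>\<^bsub>H\<^esub> \<pi> X \<xi>) \<and>
    (\<forall>X\<in>carrier B. \<forall>\<xi>\<in>carrier H. \<forall>\<eta>\<in>carrier H.
       hinner H (\<pi> (X\<^sup>\<star>\<^bsub>B\<^esub>) \<xi>) \<eta> = hinner H \<xi> (\<pi> X \<eta>))"

text \<open>
  A HOL term cannot quantify over Hilbert spaces of all types. The supremum below therefore
  ranges over the Hilbert spaces with carrier inside the type \<^typ>\<open>nat \<Rightarrow> complex \<times> 'b\<close>. This
  loses nothing: for a representation on an arbitrary Hilbert space and a vector \<open>\<xi>\<close>, every
  element of the closed invariant subspace generated by \<open>\<xi>\<close> is a limit of vectors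
  \<open>c\<^sub>n \<xi> + \<pi>(b\<^sub>n) \<xi>\<close> and hence can be named by the sequence of the pairs \<open>(c\<^sub>n, b\<^sub>n)\<close>.
  See \<open>op_norm_le_rep_seminorm\<close> below.
\<close>

definition rep_seminorm :: "('b, 'm) star_alg_scheme \<Rightarrow> 'b \<Rightarrow> real"
  where "rep_seminorm B X =
    Sup {op_norm H (\<pi> X) |(H :: (nat \<Rightarrow> complex \<times> 'b) hilb) \<pi>. star_rep B H \<pi>}"


section \<open>The enveloping C*-algebra\<close>

definition cauchy_alg :: "('b, 'm) star_alg_scheme \<Rightarrow> (nat \<Rightarrow> 'b) star_alg"
  where "cauchy_alg B =
    \<lparr>carrier = {s. (\<forall>n. s n \<in> carrier B) \<and>
       (\<forall>e>0. \<exists>N. \<forall>m\<ge>N. \<forall>n\<ge>N. rep_seminorm B (s m \<ominus>\<^bsub>B\<^esub> s n) < e)},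
     vadd = \<lambda>s t n. s n \<oplus>\<^bsub>B\<^esub> t n,
     vzero = \<lambda>n. \<zero>\<^bsub>B\<^esub>,
     vscale = \<lambda>c s n. c \<odot>\<^bsub>B\<^esub> s n,
     amult = \<lambda>s t n. s n \<otimes>\<^bsub>B\<^esub> t n,
     adj = \<lambda>s n. (s n)\<^sup>\<star>\<^bsub>B\<^esub>\<rparr>"

definition null_rel :: "('b, 'm) star_alg_scheme \<Rightarrow> ((nat \<Rightarrow> 'b) \<times> (nat \<Rightarrow> 'b)) set"
  where "null_rel B = {(s, t). s \<in> carrier (cauchy_alg B) \<and> t \<in> carrier (cauchy_alg B) \<and>
    (\<lambda>n. rep_seminorm B (s n \<ominus>\<^bsub>B\<^esub> t n)) \<longlonglongrightarrow> 0}"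

text \<open>
  Identifying Cauchy sequences of the seminormed algebra at distance zero performs both steps
  at once: it divides by the null ideal and completes the quotient.
\<close>

definition envelope :: "('b, 'm) star_alg_scheme \<Rightarrow> (nat \<Rightarrow> 'b) set normed_star_alg"
  where "envelope B = star_alg.extend (quotient_alg (cauchy_alg B) (null_rel B))
    (normed_star_alg.fields
      (\<lambda>X. the_elem ((\<lambda>s. lim (\<lambda>n. rep_seminorm B (s n))) ` X)))"

definition to_envelope :: "('b, 'm) star_alg_scheme \<Rightarrow> 'b \<Rightarrow> (nat \<Rightarrow> 'b) set"
  where "to_envelope B x = null_rel B `` {\<lambda>n. x}"


section \<open>Algebraic free products\<close>

text \<open>
  A letter \<open>(j, a)\<close> stands for \<open>i\<^sub>j(a)\<close>, and a word \<open>[(j\<^sub>1, a\<^sub>1), \<dots>, (j\<^sub>n, a\<^sub>n)]\<close> with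
  consecutive indices distinct for the elementary tensor \<open>a\<^sub>1 \<otimes> \<dots> \<otimes> a\<^sub>n\<close> in
  \<open>V\<^bsub>j\<^sub>1\<^esub> \<otimes> \<dots> \<otimes> V\<^bsub>j\<^sub>n\<^esub>\<close>.
\<close>

type_synonym ('j, 'a) word = "('j \<times> 'a) list"

definition alt_words :: "('a, 'm) star_alg_scheme \<Rightarrow> 'j set \<Rightarrow> ('j, 'a) word set"
  where "alt_words A J =
    {w. w \<noteq> [] \<and> set w \<subseteq> J \<times> carrier A \<and> distinct_adj (map fst w)}"

definition word_mult ::
    "('a, 'm) star_alg_scheme \<Rightarrow> ('j, 'a) word \<Rightarrow> ('j, 'a) word \<Rightarrow> ('j, 'a) word"
  where "word_mult A u v =
    (if u \<noteq> [] \<and> v \<noteq> [] \<and> fst (last u) = fst (hd v)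
     then butlast u @ (fst (hd v), snd (last u) \<otimes>\<^bsub>A\<^esub> snd (hd v)) # tl v
     else u @ v)"

definition word_adj :: "('a, 'm) star_alg_scheme \<Rightarrow> ('j, 'a) word \<Rightarrow> ('j, 'a) word"
  where "word_adj A w = rev (map (map_prod id (adj A)) w)"

definition fscale :: "complex \<Rightarrow> ('w \<Rightarrow>\<^sub>0 complex) \<Rightarrow> ('w \<Rightarrow>\<^sub>0 complex)"
  where "fscale c = Poly_Mapping.map ((*) c)"

definition word_alg ::
    "('a, 'm) star_alg_scheme \<Rightarrow> ('j, 'a) word set \<Rightarrow> (('j, 'a) word \<Rightarrow>\<^sub>0 complex) star_alg"
  where "word_alg A W =
    \<lparr>carrier = {p. Poly_Mapping.keys p \<subseteq> W},
     vadd = (+),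
     vzero = 0,
     vscale = fscale,
     amult = \<lambda>p q. \<Sum>u\<in>Poly_Mapping.keys p. \<Sum>v\<in>Poly_Mapping.keys q.
       Poly_Mapping.single (word_mult A u v) (Poly_Mapping.lookup p u * Poly_Mapping.lookup q v),
     adj = \<lambda>p. \<Sum>w\<in>Poly_Mapping.keys p. Poly_Mapping.single (word_adj A w) (cnj (Poly_Mapping.lookup p w))\<rparr>"

definition multilinear_rels ::
    "('a, 'm) star_alg_scheme \<Rightarrow> 'j set \<Rightarrow> (('j, 'a) word \<Rightarrow>\<^sub>0 complex) set"
  where "multilinear_rels A J =
    {Poly_Mapping.single (u @ (j, a \<oplus>\<^bsub>A\<^esub> b) # v) 1
       - Poly_Mapping.single (u @ (j, a) # v) 1 - Poly_Mapping.single (u @ (j, b) # v) 1 |u v j a b.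
       u @ (j, a) # v \<in> alt_words A J \<and> b \<in> carrier A} \<union>
    {Poly_Mapping.single (u @ (j, c \<odot>\<^bsub>A\<^esub> a) # v) 1 - Poly_Mapping.single (u @ (j, a) # v) c |u v j a c.
       u @ (j, a) # v \<in> alt_words A J}"

definition unit_rels ::
    "('a, 'm) star_alg_scheme \<Rightarrow> 'j set \<Rightarrow> (('j, 'a) word \<Rightarrow>\<^sub>0 complex) set"
  where "unit_rels A J =
    {Poly_Mapping.single (word_mult A (word_mult A u [(j, unit_of A)]) v) 1
       - Poly_Mapping.single (word_mult A u v) 1 |u v j.
       u \<in> insert [] (alt_words A J) \<and> v \<in> insert [] (alt_words A J) \<and> j \<in> J}"

definition span_rel ::
    "'w set \<Rightarrow> ('w \<Rightarrow>\<^sub>0 complex) set \<Rightarrow> (('w \<Rightarrow>\<^sub>0 complex) \<times> ('w \<Rightarrow>\<^sub>0 complex)) set"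
  where "span_rel W S =
    {(p, q). Poly_Mapping.keys p \<subseteq> W \<and> Poly_Mapping.keys q \<subseteq> W \<and> p - q \<in> module.span fscale S}"

definition free_rel where
  "free_rel A J = span_rel (alt_words A J) (multilinear_rels A J)"

definition free_prod ::
    "('a, 'm) star_alg_scheme \<Rightarrow> 'j set \<Rightarrow> (('j, 'a) word \<Rightarrow>\<^sub>0 complex) set star_alg"
  where "free_prod A J = quotient_alg (word_alg A (alt_words A J)) (free_rel A J)"

text \<open>
  In the unital free product the empty word is the unit. It is the quotient of the unitization
  of the non-unital free product by the ideal generated by all \<open>i\<^sub>j(1) - 1\<close>; the elements of
  \<^const>\<open>unit_rels\<close> span this ideal modulo multilinearity.
\<close>

definition unital_free_rel where
  "unital_free_rel A J =
    span_rel (insert [] (alt_words A J)) (multilinear_rels A J \<union> unit_rels A J)"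

definition unital_free_prod ::
    "('a, 'm) star_alg_scheme \<Rightarrow> 'j set \<Rightarrow> (('j, 'a) word \<Rightarrow>\<^sub>0 complex) set star_alg"
  where "unital_free_prod A J =
    quotient_alg (word_alg A (insert [] (alt_words A J))) (unital_free_rel A J)"

text \<open>The canonical maps \<open>i\<^sub>j\<close> into the two free products.\<close>

definition free_emb where
  "free_emb A J j a = free_rel A J `` {Poly_Mapping.single [(j, a)] 1}"

definition unital_free_emb where
  "unital_free_emb A J j a = unital_free_rel A J `` {Poly_Mapping.single [(j, a)] 1}"

text \<open>
  The maps \<open>\<beta>\<^sup>(\<^sup>0\<^sup>)\<^sub>g\<close>, \<open>\<gamma>\<^sup>(\<^sup>0\<^sup>)\<^sub>g\<close> and \<open>\<rho>\<^sup>(\<^sup>0\<^sup>)\<close>. Their values on the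
  generators \<open>i\<^sub>j(a)\<close> are computed in \<open>free_perm_emb\<close>, \<open>unital_free_perm_emb\<close> and
  \<open>free_proj_emb\<close> below.
\<close>

definition relabel :: "('j \<Rightarrow> 'j) \<Rightarrow> (('j, 'a) word \<Rightarrow>\<^sub>0 complex) \<Rightarrow> (('j, 'a) word \<Rightarrow>\<^sub>0 complex)"
  where "relabel g p = (\<Sum>w\<in>Poly_Mapping.keys p. Poly_Mapping.single (map (map_prod g id) w) (Poly_Mapping.lookup p w))"

definition free_perm where
  "free_perm A J g X = (\<Union>p\<in>X. free_rel A J `` {relabel g p})"

definition unital_free_perm where
  "unital_free_perm A J g X = (\<Union>p\<in>X. unital_free_rel A J `` {relabel g p})"

definition free_proj where
  "free_proj A J X = (\<Union>p\<in>X. unital_free_rel A J `` {p})"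

definition finitary_perms :: "'j set \<Rightarrow> ('j \<Rightarrow> 'j) monoid"
  where "finitary_perms J =
    \<lparr>carrier = {g. g permutes J \<and> finite {j. g j \<noteq> j}}, mult = (\<circ>), one = id\<rparr>"


section \<open>Extension to the enveloping algebras\<close>

definition extends_to_envelope ::
    "('b, 'm) star_alg_scheme \<Rightarrow> ('c, 'n) star_alg_scheme \<Rightarrow> ('b \<Rightarrow> 'c) \<Rightarrow>
     ((nat \<Rightarrow> 'b) set \<Rightarrow> (nat \<Rightarrow> 'c) set) \<Rightarrow> bool"
  where "extends_to_envelope B C f0 f \<longleftrightarrow>
    (\<forall>X\<in>carrier B. f (to_envelope B X) = to_envelope C (f0 X))"

text \<open>
  Maps on carriers are made extensional, as in \<^const>\<open>Bij\<close>, so that unique existence is not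
  spoiled by values outside the carrier.
\<close>

definition extended_action ::
    "('g, 'k) monoid_scheme \<Rightarrow> ('b, 'm) star_alg_scheme \<Rightarrow> ('g \<Rightarrow> 'b \<Rightarrow> 'b) \<Rightarrow>
     ('g \<Rightarrow> (nat \<Rightarrow> 'b) set \<Rightarrow> (nat \<Rightarrow> 'b) set) \<Rightarrow> bool"
  where "extended_action G B \<alpha>0 \<alpha> \<longleftrightarrow>
    \<alpha> \<in> hom G (star_Aut (envelope B)) \<inter> extensional (carrier G) \<and>
    (\<forall>g\<in>carrier G. extends_to_envelope B B (\<alpha>0 g) (\<alpha> g))"

definition extended_hom ::
    "('b, 'm) star_alg_scheme \<Rightarrow> ('c, 'n) star_alg_scheme \<Rightarrow> ('b \<Rightarrow> 'c) \<Rightarrow>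
     ((nat \<Rightarrow> 'b) set \<Rightarrow> (nat \<Rightarrow> 'c) set) \<Rightarrow> bool"
  where "extended_hom B C f0 f \<longleftrightarrow>
    f \<in> star_hom (envelope B) (envelope C) \<inter> extensional (carrier (envelope B)) \<and>
    extends_to_envelope B C f0 f"


section \<open>Values of the algebraic maps on generators\<close>

lemma module_fscale: "module fscale"
  by standard
    (auto intro!: poly_mapping_eqI simp: fscale_def lookup_add map.rep_eq when_def algebra_simps simp flip: distrib_left)

lemma equiv_span_rel: "equiv {p. Poly_Mapping.keys p \<subseteq> W} (span_rel W S)"
proof (rule equivI)
  interpret module fscale by (rule module_fscale)
  show "refl_on {p. Poly_Mapping.keys p \<subseteq> W} (span_rel W S)"
    by (auto simp: refl_on_def span_rel_def span_zero)
  show "sym (span_rel W S)"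
    using span_neg by (force simp: sym_def span_rel_def)
  show "trans (span_rel W S)"
    using span_add by (force simp: trans_def span_rel_def)
qed (auto simp: span_rel_def)

lemma relabel_sum:
  assumes "finite F" "Poly_Mapping.keys p \<subseteq> F"
  shows "relabel g p = (\<Sum>w\<in>F. Poly_Mapping.single (map (map_prod g id) w) (Poly_Mapping.lookup p w))"
  unfolding relabel_def using assms by (intro sum.mono_neutral_left) (auto simp: in_keys_iff)

lemma relabel_diff: "relabel g (p - q) = relabel g p - relabel g q"
  using keys_diff[of p q]
  by (simp add: relabel_sum[of "Poly_Mapping.keys p \<union> Poly_Mapping.keys q"]
      lookup_minus single_diff sum_subtractf)

lemma relabel_add: "relabel g (p + q) = relabel g p + relabel g q"
  using Poly_Mapping.keys_add[of p q]
  by (simp add: relabel_sum[of "Poly_Mapping.keys p \<union> Poly_Mapping.keys q"]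
      lookup_add single_add sum.distrib)

lemma fscale_single: "fscale c (Poly_Mapping.single w a) = Poly_Mapping.single w (c * a)"
  by (simp add: fscale_def map_single)

lemma fscale_sum: "fscale c (sum f F) = (\<Sum>w\<in>F. fscale c (f w))"
proof -
  interpret module fscale by (rule module_fscale)
  show ?thesis by (rule scale_sum_right)
qed

lemma lookup_fscale: "Poly_Mapping.lookup (fscale c p) w = c * Poly_Mapping.lookup p w"
  by (simp add: fscale_def map.rep_eq when_def)

lemma keys_fscale: "Poly_Mapping.keys (fscale c p) \<subseteq> Poly_Mapping.keys p"
  by (auto simp: in_keys_iff fscale_def map.rep_eq when_def)

lemma relabel_fscale: "relabel g (fscale c p) = fscale c (relabel g p)"
  by (subst relabel_sum[OF finite_keys keys_fscale])
    (auto simp: relabel_def fscale_sum fscale_single lookup_fscale intro!: sum.cong)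

lemma relabel_single [simp]:
  "relabel g (Poly_Mapping.single w c) = Poly_Mapping.single (map (map_prod g id) w) c"
  by (simp add: relabel_def)

lemma relabel_span:
  assumes "relabel g ` S \<subseteq> S" "p \<in> module.span fscale S"
  shows "relabel g p \<in> module.span fscale S"
proof -
  interpret module fscale by (rule module_fscale)
  interpret module_hom fscale fscale "relabel g"
    by standard (simp_all add: relabel_add relabel_fscale)
  have "relabel g p \<in> span (relabel g ` S)" using assms(2) span_image by blast
  then show ?thesis using span_mono[OF assms(1)] by blast
qed

lemma relabel_span_rel:
  assumes "map (map_prod g id) ` W \<subseteq> W" "relabel g ` S \<subseteq> S" "(p, q) \<in> span_rel W S"
  shows "(relabel g p, relabel g q) \<in> span_rel W S"
proof -
  have "Poly_Mapping.keys (relabel g r) \<subseteq> W" if "Poly_Mapping.keys r \<subseteq> W" for r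
  proof -
    have "Poly_Mapping.keys (relabel g r) \<subseteq> map (map_prod g id) ` Poly_Mapping.keys r"
      unfolding relabel_def
      by (rule order_trans[OF keys_sum]) (auto split: if_splits)
    then show ?thesis using assms(1) that by blast
  qed
  then show ?thesis
    using assms relabel_span[of g S "p - q"] by (auto simp: span_rel_def relabel_diff)
qed

lemma relabel_class:
  assumes "map (map_prod g id) ` W \<subseteq> W" "relabel g ` S \<subseteq> S" "Poly_Mapping.keys p \<subseteq> W"
  shows "(\<Union>q\<in>span_rel W S `` {p}. span_rel W S `` {relabel g q}) = span_rel W S `` {relabel g p}"
proof (rule UN_equiv_class[OF equiv_span_rel])
  show "(\<lambda>q. span_rel W S `` {relabel g q}) respects span_rel W S"
    unfolding congruent_def
  proof (intro ballI, clarify)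
    fix q r assume "(q, r) \<in> span_rel W S"
    then show "span_rel W S `` {relabel g q} = span_rel W S `` {relabel g r}"
      by (intro equiv_class_eq[OF equiv_span_rel] relabel_span_rel[OF assms(1,2)])
  qed
qed (use assms in auto)

lemma relabel_alt_words:
  assumes "g permutes J" shows "map (map_prod g id) w \<in> alt_words A J \<longleftrightarrow> w \<in> alt_words A J"
proof -
  have "inj g" using assms by (rule permutes_inj)
  then have "distinct_adj (map g (map fst w)) \<longleftrightarrow> distinct_adj (map fst w)"
    by (intro distinct_adj_map_iff) (auto intro: inj_on_subset)
  moreover have "map_prod g id ` set w \<subseteq> J \<times> carrier A \<longleftrightarrow> set w \<subseteq> J \<times> carrier A"
    by (force simp: image_subset_iff permutes_in_image[OF assms])
  ultimately show ?thesis
    by (simp add: alt_words_def)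
qed

lemma relabel_word_mult:
  assumes "inj g"
  shows "map (map_prod g id) (word_mult A u v) =
    word_mult A (map (map_prod g id) u) (map (map_prod g id) v)"
  using assms by (auto simp: word_mult_def last_map hd_map map_butlast map_tl inj_eq)

lemma relabel_multilinear_rels:
  fixes A :: "('a, 'm) star_alg_scheme"
  assumes g: "g permutes J" shows "relabel g ` multilinear_rels A J \<subseteq> multilinear_rels A J"
proof (rule image_subsetI)
  let ?m = "map (map_prod g id)"
  have al: "?m u @ (g j, a) # ?m v \<in> alt_words A J"
    if "u @ (j, a) # v \<in> alt_words A J" for u j v and a :: 'a
    using relabel_alt_words[OF g, of "u @ (j, a) # v" A] that by simp
  fix p assume "p \<in> multilinear_rels A J"
  then consider
    (add) u v j a b where "u @ (j, a) # v \<in> alt_words A J" "b \<in> carrier A"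
      "p = Poly_Mapping.single (u @ (j, a \<oplus>\<^bsub>A\<^esub> b) # v) 1
         - Poly_Mapping.single (u @ (j, a) # v) 1 - Poly_Mapping.single (u @ (j, b) # v) 1"
  | (scale) u v j a c where "u @ (j, a) # v \<in> alt_words A J"
      "p = Poly_Mapping.single (u @ (j, c \<odot>\<^bsub>A\<^esub> a) # v) 1 - Poly_Mapping.single (u @ (j, a) # v) c"
    unfolding multilinear_rels_def by blast
  then show "relabel g p \<in> multilinear_rels A J"
  proof cases
    case add
    have "relabel g p = Poly_Mapping.single (?m u @ (g j, a \<oplus>\<^bsub>A\<^esub> b) # ?m v) 1
         - Poly_Mapping.single (?m u @ (g j, a) # ?m v) 1 - Poly_Mapping.single (?m u @ (g j, b) # ?m v) 1"
      by (simp add: add(3) relabel_diff)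
    with al[OF add(1)] add(2) show ?thesis unfolding multilinear_rels_def by blast
  next
    case scale
    have "relabel g p = Poly_Mapping.single (?m u @ (g j, c \<odot>\<^bsub>A\<^esub> a) # ?m v) 1
         - Poly_Mapping.single (?m u @ (g j, a) # ?m v) c"
      by (simp add: scale(2) relabel_diff)
    with al[OF scale(1)] show ?thesis unfolding multilinear_rels_def by blast
  qed
qed

lemma relabel_unit_rels:
  assumes g: "g permutes J" shows "relabel g ` unit_rels A J \<subseteq> unit_rels A J"
proof (rule image_subsetI)
  let ?m = "map (map_prod g id)"
  fix p assume "p \<in> unit_rels A J"
  then obtain u v j where uvj: "u \<in> insert [] (alt_words A J)" "v \<in> insert [] (alt_words A J)" "j \<in> J"
    and p: "p = Poly_Mapping.single (word_mult A (word_mult A u [(j, unit_of A)]) v) 1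
       - Poly_Mapping.single (word_mult A u v) 1"
    unfolding unit_rels_def by blast
  have "relabel g p = Poly_Mapping.single (word_mult A (word_mult A (?m u) [(g j, unit_of A)]) (?m v)) 1
       - Poly_Mapping.single (word_mult A (?m u) (?m v)) 1"
    by (simp add: p relabel_diff relabel_word_mult[OF permutes_inj[OF g]])
  moreover have "?m w \<in> insert [] (alt_words A J)" if "w \<in> insert [] (alt_words A J)" for w
    using that relabel_alt_words[OF g, of w A] by auto
  moreover have "g j \<in> J" using uvj permutes_in_image[OF g] by simp
  ultimately show "relabel g p \<in> unit_rels A J"
    using uvj unfolding unit_rels_def by blast
qed

lemma letter_alt_words: "\<lbrakk>j \<in> J; a \<in> carrier A\<rbrakk> \<Longrightarrow> [(j, a)] \<in> alt_words A J"
  by (simp add: alt_words_def)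

lemma free_perm_emb:
  assumes "g permutes J" "j \<in> J" "a \<in> carrier A"
  shows "free_perm A J g (free_emb A J j a) = free_emb A J (g j) a"
proof -
  have "map (map_prod g id) ` alt_words A J \<subseteq> alt_words A J"
    using relabel_alt_words[OF assms(1)] by blast
  from relabel_class[OF this relabel_multilinear_rels[OF assms(1)], of "Poly_Mapping.single [(j, a)] 1"]
  show ?thesis
    using letter_alt_words[OF assms(2,3)] by (simp add: free_perm_def free_emb_def free_rel_def)
qed

lemma unital_free_perm_emb:
  assumes "g permutes J" "j \<in> J" "a \<in> carrier A"
  shows "unital_free_perm A J g (unital_free_emb A J j a) = unital_free_emb A J (g j) a"
proof -
  have W: "map (map_prod g id) ` insert [] (alt_words A J) \<subseteq> insert [] (alt_words A J)"
    using relabel_alt_words[OF assms(1)] by auto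
  have S: "relabel g ` (multilinear_rels A J \<union> unit_rels A J) \<subseteq> multilinear_rels A J \<union> unit_rels A J"
    using relabel_multilinear_rels[OF assms(1)] relabel_unit_rels[OF assms(1)] by blast
  from relabel_class[OF W S, of "Poly_Mapping.single [(j, a)] 1"]
  show ?thesis
    using letter_alt_words[OF assms(2,3)]
    by (simp add: unital_free_perm_def unital_free_emb_def unital_free_rel_def)
qed

lemma free_proj_emb:
  assumes "j \<in> J" "a \<in> carrier A"
  shows "free_proj A J (free_emb A J j a) = unital_free_emb A J j a"
proof -
  interpret module fscale by (rule module_fscale)
  have sub: "free_rel A J \<subseteq> unital_free_rel A J"
    using span_mono[of "multilinear_rels A J" "multilinear_rels A J \<union> unit_rels A J"]
    by (auto simp: free_rel_def unital_free_rel_def span_rel_def)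
  have eq: "unital_free_rel A J `` {p} = unital_free_emb A J j a" if "p \<in> free_emb A J j a" for p
  proof -
    have "(Poly_Mapping.single [(j, a)] 1, p) \<in> unital_free_rel A J"
      using that sub by (auto simp: free_emb_def)
    then show ?thesis
      unfolding unital_free_emb_def unital_free_rel_def
      by (rule equiv_class_eq[OF equiv_span_rel, symmetric])
  qed
  have "Poly_Mapping.single [(j, a)] 1 \<in> free_emb A J j a"
    using letter_alt_words[OF assms] by (simp add: free_emb_def free_rel_def span_rel_def span_zero)
  with eq show ?thesis by (auto simp: free_proj_def)
qed


section \<open>The seminorm dominates representations on arbitrary Hilbert spaces\<close>

lemma (in group) group_l_cancel_iff:
  "\<lbrakk>x \<in> carrier G; y \<in> carrier G; z \<in> carrier G\<rbrakk> \<Longrightarrow> (mult G x y = mult G x z) = (y = z)"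
  by simp

context complex_vector_space
begin

lemma add_closed: "\<lbrakk>x \<in> carrier V; y \<in> carrier V\<rbrakk> \<Longrightarrow> x \<oplus> y \<in> carrier V"
  using comm_group.axioms(2)[OF add_comm_group, THEN group.is_monoid, THEN monoid.m_closed] by simp

lemma zero_closed: "\<zero> \<in> carrier V"
  using comm_group.axioms(2)[OF add_comm_group, THEN group.is_monoid, THEN monoid.one_closed] by simp

lemma add_assoc:
  "\<lbrakk>x \<in> carrier V; y \<in> carrier V; z \<in> carrier V\<rbrakk> \<Longrightarrow> (x \<oplus> y) \<oplus> z = x \<oplus> (y \<oplus> z)"
  using comm_group.axioms(2)[OF add_comm_group, THEN group.is_monoid, THEN monoid.m_assoc] by simp

lemma add_zero: "x \<in> carrier V \<Longrightarrow> x \<oplus> \<zero> = x"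
  using comm_group.axioms(2)[OF add_comm_group, THEN group.is_monoid, THEN monoid.r_one] by simp

lemma add_commute: "\<lbrakk>x \<in> carrier V; y \<in> carrier V\<rbrakk> \<Longrightarrow> x \<oplus> y = y \<oplus> x"
  using comm_group.axioms(1)[OF add_comm_group, THEN comm_monoid.m_comm] by simp

lemma add_left_cancel:
  "\<lbrakk>x \<in> carrier V; y \<in> carrier V; z \<in> carrier V; x \<oplus> y = x \<oplus> z\<rbrakk> \<Longrightarrow> y = z"
  using comm_group.axioms(2)[OF add_comm_group, THEN group.group_l_cancel_iff] by simp

lemma scale_zero_left: "x \<in> carrier V \<Longrightarrow> 0 \<odot> x = \<zero>"
  using add_left_cancel[of "0 \<odot> x" "0 \<odot> x" "\<zero>"] scale_add_left[of x 0 0]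
  by (simp add: scale_closed zero_closed add_zero)

lemma add_neg: "x \<in> carrier V \<Longrightarrow> x \<oplus> (-1) \<odot> x = \<zero>"
  using scale_add_left[of x 1 "-1"] by (simp add: scale_one scale_zero_left)

lemma diff_closed: "\<lbrakk>x \<in> carrier V; y \<in> carrier V\<rbrakk> \<Longrightarrow> x \<ominus> y \<in> carrier V"
  by (simp add: vdiff_def add_closed scale_closed)

lemma add_lcomm:
  "\<lbrakk>x \<in> carrier V; y \<in> carrier V; z \<in> carrier V\<rbrakk> \<Longrightarrow> x \<oplus> (y \<oplus> z) = y \<oplus> (x \<oplus> z)"
  by (metis add_assoc add_commute)

lemmas add_ac = add_assoc add_commute add_lcomm

lemma diff_eq_zero: "\<lbrakk>x \<in> carrier V; y \<in> carrier V; x \<ominus> y = \<zero>\<rbrakk> \<Longrightarrow> x = y"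
  unfolding vdiff_def
  by (metis add_left_cancel add_neg add_commute scale_closed)

lemma diff_add_diff:
  assumes "x \<in> carrier V" "y \<in> carrier V" "z \<in> carrier V"
  shows "x \<ominus> z = (x \<ominus> y) \<oplus> (y \<ominus> z)"
proof -
  have "(x \<ominus> y) \<oplus> (y \<ominus> z) = (x \<oplus> (-1) \<odot> z) \<oplus> (y \<oplus> (-1) \<odot> y)"
    unfolding vdiff_def using assms by (simp add: add_ac add_closed scale_closed)
  then show ?thesis
    using assms by (simp add: vdiff_def add_neg add_zero add_closed scale_closed)
qed

lemma add_diff_add:
  "\<lbrakk>x \<in> carrier V; y \<in> carrier V; x' \<in> carrier V; y' \<in> carrier V\<rbrakk>
   \<Longrightarrow> (x \<oplus> y) \<ominus> (x' \<oplus> y') = (x \<ominus> x') \<oplus> (y \<ominus> y')"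
  by (simp add: vdiff_def add_ac add_closed scale_closed scale_add_right)

lemma scale_diff:
  "\<lbrakk>x \<in> carrier V; y \<in> carrier V\<rbrakk> \<Longrightarrow> c \<odot> x \<ominus> c \<odot> y = c \<odot> (x \<ominus> y)"
  by (simp add: vdiff_def scale_closed scale_add_right scale_scale mult.commute)

end

context hilbert_space
begin

lemma inner_add_right:
  "\<lbrakk>x \<in> carrier H; y \<in> carrier H; z \<in> carrier H\<rbrakk>
   \<Longrightarrow> hinner H z (x \<oplus> y) = hinner H z x + hinner H z y"
  by (metis add_closed complex_cnj_add inner_add_left inner_commute)

lemma inner_scale_right:
  "\<lbrakk>x \<in> carrier H; y \<in> carrier H\<rbrakk> \<Longrightarrow> hinner H y (c \<odot> x) = cnj c * hinner H y x"
  by (metis scale_closed complex_cnj_mult inner_scale_left inner_commute)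

lemma inner_self: "x \<in> carrier H \<Longrightarrow> hinner H x x = complex_of_real ((hnorm H x)\<^sup>2)"
  using inner_commute[of x x] inner_nonneg[of x]
  by (auto simp: hnorm_def complex_eq_iff)

lemma hnorm_nonneg: "x \<in> carrier H \<Longrightarrow> 0 \<le> hnorm H x"
  by (simp add: hnorm_def inner_nonneg)

lemma hnorm_scale: "x \<in> carrier H \<Longrightarrow> hnorm H (c \<odot> x) = cmod c * hnorm H x"
proof -
  assume x: "x \<in> carrier H"
  have "hinner H (c \<odot> x) (c \<odot> x) = (c * cnj c) * hinner H x x"
    using x by (simp add: inner_scale_left inner_scale_right scale_closed)
  also have "\<dots> = complex_of_real ((cmod c * hnorm H x)\<^sup>2)"
    using x by (simp only: inner_self complex_norm_square[symmetric]) (simp add: power_mult_distrib)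
  finally show ?thesis
    using x by (simp add: hnorm_def[of H "c \<odot> x"] hnorm_nonneg)
qed

lemma cauchy_schwarz:
  assumes "x \<in> carrier H" "y \<in> carrier H"
  shows "cmod (hinner H x y) \<le> hnorm H x * hnorm H y"
proof (cases "hnorm H y = 0")
  case True
  then have "y = \<zero>" using assms by (simp add: inner_self inner_eq_zero)
  then have "hinner H x y = 0"
    using inner_scale_right[of y x 0] assms by (simp add: scale_zero_left zero_closed)
  then show ?thesis using True by simp
next
  case False
  define t where "t = hinner H x y / complex_of_real ((hnorm H y)\<^sup>2)"
  define z where "z = x \<oplus> (- t) \<odot> y"
  have z: "z \<in> carrier H" using assms by (simp add: z_def add_closed scale_closed)
  have n: "complex_of_real ((hnorm H y)\<^sup>2) \<noteq> 0" using False by simp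
  have "hinner H z y = 0"
    using assms n by (simp add: z_def inner_add_left inner_scale_left scale_closed inner_self t_def)
  then have "hinner H z z = hinner H z x"
    using assms z
    by (subst (2) z_def) (simp add: inner_add_right inner_scale_right scale_closed)
  also have "\<dots> = hinner H x x - t * cnj (hinner H x y)"
    using assms by (simp add: z_def inner_add_left inner_scale_left scale_closed inner_commute[of x y])
  also have "\<dots> = complex_of_real ((hnorm H x)\<^sup>2 - (cmod (hinner H x y))\<^sup>2 / (hnorm H y)\<^sup>2)"
    using assms by (simp only: inner_self t_def) (simp add: complex_norm_square[symmetric])
  finally have "0 \<le> (hnorm H x)\<^sup>2 - (cmod (hinner H x y))\<^sup>2 / (hnorm H y)\<^sup>2"
    using inner_nonneg[OF z] by simp
  then have "(cmod (hinner H x y))\<^sup>2 \<le> (hnorm H x * hnorm H y)\<^sup>2"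
    using False by (simp add: field_simps power_mult_distrib)
  then show ?thesis
    using assms by (auto intro: power2_le_imp_le simp: hnorm_nonneg)
qed

lemma hnorm_triangle:
  assumes "x \<in> carrier H" "y \<in> carrier H"
  shows "hnorm H (x \<oplus> y) \<le> hnorm H x + hnorm H y"
proof -
  have "(hnorm H (x \<oplus> y))\<^sup>2 = Re (hinner H (x \<oplus> y) (x \<oplus> y))"
    using assms by (simp add: inner_self add_closed)
  also have "\<dots> = (hnorm H x)\<^sup>2 + (hnorm H y)\<^sup>2 + 2 * Re (hinner H x y)"
    using assms
    by (simp add: inner_add_left inner_add_right add_closed inner_commute[of x y]) (simp add: inner_self)
  also have "\<dots> \<le> (hnorm H x)\<^sup>2 + (hnorm H y)\<^sup>2 + 2 * (hnorm H x * hnorm H y)"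
    using cauchy_schwarz[OF assms] complex_Re_le_cmod[of "hinner H x y"] by linarith
  also have "\<dots> = (hnorm H x + hnorm H y)\<^sup>2" by (simp add: power2_sum)
  finally show ?thesis
    using assms by (auto intro: power2_le_imp_le simp: hnorm_nonneg)
qed

lemma hnorm_zero: "hnorm H \<zero> = 0"
  using hnorm_scale[OF zero_closed, of 0] by (simp add: scale_zero_left zero_closed)

lemma hnorm_eq_zero: "\<lbrakk>x \<in> carrier H; hnorm H x = 0\<rbrakk> \<Longrightarrow> x = \<zero>"
  by (simp add: inner_self inner_eq_zero)

lemma hnorm_diff_triangle:
  "\<lbrakk>x \<in> carrier H; y \<in> carrier H; z \<in> carrier H\<rbrakk>
   \<Longrightarrow> hnorm H (x \<ominus> z) \<le> hnorm H (x \<ominus> y) + hnorm H (y \<ominus> z)"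
  by (metis diff_add_diff diff_closed hnorm_triangle)

lemma hnorm_diff_commute:
  assumes "x \<in> carrier H" "y \<in> carrier H"
  shows "hnorm H (x \<ominus> y) = hnorm H (y \<ominus> x)"
proof -
  have "x \<ominus> y = (-1) \<odot> (y \<ominus> x)"
    using assms
    by (simp add: vdiff_def scale_add_right scale_closed scale_scale scale_one add_commute)
  then show ?thesis using assms by (simp add: hnorm_scale diff_closed)
qed

text \<open>Closed subspaces, transported along an injection, are Hilbert spaces.\<close>

definition transport :: "('h \<Rightarrow> 'k) \<Rightarrow> 'h set \<Rightarrow> 'k hilb"
  where "transport c K = (let d = inv_into K c in
    \<lparr>carrier = c ` K, vadd = \<lambda>u v. c (d u \<oplus> d v), vzero = c \<zero>,
     vscale = \<lambda>a u. c (a \<odot> d u), hinner = \<lambda>u v. hinner H (d u) (d v)\<rparr>)"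

lemma hilbert_space_transport:
  fixes c :: "'h \<Rightarrow> 'k"
  assumes c: "inj_on c K" and K: "K \<subseteq> carrier H" "\<zero> \<in> K"
    and Ka: "\<And>x y. x \<in> K \<Longrightarrow> y \<in> K \<Longrightarrow> x \<oplus> y \<in> K"
    and Ks: "\<And>x a. x \<in> K \<Longrightarrow> a \<odot> x \<in> K"
    and Kc: "\<And>s x. (\<And>n. s n \<in> K) \<Longrightarrow> x \<in> carrier H \<Longrightarrow> (\<lambda>n. hnorm H (s n \<ominus> x)) \<longlonglongrightarrow> 0 \<Longrightarrow> x \<in> K"
  shows "hilbert_space (transport c K)"
proof -
  let ?d = "inv_into K c"
  let ?T = "transport c K"
  have d: "?d (c x) = x" if "x \<in> K" for x using c that by simp
  have KH: "x \<in> carrier H" if "x \<in> K" for x using K that by auto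
  have T: "carrier ?T = c ` K" "vadd ?T = (\<lambda>u v. c (?d u \<oplus> ?d v))" "vzero ?T = c \<zero>"
    "vscale ?T = (\<lambda>a u. c (a \<odot> ?d u))" "hinner ?T = (\<lambda>u v. hinner H (?d u) (?d v))"
    by (simp_all add: transport_def Let_def)
  note sm = T d Ka Ks K(2) KH
  have hn: "hnorm ?T u = hnorm H (?d u)" for u by (simp add: hnorm_def T)
  have Kd: "x \<ominus> y \<in> K" if "x \<in> K" "y \<in> K" for x y using that by (simp add: vdiff_def Ka Ks)
  have df: "c x \<ominus>\<^bsub>?T\<^esub> c y = c (x \<ominus> y)" if "x \<in> K" "y \<in> K" for x y
    using that by (simp add: vdiff_def sm)
  have vs: "complex_vector_space ?T"
  proof (rule complex_vector_space.intro)
    show "comm_group \<lparr>carrier = carrier ?T, mult = vadd ?T, one = vzero ?T\<rparr>"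
    proof (rule comm_groupI, goal_cases)
      case (3 x y z)
      then show ?case by (auto simp: sm add_assoc)
    next
      case (6 x)
      then obtain k where k: "k \<in> K" "x = c k" by (auto simp: T)
      show ?case
        using k by (intro bexI[of _ "c ((-1) \<odot> k)"])
          (auto simp: sm add_neg add_commute scale_closed)
    qed (auto simp: sm add_closed add_assoc add_zero zero_closed add_commute)
  qed (auto simp: sm scale_add_right scale_add_left scale_scale scale_one)
  show ?thesis
  proof (rule hilbert_space.intro[OF vs], rule hilbert_space_axioms.intro)
    fix s :: "nat \<Rightarrow> 'k"
    assume s: "\<forall>n. s n \<in> carrier ?T"
      and cs: "\<forall>e>0. \<exists>N. \<forall>m\<ge>N. \<forall>n\<ge>N. hnorm ?T (s m \<ominus>\<^bsub>?T\<^esub> s n) < e"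
    define r where "r n = ?d (s n)" for n
    have r: "r n \<in> K" "s n = c (r n)" for n
      using s by (auto simp: T r_def f_inv_into_f inv_into_into)
    have "\<forall>e>0. \<exists>N. \<forall>m\<ge>N. \<forall>n\<ge>N. hnorm H (r m \<ominus> r n) < e"
      using cs by (simp add: r df hn d Kd)
    then obtain x where x: "x \<in> carrier H" "(\<lambda>n. hnorm H (r n \<ominus> x)) \<longlonglongrightarrow> 0"
      using complete[of r] r(1) KH by auto
    then have "x \<in> K" using Kc[of r x] r by auto
    with x show "\<exists>x\<in>carrier ?T. (\<lambda>n. hnorm ?T (s n \<ominus>\<^bsub>?T\<^esub> x)) \<longlonglongrightarrow> 0"
      by (intro bexI[of _ "c x"]) (auto simp: r df hn d Kd T)
  next
    fix x assume "x \<in> carrier ?T" "hinner ?T x x = 0"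
    then obtain k where k: "k \<in> K" "x = c k" "hinner H (?d (c k)) (?d (c k)) = 0"
      by (auto simp only: T)
    then have "k = \<zero>" using inner_eq_zero[OF KH[OF k(1)]] by (simp only: d[OF k(1)])
    then show "x = vzero ?T" by (simp only: k(2) T(3))
  next
    fix x y assume "x \<in> carrier ?T" "y \<in> carrier ?T"
    then show "hinner ?T y x = cnj (hinner ?T x y)"
      unfolding T by (auto simp: d intro!: inner_commute KH)
  qed (auto simp: sm inner_add_left inner_scale_left inner_nonneg)
qed

end


lemma squeeze_zero:
  fixes f g :: "nat \<Rightarrow> real"
  assumes "g \<longlonglongrightarrow> 0" "\<And>n. 0 \<le> f n" "\<And>n. f n \<le> g n"
  shows "f \<longlonglongrightarrow> 0"
  using assms by (intro tendsto_sandwich[of "\<lambda>_. 0" f _ g]) auto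

lemma op_norm_le_rep_seminorm:
  fixes B :: "('b, 'm) star_alg_scheme" and H :: "('h, 'n) hilb_scheme"
  assumes B: "star_algebra B" and rep: "star_rep B H \<pi>" and X: "X \<in> carrier B"
    and bdd: "bdd_above {op_norm H' (\<pi>' X) |(H' :: (nat \<Rightarrow> complex \<times> 'b) hilb) \<pi>'. star_rep B H' \<pi>'}"
  shows "op_norm H (\<pi> X) \<le> rep_seminorm B X"
proof -
  interpret B: star_algebra B by (rule B)
  interpret H: hilbert_space H using rep by (simp add: star_rep_def)
  have bop: "bounded_op H (\<pi> Y)" if "Y \<in> carrier B" for Y using rep that by (simp add: star_rep_def)
  have pc: "\<pi> Y \<eta> \<in> carrier H" if "Y \<in> carrier B" "\<eta> \<in> carrier H" for Y \<eta>
    using bop[OF that(1)] that(2) by (auto simp: bounded_op_def)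
  have pa: "\<pi> Y (\<eta> \<oplus>\<^bsub>H\<^esub> \<zeta>) = \<pi> Y \<eta> \<oplus>\<^bsub>H\<^esub> \<pi> Y \<zeta>"
    if "Y \<in> carrier B" "\<eta> \<in> carrier H" "\<zeta> \<in> carrier H" for Y \<eta> \<zeta>
    using bop[OF that(1)] that(2,3) by (auto simp: bounded_op_def)
  have ps: "\<pi> Y (c \<odot>\<^bsub>H\<^esub> \<eta>) = c \<odot>\<^bsub>H\<^esub> \<pi> Y \<eta>"
    if "Y \<in> carrier B" "\<eta> \<in> carrier H" for Y \<eta> c
    using bop[OF that(1)] that(2) by (auto simp: bounded_op_def)
  have Ba: "\<pi> (Y \<oplus>\<^bsub>B\<^esub> Z) \<eta> = \<pi> Y \<eta> \<oplus>\<^bsub>H\<^esub> \<pi> Z \<eta>" "\<pi> (Y \<otimes>\<^bsub>B\<^esub> Z) \<eta> = \<pi> Y (\<pi> Z \<eta>)"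
    if "Y \<in> carrier B" "Z \<in> carrier B" "\<eta> \<in> carrier H" for Y Z \<eta>
    using rep that by (auto simp: star_rep_def)
  have Bs: "\<pi> (c \<odot>\<^bsub>B\<^esub> Y) \<eta> = c \<odot>\<^bsub>H\<^esub> \<pi> Y \<eta>" if "Y \<in> carrier B" "\<eta> \<in> carrier H" for Y \<eta> c
    using rep that by (auto simp: star_rep_def)
  have Bt: "hinner H (\<pi> (Y\<^sup>\<star>\<^bsub>B\<^esub>) \<eta>) \<zeta> = hinner H \<eta> (\<pi> Y \<zeta>)"
    if "Y \<in> carrier B" "\<eta> \<in> carrier H" "\<zeta> \<in> carrier H" for Y \<eta> \<zeta>
    using rep that by (auto simp: star_rep_def)
  have bound: "hnorm H (\<pi> X \<xi>) \<le> rep_seminorm B X" if \<xi>: "\<xi> \<in> carrier H" "hnorm H \<xi> \<le> 1" for \<xi>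
  proof -
    define v where "v p = fst p \<odot>\<^bsub>H\<^esub> \<xi> \<oplus>\<^bsub>H\<^esub> \<pi> (snd p) \<xi>" for p
    define P where "P = (UNIV :: complex set) \<times> carrier B"
    have vc: "v p \<in> carrier H" if "p \<in> P" for p
      using that \<xi> pc by (auto simp: v_def P_def intro!: H.add_closed H.scale_closed)
    define names where "names \<eta> s \<longleftrightarrow> (\<forall>n. s n \<in> P) \<and> (\<lambda>n. hnorm H (v (s n) \<ominus>\<^bsub>H\<^esub> \<eta>)) \<longlonglongrightarrow> 0" for \<eta> s
    define K where "K = {\<eta> \<in> carrier H. \<exists>s. names \<eta> s}"
    define c where "c \<eta> = (SOME s. names \<eta> s)" for \<eta>
    have cn: "names \<eta> (c \<eta>)" if "\<eta> \<in> K" for \<eta>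
      using that unfolding c_def K_def by (metis (mono_tags, lifting) mem_Collect_eq someI)
    have KH: "\<eta> \<in> carrier H" if "\<eta> \<in> K" for \<eta> using that by (simp add: K_def)
    have inj: "inj_on c K"
    proof (rule inj_onI)
      fix \<eta> \<zeta> assume a: "\<eta> \<in> K" "\<zeta> \<in> K" "c \<eta> = c \<zeta>"
      let ?s = "c \<eta>"
      have s: "\<And>n. ?s n \<in> P" "(\<lambda>n. hnorm H (v (?s n) \<ominus>\<^bsub>H\<^esub> \<eta>)) \<longlonglongrightarrow> 0"
        "(\<lambda>n. hnorm H (v (?s n) \<ominus>\<^bsub>H\<^esub> \<zeta>)) \<longlonglongrightarrow> 0"
        using cn[OF a(1)] cn[OF a(2)] a(3) by (auto simp: names_def)
      have "(\<lambda>n. hnorm H (v (?s n) \<ominus>\<^bsub>H\<^esub> \<eta>) + hnorm H (v (?s n) \<ominus>\<^bsub>H\<^esub> \<zeta>)) \<longlonglongrightarrow> 0 + 0"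
        by (intro tendsto_add s)
      moreover have "hnorm H (\<eta> \<ominus>\<^bsub>H\<^esub> \<zeta>) \<le> hnorm H (v (?s n) \<ominus>\<^bsub>H\<^esub> \<eta>) + hnorm H (v (?s n) \<ominus>\<^bsub>H\<^esub> \<zeta>)" for n
        using H.hnorm_diff_triangle[of \<eta> "v (?s n)" \<zeta>] H.hnorm_diff_commute[of \<eta> "v (?s n)"]
          vc[OF s(1)] KH a by simp
      ultimately have "hnorm H (\<eta> \<ominus>\<^bsub>H\<^esub> \<zeta>) \<le> 0"
        by (intro LIMSEQ_le_const[of _ 0]) auto
      then have "hnorm H (\<eta> \<ominus>\<^bsub>H\<^esub> \<zeta>) = 0"
        using H.hnorm_nonneg[of "\<eta> \<ominus>\<^bsub>H\<^esub> \<zeta>"] KH a by (simp add: H.diff_closed)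
      then show "\<eta> = \<zeta>"
        using H.hnorm_eq_zero[of "\<eta> \<ominus>\<^bsub>H\<^esub> \<zeta>"] H.diff_eq_zero[of \<eta> \<zeta>] KH a by (simp add: H.diff_closed)
    qed
    have vP: "v p \<in> K" if "p \<in> P" for p
      using that vc[OF that] H.diff_add_diff
      by (auto simp: K_def names_def vdiff_def H.add_neg H.hnorm_zero intro!: exI[of _ "\<lambda>_. p"])
    have vadd: "v p \<oplus>\<^bsub>H\<^esub> v q = v (fst p + fst q, snd p \<oplus>\<^bsub>B\<^esub> snd q)" if "p \<in> P" "q \<in> P" for p q
      using that \<xi> by (auto simp: v_def P_def Ba H.scale_add_left H.add_ac H.add_closed H.scale_closed pc)
    have vscale: "a \<odot>\<^bsub>H\<^esub> v p = v (a * fst p, a \<odot>\<^bsub>B\<^esub> snd p)" if "p \<in> P" for p a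
      using that \<xi> by (auto simp: v_def P_def Bs H.scale_add_right H.scale_scale H.scale_closed pc)
    have Bzero: "\<pi> \<zero>\<^bsub>B\<^esub> \<xi> = \<zero>\<^bsub>H\<^esub>"
      using Bs[OF B.zero_closed \<xi>(1), of 0] B.scale_zero_left[OF B.zero_closed]
        H.scale_zero_left pc[OF B.zero_closed \<xi>(1)] by simp
    have vact: "\<pi> Y (v p) = v (0, fst p \<odot>\<^bsub>B\<^esub> Y \<oplus>\<^bsub>B\<^esub> Y \<otimes>\<^bsub>B\<^esub> snd p)"
      if "Y \<in> carrier B" "p \<in> P" for Y p
      using that \<xi>
      by (auto simp: v_def P_def Ba Bs pa ps pc H.scale_closed H.scale_zero_left H.zero_closed
          H.add_closed B.scale_closed B.mult_closed H.add_zero H.add_commute[of "\<zero>\<^bsub>H\<^esub>"])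
    have K0: "\<zero>\<^bsub>H\<^esub> \<in> K"
      using vP[of "(0, \<zero>\<^bsub>B\<^esub>)"] \<xi>
      by (simp add: v_def P_def B.zero_closed Bzero H.scale_zero_left H.add_zero H.zero_closed)
    have \<xi>K: "\<xi> \<in> K"
      using vP[of "(1, \<zero>\<^bsub>B\<^esub>)"] \<xi>
      by (simp add: v_def P_def B.zero_closed Bzero H.scale_one H.add_zero)
    have Ka: "\<eta> \<oplus>\<^bsub>H\<^esub> \<zeta> \<in> K" if "\<eta> \<in> K" "\<zeta> \<in> K" for \<eta> \<zeta>
    proof -
      from that obtain s t where st: "names \<eta> s" "names \<zeta> t" by (auto simp: K_def)
      define r where "r n = (fst (s n) + fst (t n), snd (s n) \<oplus>\<^bsub>B\<^esub> snd (t n))" for n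
      have P: "s n \<in> P" "t n \<in> P" "r n \<in> P" for n
        using st by (auto simp: names_def r_def P_def mem_Times_iff intro!: B.add_closed)
      have "(\<lambda>n. hnorm H (v (s n) \<ominus>\<^bsub>H\<^esub> \<eta>) + hnorm H (v (t n) \<ominus>\<^bsub>H\<^esub> \<zeta>)) \<longlonglongrightarrow> 0 + 0"
        using st by (intro tendsto_add) (auto simp: names_def)
      moreover have "hnorm H (v (r n) \<ominus>\<^bsub>H\<^esub> (\<eta> \<oplus>\<^bsub>H\<^esub> \<zeta>))
          \<le> hnorm H (v (s n) \<ominus>\<^bsub>H\<^esub> \<eta>) + hnorm H (v (t n) \<ominus>\<^bsub>H\<^esub> \<zeta>)" for n
        unfolding r_def vadd[OF P(1,2), symmetric]
        using that vc[OF P(1)] vc[OF P(2)] KH by (subst H.add_diff_add) (auto intro!: H.hnorm_triangle H.diff_closed)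
      moreover have "0 \<le> hnorm H (v (r n) \<ominus>\<^bsub>H\<^esub> (\<eta> \<oplus>\<^bsub>H\<^esub> \<zeta>))" for n
        by (intro H.hnorm_nonneg H.diff_closed H.add_closed vc P KH that)
      ultimately have "(\<lambda>n. hnorm H (v (r n) \<ominus>\<^bsub>H\<^esub> (\<eta> \<oplus>\<^bsub>H\<^esub> \<zeta>))) \<longlonglongrightarrow> 0"
        using squeeze_zero by simp
      then have "names (\<eta> \<oplus>\<^bsub>H\<^esub> \<zeta>) r" using P by (simp add: names_def)
      then show ?thesis using H.add_closed[OF KH[OF that(1)] KH[OF that(2)]] unfolding K_def by blast
    qed
    have Ks: "a \<odot>\<^bsub>H\<^esub> \<eta> \<in> K" if "\<eta> \<in> K" for \<eta> a
    proof -
      from that obtain s where s: "names \<eta> s" by (auto simp: K_def)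
      define r where "r n = (a * fst (s n), a \<odot>\<^bsub>B\<^esub> snd (s n))" for n
      have P: "s n \<in> P" "r n \<in> P" for n
        using s by (auto simp: names_def r_def P_def mem_Times_iff intro!: B.scale_closed)
      have "(\<lambda>n. cmod a * hnorm H (v (s n) \<ominus>\<^bsub>H\<^esub> \<eta>)) \<longlonglongrightarrow> cmod a * 0"
        using s by (intro tendsto_mult) (auto simp: names_def)
      moreover have "hnorm H (v (r n) \<ominus>\<^bsub>H\<^esub> (a \<odot>\<^bsub>H\<^esub> \<eta>)) = cmod a * hnorm H (v (s n) \<ominus>\<^bsub>H\<^esub> \<eta>)" for n
        unfolding r_def vscale[OF P(1), symmetric]
        using that vc[OF P(1)] KH by (simp add: H.scale_diff H.hnorm_scale H.diff_closed)
      ultimately have "names (a \<odot>\<^bsub>H\<^esub> \<eta>) r" using P by (simp add: names_def)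
      then show ?thesis using H.scale_closed[OF KH[OF that]] unfolding K_def by blast
    qed
    have Kc: "\<eta> \<in> K" if s: "\<And>n. s n \<in> K" and \<eta>: "\<eta> \<in> carrier H"
      and lim: "(\<lambda>n. hnorm H (s n \<ominus>\<^bsub>H\<^esub> \<eta>)) \<longlonglongrightarrow> 0" for s \<eta>
    proof -
      have "\<exists>p. p \<in> P \<and> hnorm H (v p \<ominus>\<^bsub>H\<^esub> s n) < inverse (real (Suc n))" for n
      proof -
        from s[of n] obtain t where t: "names (s n) t" by (auto simp: K_def)
        then have "eventually (\<lambda>m. hnorm H (v (t m) \<ominus>\<^bsub>H\<^esub> s n) < inverse (real (Suc n))) sequentially"
          by (intro order_tendstoD(2)[of _ 0]) (auto simp: names_def)
        then obtain m where "hnorm H (v (t m) \<ominus>\<^bsub>H\<^esub> s n) < inverse (real (Suc n))"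
          using eventually_happens'[OF sequentially_bot] by blast
        with t show ?thesis by (intro exI[of _ "t m"]) (simp add: names_def)
      qed
      then obtain p where p: "\<And>n. p n \<in> P"
        "\<And>n. hnorm H (v (p n) \<ominus>\<^bsub>H\<^esub> s n) < inverse (real (Suc n))" by metis
      have "(\<lambda>n. inverse (real (Suc n)) + hnorm H (s n \<ominus>\<^bsub>H\<^esub> \<eta>)) \<longlonglongrightarrow> 0 + 0"
        by (intro tendsto_add lim LIMSEQ_inverse_real_of_nat)
      moreover have "hnorm H (v (p n) \<ominus>\<^bsub>H\<^esub> \<eta>) \<le> inverse (real (Suc n)) + hnorm H (s n \<ominus>\<^bsub>H\<^esub> \<eta>)" for n
        using H.hnorm_diff_triangle[of "v (p n)" "s n" \<eta>] p(2)[of n] vc[OF p(1)] KH[OF s] \<eta>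
        by (smt (verit))
      moreover have "0 \<le> hnorm H (v (p n) \<ominus>\<^bsub>H\<^esub> \<eta>)" for n
        by (intro H.hnorm_nonneg H.diff_closed vc p \<eta>)
      ultimately have "(\<lambda>n. hnorm H (v (p n) \<ominus>\<^bsub>H\<^esub> \<eta>)) \<longlonglongrightarrow> 0"
        using squeeze_zero by simp
      then have "names \<eta> p" using p by (simp add: names_def)
      then show ?thesis using \<eta> unfolding K_def by blast
    qed
    have Kp: "\<pi> Y \<eta> \<in> K" if Y: "Y \<in> carrier B" and \<eta>: "\<eta> \<in> K" for Y \<eta>
    proof -
      from \<eta> obtain s where s: "names \<eta> s" by (auto simp: K_def)
      then have P: "s n \<in> P" for n by (simp add: names_def)
      obtain C where C: "\<And>x. x \<in> carrier H \<Longrightarrow> hnorm H (\<pi> Y x) \<le> C * hnorm H x"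
        using bop[OF Y] unfolding bounded_op_def by blast
      have eq: "\<pi> Y (v (s n)) \<ominus>\<^bsub>H\<^esub> \<pi> Y \<eta> = \<pi> Y (v (s n) \<ominus>\<^bsub>H\<^esub> \<eta>)" for n
        using Y vc[OF P] KH[OF \<eta>] by (simp add: vdiff_def pa ps H.scale_closed)
      have "(\<lambda>n. C * hnorm H (v (s n) \<ominus>\<^bsub>H\<^esub> \<eta>)) \<longlonglongrightarrow> C * 0"
        using s by (intro tendsto_mult) (auto simp: names_def)
      moreover have "0 \<le> hnorm H (\<pi> Y (v (s n)) \<ominus>\<^bsub>H\<^esub> \<pi> Y \<eta>)" for n
        by (intro H.hnorm_nonneg H.diff_closed pc Y vc P KH \<eta>)
      moreover have "hnorm H (\<pi> Y (v (s n)) \<ominus>\<^bsub>H\<^esub> \<pi> Y \<eta>) \<le> C * hnorm H (v (s n) \<ominus>\<^bsub>H\<^esub> \<eta>)" for n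
        unfolding eq by (intro C H.diff_closed vc P KH \<eta>)
      ultimately have lim: "(\<lambda>n. hnorm H (\<pi> Y (v (s n)) \<ominus>\<^bsub>H\<^esub> \<pi> Y \<eta>)) \<longlonglongrightarrow> 0"
        using squeeze_zero by simp
      have "\<pi> Y (v (s n)) \<in> K" for n
        unfolding vact[OF Y P] using Y P[of n]
        by (intro vP) (auto simp: P_def mem_Times_iff intro!: B.add_closed B.scale_closed B.mult_closed)
      then show ?thesis using Kc[OF _ pc[OF Y KH[OF \<eta>]] lim] by blast
    qed
    let ?T = "H.transport c K"
    let ?d = "inv_into K c"
    define \<pi>' where "\<pi>' Y u = c (\<pi> Y (?d u))" for Y u
    have d: "?d (c x) = x" if "x \<in> K" for x using inj that by simp
    have T: "carrier ?T = c ` K" "vadd ?T = (\<lambda>u v. c (?d u \<oplus>\<^bsub>H\<^esub> ?d v))"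
      "vscale ?T = (\<lambda>a u. c (a \<odot>\<^bsub>H\<^esub> ?d u))" "hinner ?T = (\<lambda>u v. hinner H (?d u) (?d v))"
      by (simp_all add: H.transport_def Let_def)
    have hn: "hnorm ?T u = hnorm H (?d u)" for u by (simp add: hnorm_def T)
    have hT: "hilbert_space ?T"
      by (rule H.hilbert_space_transport[OF inj _ K0 Ka Ks Kc]) (auto dest: KH)
    have bT: "bounded_op ?T (\<pi>' Y)" if Y: "Y \<in> carrier B" for Y
    proof -
      obtain C where "\<And>x. x \<in> carrier H \<Longrightarrow> hnorm H (\<pi> Y x) \<le> C * hnorm H x"
        using bop[OF Y] unfolding bounded_op_def by blast
      then show ?thesis
        using Y unfolding bounded_op_def
        by (auto simp: T hn \<pi>'_def d Ka Ks Kp KH pa ps intro!: exI[of _ C])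
    qed
    have repT: "star_rep B ?T \<pi>'"
      using hT bT unfolding star_rep_def
      by (auto simp: T \<pi>'_def d Ka Ks Kp KH Ba Bs Bt B.adj_closed)
    have "hnorm H (\<pi> X \<xi>) = hnorm ?T (\<pi>' X (c \<xi>))"
      by (simp add: hn \<pi>'_def d \<xi>K Kp X)
    also have "\<dots> \<le> op_norm ?T (\<pi>' X)"
      unfolding op_norm_def
    proof (rule cSup_upper)
      show "hnorm ?T (\<pi>' X (c \<xi>)) \<in> {hnorm ?T (\<pi>' X x) |x. x \<in> carrier ?T \<and> hnorm ?T x \<le> 1}"
        using \<xi> \<xi>K by (auto simp: T hn d)
      obtain C where C: "\<And>x. x \<in> carrier ?T \<Longrightarrow> hnorm ?T (\<pi>' X x) \<le> C * hnorm ?T x"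
        using bT[OF X] unfolding bounded_op_def by blast
      have "hnorm ?T (\<pi>' X x) \<le> \<bar>C\<bar>" if "x \<in> carrier ?T" "hnorm ?T x \<le> 1" for x
      proof -
        have "C * hnorm ?T x \<le> \<bar>C\<bar> * hnorm ?T x"
          using that hilbert_space.hnorm_nonneg[OF hT] by (intro mult_right_mono) auto
        also have "\<dots> \<le> \<bar>C\<bar> * 1" using that by (intro mult_left_mono) auto
        finally show ?thesis using C[OF that(1)] by simp
      qed
      then show "bdd_above {hnorm ?T (\<pi>' X x) |x. x \<in> carrier ?T \<and> hnorm ?T x \<le> 1}"
        by (intro bdd_aboveI[of _ "\<bar>C\<bar>"]) auto
    qed
    also have "\<dots> \<le> rep_seminorm B X"
      unfolding rep_seminorm_def using repT by (intro cSup_upper bdd) blast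
    finally show ?thesis .
  qed
  show ?thesis
    unfolding op_norm_def
    using bound H.zero_closed H.hnorm_zero by (intro cSup_least) (auto intro!: exI[of _ "\<zero>\<^bsub>H\<^esub>"])
qed

end

theory Submission
  imports Defs
begin

text \<open>
  Write \<open>E(B)\<close> for the enveloping C*-algebra of a *-algebra \<open>B\<close>, with norm
  \<open>sup {\<parallel>\<pi>(X)\<parallel> | \<pi> a *-representation}\<close>. The theorem is an instance of the fact that \<open>E\<close> is a
  functor on *-algebras with finite universal seminorm and preserves surjections, applied to the maps \<open>\<beta>\<^sup>(\<^sup>0\<^sup>)\<^sub>g\<close>, \<open>\<gamma>\<^sup>(\<^sup>0\<^sup>)\<^sub>g\<close>
  and \<open>\<rho>\<^sup>(\<^sup>0\<^sup>)\<close>.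

  Extensions exist because a *-homomorphism \<open>f : B \<rightarrow> C\<close> pulls representations of \<open>C\<close> back to \<open>B\<close> and
  is therefore contractive for the universal seminorms. They are unique because every *-homomorphism
  from a C*-algebra to \<open>E(C)\<close> is automatically contractive (\<open>hom_to_envelope_contractive\<close>), so that
  two of them agree as soon as they agree on the dense image of \<open>B\<close>. Uniqueness then yields the group
  law, bijectivity and \<open>\<rho> \<circ> \<beta>\<^sub>g = \<gamma>\<^sub>g \<circ> \<rho>\<close>, since these identities hold on the algebraic free products.

  Automatic contractivity is usually deduced from the spectral radius formula. Here it comes from a
  square root: for \<open>\<parallel>x\<parallel> < 1\<close> a fixed point argument produces \<open>b\<close> with
  \<open>1 - x\<^sup>\<star> x = (1 - b)\<^sup>\<star> (1 - b)\<close> (\<open>exists_root_one_minus_square\<close>), and in every representation this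
  forces \<open>\<parallel>\<pi>(x) \<xi>\<parallel> \<le> \<parallel>\<xi>\<parallel>\<close>. The same fact bounds \<open>\<parallel>\<pi>(i\<^sub>j(a))\<parallel>\<close> by \<open>\<parallel>a\<parallel>\<close>, and since the letters
  \<open>i\<^sub>j(a)\<close> generate the free products, their universal seminorms are finite
  (\<open>bounded_word_quotient\<close>).

  For surjectivity of \<open>E(f)\<close>, when \<open>f : B \<rightarrow> C\<close> is onto, the norm of lifts has to be controlled; the
  usual argument, that *-homomorphisms of C*-algebras have closed range, needs functional calculus. The
  replacement is the map \<open>z \<mapsto> z - z z\<^sup>\<star> z / R\<^sup>2\<close>, which halves the bound on elements of norm at most \<open>R\<close>
  but hardly moves elements of norm at most 1 when \<open>R\<close> is large. Applied repeatedly to a lift of \<open>y\<close> with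
  \<open>\<parallel>y\<parallel> \<le> 1\<close>, it produces an approximate lift of norm at most 2 (\<open>shrink_lift\<close>), and a
  series of such corrections gives preimages in the completion (\<open>envelope_map_surj\<close>).

  It remains to see that the two free products are *-algebras: the words form a *-semigroup under
  merging concatenation, and the multilinearity and unit relations span *-ideals of its semigroup
  algebra. For \<open>J \<noteq> {}\<close> the projection \<open>\<rho>\<^sup>(\<^sup>0\<^sup>)\<close> is onto because the unit equals \<open>i\<^sub>j(1)\<close>.
\<close>

section \<open>Star-homomorphisms and quotient star-algebras\<close>

context star_algebra
begin

lemma mult_diff_left:
  "\<lbrakk>x \<in> carrier A; y \<in> carrier A; z \<in> carrier A\<rbrakk> \<Longrightarrow> (x \<ominus> y) \<otimes> z = x \<otimes> z \<ominus> y \<otimes> z"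
  by (simp add: vdiff_def mult_add_left scale_mult_left scale_closed)

lemma mult_diff_right:
  "\<lbrakk>x \<in> carrier A; y \<in> carrier A; z \<in> carrier A\<rbrakk> \<Longrightarrow> x \<otimes> (y \<ominus> z) = x \<otimes> y \<ominus> x \<otimes> z"
  by (simp add: vdiff_def mult_add_right scale_mult_right scale_closed)

lemma adj_diff: "\<lbrakk>x \<in> carrier A; y \<in> carrier A\<rbrakk> \<Longrightarrow> (x \<ominus> y)\<^sup>\<star> = x\<^sup>\<star> \<ominus> y\<^sup>\<star>"
  by (simp add: vdiff_def adj_add adj_scale scale_closed)

lemma mult_diff_mult:
  assumes "x \<in> carrier A" "y \<in> carrier A" "x' \<in> carrier A" "y' \<in> carrier A"
  shows "x \<otimes> y \<ominus> x' \<otimes> y' = x \<otimes> (y \<ominus> y') \<oplus> (x \<ominus> x') \<otimes> y'"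
  using assms diff_add_diff[of "x \<otimes> y" "x \<otimes> y'" "x' \<otimes> y'"]
  by (simp add: mult_diff_left mult_diff_right mult_closed)

end

lemma star_homI:
  assumes "\<And>x. x \<in> carrier A \<Longrightarrow> f x \<in> carrier B"
    and "\<And>x y. \<lbrakk>x \<in> carrier A; y \<in> carrier A\<rbrakk> \<Longrightarrow> f (x \<oplus>\<^bsub>A\<^esub> y) = f x \<oplus>\<^bsub>B\<^esub> f y"
    and "\<And>x y. \<lbrakk>x \<in> carrier A; y \<in> carrier A\<rbrakk> \<Longrightarrow> f (x \<otimes>\<^bsub>A\<^esub> y) = f x \<otimes>\<^bsub>B\<^esub> f y"
    and "\<And>x c. x \<in> carrier A \<Longrightarrow> f (c \<odot>\<^bsub>A\<^esub> x) = c \<odot>\<^bsub>B\<^esub> f x"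
    and "\<And>x. x \<in> carrier A \<Longrightarrow> f (x\<^sup>\<star>\<^bsub>A\<^esub>) = (f x)\<^sup>\<star>\<^bsub>B\<^esub>"
  shows "f \<in> star_hom A B"
  using assms by (auto simp: star_hom_def)

lemma star_homD:
  assumes "f \<in> star_hom A B"
  shows "\<And>x. x \<in> carrier A \<Longrightarrow> f x \<in> carrier B"
    and "\<And>x y. \<lbrakk>x \<in> carrier A; y \<in> carrier A\<rbrakk> \<Longrightarrow> f (x \<oplus>\<^bsub>A\<^esub> y) = f x \<oplus>\<^bsub>B\<^esub> f y"
    and "\<And>x y. \<lbrakk>x \<in> carrier A; y \<in> carrier A\<rbrakk> \<Longrightarrow> f (x \<otimes>\<^bsub>A\<^esub> y) = f x \<otimes>\<^bsub>B\<^esub> f y"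
    and "\<And>x c. x \<in> carrier A \<Longrightarrow> f (c \<odot>\<^bsub>A\<^esub> x) = c \<odot>\<^bsub>B\<^esub> f x"
    and "\<And>x. x \<in> carrier A \<Longrightarrow> f (x\<^sup>\<star>\<^bsub>A\<^esub>) = (f x)\<^sup>\<star>\<^bsub>B\<^esub>"
  using assms by (auto simp: star_hom_def)

lemma star_hom_cong:
  assumes "star_algebra A" "f \<in> star_hom A B" "\<And>x. x \<in> carrier A \<Longrightarrow> g x = f x"
  shows "g \<in> star_hom A B"
proof -
  interpret star_algebra A by fact
  show ?thesis
    using star_homD[OF assms(2)] assms(3)
    by (intro star_homI) (simp_all add: add_closed mult_closed scale_closed adj_closed)
qed

lemma star_hom_comp:
  assumes "f \<in> star_hom A B" "g \<in> star_hom B C"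
  shows "(\<lambda>x. g (f x)) \<in> star_hom A C"
  using star_homD[OF assms(1)] star_homD[OF assms(2)] by (intro star_homI) simp_all

lemma star_hom_diff:
  assumes "star_algebra A" "f \<in> star_hom A B" "x \<in> carrier A" "y \<in> carrier A"
  shows "f (x \<ominus>\<^bsub>A\<^esub> y) = f x \<ominus>\<^bsub>B\<^esub> f y"
proof -
  interpret star_algebra A by fact
  show ?thesis using assms star_homD[OF assms(2)] by (simp add: vdiff_def scale_closed)
qed

locale star_congruence = star_algebra A for A :: "('a, 'm) star_alg_scheme" (structure) +
  fixes R :: "('a \<times> 'a) set"
  assumes equiv: "equiv (carrier A) R"
    and add_cong: "\<lbrakk>(x, x') \<in> R; (y, y') \<in> R\<rbrakk> \<Longrightarrow> (x \<oplus> y, x' \<oplus> y') \<in> R"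
    and mult_cong: "\<lbrakk>(x, x') \<in> R; (y, y') \<in> R\<rbrakk> \<Longrightarrow> (x \<otimes> y, x' \<otimes> y') \<in> R"
    and scale_cong: "(x, x') \<in> R \<Longrightarrow> (c \<odot> x, c \<odot> x') \<in> R"
    and adj_cong: "(x, x') \<in> R \<Longrightarrow> (x\<^sup>\<star>, x'\<^sup>\<star>) \<in> R"
begin

lemma quotient_carrier: "carrier (quotient_alg A R) = (\<lambda>x. R `` {x}) ` carrier A"
  by (auto simp: quotient_alg_def quotient_def)

lemma class_closed: "x \<in> carrier A \<Longrightarrow> R `` {x} \<in> carrier (quotient_alg A R)"
  by (simp add: quotient_carrier)

lemma class_eqI: "(x, y) \<in> R \<Longrightarrow> R `` {x} = R `` {y}"
  by (rule equiv_class_eq[OF equiv])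

lemma quotient_zero: "vzero (quotient_alg A R) = R `` {\<zero>}"
  by (simp add: quotient_alg_def)

lemma quotient_add:
  assumes "x \<in> carrier A" "y \<in> carrier A"
  shows "R `` {x} \<oplus>\<^bsub>quotient_alg A R\<^esub> R `` {y} = R `` {x \<oplus> y}"
  unfolding quotient_alg_def
  using UN_equiv_class2[OF equiv equiv congruent2I'[of R R "\<lambda>x y. R `` {x \<oplus> y}"] assms]
  by (simp add: class_eqI add_cong)

lemma quotient_mult:
  assumes "x \<in> carrier A" "y \<in> carrier A"
  shows "R `` {x} \<otimes>\<^bsub>quotient_alg A R\<^esub> R `` {y} = R `` {x \<otimes> y}"
  unfolding quotient_alg_def
  using UN_equiv_class2[OF equiv equiv congruent2I'[of R R "\<lambda>x y. R `` {x \<otimes> y}"] assms]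
  by (simp add: class_eqI mult_cong)

lemma quotient_scale:
  assumes "x \<in> carrier A"
  shows "c \<odot>\<^bsub>quotient_alg A R\<^esub> R `` {x} = R `` {c \<odot> x}"
  unfolding quotient_alg_def
  using UN_equiv_class[OF equiv congruentI[of R "\<lambda>x. R `` {c \<odot> x}"] assms]
  by (simp add: class_eqI scale_cong)

lemma quotient_adj:
  assumes "x \<in> carrier A"
  shows "(R `` {x})\<^sup>\<star>\<^bsub>quotient_alg A R\<^esub> = R `` {x\<^sup>\<star>}"
  unfolding quotient_alg_def
  using UN_equiv_class[OF equiv congruentI[of R "\<lambda>x. R `` {x\<^sup>\<star>}"] assms]
  by (simp add: class_eqI adj_cong)

lemmas quotient_simps = quotient_zero quotient_add quotient_mult quotient_scale quotient_adj

lemma star_algebra_quotient: "star_algebra (quotient_alg A R)"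
proof (intro star_algebra.intro complex_vector_space.intro star_algebra_axioms.intro)
  let ?Q = "quotient_alg A R"
  show "comm_group \<lparr>carrier = carrier ?Q, mult = vadd ?Q, one = vzero ?Q\<rparr>"
  proof (rule comm_groupI, goal_cases)
    case (4 x y)
    then obtain a b where "a \<in> carrier A" "b \<in> carrier A" "x = R `` {a}" "y = R `` {b}"
      by (auto simp: quotient_carrier)
    then show ?case by (simp add: quotient_add add_commute)
  next
    case (6 x)
    then obtain k where k: "k \<in> carrier A" "x = R `` {k}" by (auto simp: quotient_carrier)
    show ?case
      using k by (intro bexI[of _ "R `` {(-1) \<odot> k}"])
        (auto simp: quotient_simps class_closed scale_closed add_neg add_commute)
  qed (auto simp: quotient_carrier quotient_simps add_closed zero_closed add_assoc add_zero
      add_commute[of \<zero>])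
qed (auto simp: quotient_carrier quotient_simps add_closed mult_closed scale_closed adj_closed
    scale_add_right scale_add_left scale_scale scale_one mult_assoc mult_add_left mult_add_right
    scale_mult_left scale_mult_right adj_adj adj_add adj_scale adj_mult)

end

lemma quotient_hom_class:
  assumes "star_congruence A R" "star_congruence B S"
    and resp: "\<And>x y. (x, y) \<in> R \<Longrightarrow> (h x, h y) \<in> S" and "x \<in> carrier A"
  shows "(\<Union>y\<in>R `` {x}. S `` {h y}) = S `` {h x}"
proof -
  interpret A: star_congruence A R by fact
  interpret B: star_congruence B S by fact
  show ?thesis
    using UN_equiv_class[OF A.equiv congruentI[of R "\<lambda>x. S `` {h x}"] assms(4)]
    by (simp add: B.class_eqI resp)
qed

lemma quotient_hom:
  assumes "star_congruence A R" "star_congruence B S" "h \<in> star_hom A B"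
    and resp: "\<And>x y. (x, y) \<in> R \<Longrightarrow> (h x, h y) \<in> S"
  shows "(\<lambda>X. \<Union>x\<in>X. S `` {h x}) \<in> star_hom (quotient_alg A R) (quotient_alg B S)"
proof -
  interpret A: star_congruence A R by fact
  interpret B: star_congruence B S by fact
  note h = star_homD[OF assms(3)]
  show ?thesis
    by (intro star_homI; unfold A.quotient_carrier; elim imageE;
      simp add: B.class_closed A.quotient_simps B.quotient_simps h
        A.add_closed A.mult_closed A.scale_closed A.adj_closed
        quotient_hom_class[OF assms(1,2) resp])
qed


section \<open>C*-seminorms\<close>

text \<open>
  The norm of a C*-algebra is of this kind, and so is the universal seminorm of a *-algebra before
  separation and completion.
\<close>

locale cstar_seminorm = star_algebra A for A :: "('a, 'm) star_alg_scheme" (structure) +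
  fixes p :: "'a \<Rightarrow> real"
  assumes p_scale: "x \<in> carrier A \<Longrightarrow> p (c \<odot> x) = cmod c * p x"
    and p_triangle: "\<lbrakk>x \<in> carrier A; y \<in> carrier A\<rbrakk> \<Longrightarrow> p (x \<oplus> y) \<le> p x + p y"
    and p_mult: "\<lbrakk>x \<in> carrier A; y \<in> carrier A\<rbrakk> \<Longrightarrow> p (x \<otimes> y) \<le> p x * p y"
    and p_cstar: "x \<in> carrier A \<Longrightarrow> p (x\<^sup>\<star> \<otimes> x) = (p x)\<^sup>2"
begin

lemma p_zero: "p \<zero> = 0"
  using p_scale[OF zero_closed, of 0] by (simp add: scale_zero_left zero_closed)

lemma p_nonneg: "x \<in> carrier A \<Longrightarrow> 0 \<le> p x"
  using p_triangle[of x "(-1) \<odot> x"] by (simp add: scale_closed add_neg p_zero p_scale)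

lemma p_adj: assumes "x \<in> carrier A" shows "p (x\<^sup>\<star>) = p x"
proof -
  have le: "p y \<le> p (y\<^sup>\<star>)" if "y \<in> carrier A" for y
  proof (cases "p y = 0")
    case False
    have "p y * p y \<le> p (y\<^sup>\<star>) * p y"
      using p_mult[OF adj_closed[OF that] that] p_cstar[OF that] by (simp add: power2_eq_square)
    then show ?thesis using False p_nonneg[OF that] by (simp add: mult_le_cancel_right)
  qed (simp add: that p_nonneg adj_closed)
  show ?thesis using le[OF assms] le[OF adj_closed[OF assms]] assms by (simp add: adj_adj)
qed

lemma p_diff_self: "x \<in> carrier A \<Longrightarrow> p (x \<ominus> x) = 0"
  by (simp add: vdiff_def add_neg p_zero)

lemma p_diff_commute:
  assumes "x \<in> carrier A" "y \<in> carrier A"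
  shows "p (x \<ominus> y) = p (y \<ominus> x)"
proof -
  have "x \<ominus> y = (-1) \<odot> (y \<ominus> x)"
    using assms
    by (simp add: vdiff_def scale_add_right scale_closed scale_scale scale_one add_commute)
  then show ?thesis using assms by (simp add: p_scale diff_closed)
qed

lemma p_diff_triangle:
  "\<lbrakk>x \<in> carrier A; y \<in> carrier A; z \<in> carrier A\<rbrakk> \<Longrightarrow> p (x \<ominus> z) \<le> p (x \<ominus> y) + p (y \<ominus> z)"
  by (metis diff_add_diff diff_closed p_triangle)

lemma diff_add_cancel: "\<lbrakk>x \<in> carrier A; y \<in> carrier A\<rbrakk> \<Longrightarrow> (x \<ominus> y) \<oplus> y = x"
  by (simp add: vdiff_def add_assoc scale_closed add_commute[of "(-1) \<odot> y"] add_neg add_zero)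

lemma p_le_diff: "\<lbrakk>x \<in> carrier A; y \<in> carrier A\<rbrakk> \<Longrightarrow> p x \<le> p (x \<ominus> y) + p y"
  by (metis diff_add_cancel diff_closed p_triangle)

lemma p_reverse_triangle:
  "\<lbrakk>x \<in> carrier A; y \<in> carrier A\<rbrakk> \<Longrightarrow> \<bar>p x - p y\<bar> \<le> p (x \<ominus> y)"
  using p_le_diff[of x y] p_le_diff[of y x] p_diff_commute[of x y] by linarith

lemma p_add_diff_add:
  assumes "x \<in> carrier A" "y \<in> carrier A" "x' \<in> carrier A" "y' \<in> carrier A"
  shows "p ((x \<oplus> y) \<ominus> (x' \<oplus> y')) \<le> p (x \<ominus> x') + p (y \<ominus> y')"
  using assms by (simp add: add_diff_add p_triangle diff_closed)

lemma p_scale_diff: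
  "\<lbrakk>x \<in> carrier A; y \<in> carrier A\<rbrakk> \<Longrightarrow> p (c \<odot> x \<ominus> c \<odot> y) = cmod c * p (x \<ominus> y)"
  by (simp add: scale_diff p_scale diff_closed)

lemma p_adj_diff: "\<lbrakk>x \<in> carrier A; y \<in> carrier A\<rbrakk> \<Longrightarrow> p (x\<^sup>\<star> \<ominus> y\<^sup>\<star>) = p (x \<ominus> y)"
  by (simp add: p_adj diff_closed flip: adj_diff)

lemma p_mult_diff_mult:
  assumes "x \<in> carrier A" "y \<in> carrier A" "x' \<in> carrier A" "y' \<in> carrier A"
  shows "p (x \<otimes> y \<ominus> x' \<otimes> y') \<le> p x * p (y \<ominus> y') + p (x \<ominus> x') * p y'"
proof -
  have "p (x \<otimes> y \<ominus> x' \<otimes> y') \<le> p (x \<otimes> (y \<ominus> y')) + p ((x \<ominus> x') \<otimes> y')"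
    using assms by (simp add: mult_diff_mult p_triangle mult_closed diff_closed)
  also have "\<dots> \<le> p x * p (y \<ominus> y') + p (x \<ominus> x') * p y'"
    using assms by (intro add_mono p_mult diff_closed)
  finally show ?thesis .
qed

end

lemma (in cstar_algebra) cstar_seminorm_nrm: "cstar_seminorm A (nrm A)"
  by unfold_locales (simp_all add: norm_scale norm_triangle norm_mult cstar_identity)

text \<open>
  Stated for the distances \<open>d m n\<close> between the terms of a sequence only, so that it applies to norms
  and to seminorms alike.
\<close>

lemma geometric_steps_Cauchy:
  fixes d :: "nat \<Rightarrow> nat \<Rightarrow> real"
  assumes triangle: "\<And>i j k. d i k \<le> d i j + d j k" and commute: "\<And>i j. d i j = d j i"
    and self: "\<And>i. d i i = 0" and step: "\<And>i. d (Suc i) i \<le> K * q ^ i"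
    and q: "0 \<le> q" "q < 1" and "0 < e"
  shows "\<exists>N. \<forall>m\<ge>N. \<forall>n\<ge>N. d m n < e"
proof -
  define G where "G n = (\<Sum>i<n. K * q ^ i)" for n
  have "d (n + k) n \<le> G (n + k) - G n" for n k
  proof (induction k)
    case (Suc k)
    then show ?case
      using triangle[of "Suc (n + k)" n "n + k"] step[of "n + k"] by (simp add: G_def)
  qed (simp add: self)
  then have le: "d m n \<le> G m - G n" if "n \<le> m" for m n
    using that by (metis le_add_diff_inverse)
  have "summable (\<lambda>i. K * q ^ i)" using q by (intro summable_mult summable_geometric) simp
  then have "Cauchy G"
    unfolding G_def summable_iff_convergent by (rule convergent_Cauchy)
  then obtain N where N: "\<And>m n. \<lbrakk>N \<le> m; N \<le> n\<rbrakk> \<Longrightarrow> \<bar>G m - G n\<bar> < e"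
    using \<open>0 < e\<close> by (auto simp: Cauchy_def dist_real_def) meson
  have "d m n < e" if "N \<le> m" "N \<le> n" for m n
    using le[of n m] le[of m n] commute[of m n] N[OF that] by (cases "n \<le> m") auto
  then show ?thesis by blast
qed


section \<open>Representations of C*-algebras are contractive\<close>

text \<open>
  The square root of the next lemma is constructed on the open unit ball only; this carries bounds
  obtained there over to all elements.
\<close>

lemma (in cstar_seminorm) le_of_unit_ball:
  assumes unit_ball: "\<And>y. \<lbrakk>y \<in> carrier A; p y < 1\<rbrakk> \<Longrightarrow> g y \<le> K" and x: "x \<in> carrier A"
    and scale: "\<And>c y. y \<in> carrier A \<Longrightarrow> g (c \<odot> y) = cmod c * g y" and "0 \<le> K"
  shows "g x \<le> p x * K"
proof (rule field_le_epsilon)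
  fix e :: real assume "0 < e"
  define c where "c = p x + e / (K + 1)"
  have c: "p x < c" "0 < c"
    using \<open>0 < e\<close> \<open>0 \<le> K\<close> p_nonneg[OF x] by (auto simp: c_def intro!: add_nonneg_pos)
  have "g (of_real (1 / c) \<odot> x) \<le> K"
    using c by (intro unit_ball scale_closed x) (simp add: p_scale x norm_divide)
  then have "g x \<le> c * K" using c by (simp add: scale x norm_divide field_simps)
  also have "\<dots> = p x * K + e * (K / (K + 1))" by (simp add: c_def algebra_simps)
  also have "\<dots> \<le> p x * K + e * 1"
    using \<open>0 < e\<close> \<open>0 \<le> K\<close> by (intro add_left_mono mult_left_mono) auto
  finally show "g x \<le> p x * K + e" by simp
qed

text \<open>
  Formally \<open>b = 1 - sqrt (1 - x\<^sup>\<star> x)\<close>, so that \<open>(1 - b)\<^sup>\<star> (1 - b) = 1 - x\<^sup>\<star> x\<close>; the equation below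
  is this identity with the unit cancelled. The element \<open>b\<close> is the fixed point of
  \<open>b \<mapsto> (x\<^sup>\<star> x + b\<^sup>2) / 2\<close>, a contraction of the ball of radius \<open>\<parallel>x\<^sup>\<star> x\<parallel> < 1\<close>. This root replaces
  all spectral theory: it writes \<open>1 - x\<^sup>\<star> x\<close> in the form \<open>c\<^sup>\<star> c\<close>, which *-homomorphisms preserve.
\<close>

lemma (in cstar_algebra) exists_root_one_minus_square:
  assumes x: "x \<in> carrier A" and "nrm A x < 1"
  obtains b where "b \<in> carrier A" "b \<oplus> b\<^sup>\<star> = x\<^sup>\<star> \<otimes> x \<oplus> b\<^sup>\<star> \<otimes> b"
proof -
  interpret cstar_seminorm A "nrm A" by (rule cstar_seminorm_nrm)
  define a where "a = x\<^sup>\<star> \<otimes> x"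
  define r where "r = nrm A a"
  have a: "a \<in> carrier A" "a\<^sup>\<star> = a"
    using x by (simp_all add: a_def mult_closed adj_closed adj_mult adj_adj)
  have r: "0 \<le> r" "r < 1"
    using a assms(2) p_nonneg[OF x]
    by (simp_all add: r_def norm_nonneg) (simp add: a_def x p_cstar power_less_one_iff)
  define F where "F b = (1/2) \<odot> (a \<oplus> b \<otimes> b)" for b
  have Fc: "F b \<in> carrier A" if "b \<in> carrier A" for b
    using that a by (simp add: F_def scale_closed add_closed mult_closed)
  have Fd: "nrm A (F b \<ominus> F c) \<le> (nrm A b + nrm A c) / 2 * nrm A (b \<ominus> c)"
    if "b \<in> carrier A" "c \<in> carrier A" for b c
  proof -
    have "nrm A (F b \<ominus> F c) \<le> (nrm A (a \<ominus> a) + nrm A (b \<otimes> b \<ominus> c \<otimes> c)) / 2"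
      using that a p_add_diff_add[of a "b \<otimes> b" a "c \<otimes> c"]
      by (simp add: F_def p_scale_diff add_closed mult_closed)
    then show ?thesis
      using p_mult_diff_mult[OF that(1,1,2,2)] a by (simp add: p_diff_self algebra_simps)
  qed
  define s where "s n = (F ^^ n) \<zero>" for n
  have s_Suc: "s (Suc n) = F (s n)" for n by (simp add: s_def)
  have s: "s n \<in> carrier A \<and> (s n)\<^sup>\<star> = s n \<and> nrm A (s n) \<le> r" for n
  proof (induction n)
    case 0
    then show ?case using adj_scale[OF zero_closed, of 0] r adj_closed[OF zero_closed]
      by (simp add: s_def zero_closed p_zero scale_zero_left)
  next
    case (Suc n)
    have "nrm A (s n) * nrm A (s n) \<le> r * 1"
      using Suc r by (intro mult_mono) (auto simp: p_nonneg)
    then have "nrm A (a \<oplus> s n \<otimes> s n) \<le> 2 * r"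
      using p_triangle[OF a(1), of "s n \<otimes> s n"] p_mult[of "s n" "s n"] Suc
      by (simp add: mult_closed r_def)
    then show ?case
      using Suc a
      by (simp add: s_Suc Fc) (simp add: F_def p_scale adj_scale adj_add adj_mult add_closed mult_closed)
  qed
  note sc = s[THEN conjunct1]
  have "nrm A (s (Suc n) \<ominus> s n) \<le> nrm A (s 1 \<ominus> s 0) * r ^ n" for n
  proof (induction n)
    case (Suc n)
    have "(nrm A (s (Suc n)) + nrm A (s n)) / 2 \<le> r" using s[of n] s[of "Suc n"] by simp
    then have "nrm A (s (Suc (Suc n)) \<ominus> s (Suc n)) \<le> r * nrm A (s (Suc n) \<ominus> s n)"
      using Fd[OF sc sc, of "Suc n" n] sc
      by (simp only: s_Suc[symmetric]) (erule order_trans, intro mult_right_mono, auto simp: p_nonneg diff_closed)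
    then show ?case using Suc r mult_left_mono[OF Suc r(1)] by (simp add: mult.left_commute)
  qed simp
  then have "\<forall>e>0. \<exists>N. \<forall>m\<ge>N. \<forall>n\<ge>N. nrm A (s m \<ominus> s n) < e"
    using sc r
    by (intro allI impI geometric_steps_Cauchy[where q = r]) (auto simp: p_diff_self p_diff_commute p_diff_triangle)
  then obtain b where b: "b \<in> carrier A" and lim: "(\<lambda>n. nrm A (s n \<ominus> b)) \<longlonglongrightarrow> 0"
    using complete[of s] sc by blast
  have "nrm A (b \<ominus> F b) \<le> 0"
  proof (rule LIMSEQ_le_const)
    show "(\<lambda>n. nrm A (s (Suc n) \<ominus> b) + (r + nrm A b) / 2 * nrm A (s n \<ominus> b)) \<longlonglongrightarrow> 0"
      by (intro tendsto_add_zero LIMSEQ_Suc[OF lim] tendsto_mult_right_zero lim)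
    have "nrm A (b \<ominus> F b) \<le> nrm A (s (Suc n) \<ominus> b) + (r + nrm A b) / 2 * nrm A (s n \<ominus> b)" for n
    proof -
      have "nrm A (F (s n) \<ominus> F b) \<le> (r + nrm A b) / 2 * nrm A (s n \<ominus> b)"
        using Fd[OF sc b, of n] s[of n] b
        by (elim order_trans, intro mult_right_mono) (auto simp: p_nonneg diff_closed)
      then show ?thesis
        using p_diff_triangle[OF b Fc[OF sc[of n]] Fc[OF b]] p_diff_commute[OF b Fc[OF sc[of n]]]
        by (simp add: s_Suc)
    qed
    then show "\<exists>N. \<forall>n\<ge>N. nrm A (b \<ominus> F b)
        \<le> nrm A (s (Suc n) \<ominus> b) + (r + nrm A b) / 2 * nrm A (s n \<ominus> b)"
      by blast
  qed
  then have Fb: "b = F b"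
    using b Fc[OF b] by (metis diff_closed diff_eq_zero norm_eq_zero order_antisym p_nonneg)
  have "nrm A (b\<^sup>\<star> \<ominus> b) \<le> 0"
  proof (rule LIMSEQ_le_const)
    show "(\<lambda>n. nrm A (s n \<ominus> b) + nrm A (s n \<ominus> b)) \<longlonglongrightarrow> 0"
      using tendsto_add[OF lim lim] by simp
    have "nrm A (b\<^sup>\<star> \<ominus> b) \<le> nrm A (s n \<ominus> b) + nrm A (s n \<ominus> b)" for n
      using p_diff_triangle[OF adj_closed[OF b] sc[of n] b] p_adj_diff[OF b sc[of n]] s[of n]
        p_diff_commute[OF b sc[of n]] by simp
    then show "\<exists>N. \<forall>n\<ge>N. nrm A (b\<^sup>\<star> \<ominus> b) \<le> nrm A (s n \<ominus> b) + nrm A (s n \<ominus> b)" by blast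
  qed
  then have adj_b: "b\<^sup>\<star> = b"
    using b by (metis adj_closed diff_closed diff_eq_zero norm_eq_zero order_antisym p_nonneg)
  have "b \<oplus> b = 2 \<odot> b" using scale_add_left[OF b, of 1 1] by (simp add: scale_one b)
  also have "\<dots> = 2 \<odot> F b" by (subst Fb) simp
  also have "\<dots> = a \<oplus> b \<otimes> b"
    using a b by (simp add: F_def scale_scale scale_one add_closed mult_closed)
  finally show ?thesis using that[OF b] by (simp add: adj_b a_def)
qed

locale star_representation = B: star_algebra B + H: hilbert_space H
  for B :: "('b, 'm) star_alg_scheme" and H :: "('h, 'n) hilb_scheme" +
  fixes \<pi> :: "'b \<Rightarrow> 'h \<Rightarrow> 'h"
  assumes rep: "star_rep B H \<pi>"
begin

lemma rep_bounded: "X \<in> carrier B \<Longrightarrow> bounded_op H (\<pi> X)"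
  using rep by (simp add: star_rep_def)

lemma rep_closed: "\<lbrakk>X \<in> carrier B; \<xi> \<in> carrier H\<rbrakk> \<Longrightarrow> \<pi> X \<xi> \<in> carrier H"
  using rep_bounded unfolding bounded_op_def by blast

lemma rep_vadd:
  "\<lbrakk>X \<in> carrier B; \<xi> \<in> carrier H; \<eta> \<in> carrier H\<rbrakk> \<Longrightarrow> \<pi> X (\<xi> \<oplus>\<^bsub>H\<^esub> \<eta>) = \<pi> X \<xi> \<oplus>\<^bsub>H\<^esub> \<pi> X \<eta>"
  using rep_bounded by (auto simp: bounded_op_def)

lemma rep_vscale: "\<lbrakk>X \<in> carrier B; \<xi> \<in> carrier H\<rbrakk> \<Longrightarrow> \<pi> X (c \<odot>\<^bsub>H\<^esub> \<xi>) = c \<odot>\<^bsub>H\<^esub> \<pi> X \<xi>"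
  using rep_bounded by (auto simp: bounded_op_def)

lemma rep_add:
  "\<lbrakk>X \<in> carrier B; Y \<in> carrier B; \<xi> \<in> carrier H\<rbrakk> \<Longrightarrow> \<pi> (X \<oplus>\<^bsub>B\<^esub> Y) \<xi> = \<pi> X \<xi> \<oplus>\<^bsub>H\<^esub> \<pi> Y \<xi>"
  using rep by (simp add: star_rep_def)

lemma rep_mult:
  "\<lbrakk>X \<in> carrier B; Y \<in> carrier B; \<xi> \<in> carrier H\<rbrakk> \<Longrightarrow> \<pi> (X \<otimes>\<^bsub>B\<^esub> Y) \<xi> = \<pi> X (\<pi> Y \<xi>)"
  using rep by (simp add: star_rep_def)

lemma rep_scale: "\<lbrakk>X \<in> carrier B; \<xi> \<in> carrier H\<rbrakk> \<Longrightarrow> \<pi> (c \<odot>\<^bsub>B\<^esub> X) \<xi> = c \<odot>\<^bsub>H\<^esub> \<pi> X \<xi>"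
  using rep by (simp add: star_rep_def)

lemma rep_zero: "\<xi> \<in> carrier H \<Longrightarrow> \<pi> \<zero>\<^bsub>B\<^esub> \<xi> = \<zero>\<^bsub>H\<^esub>"
  using rep_scale[OF B.zero_closed, of \<xi> 0]
  by (simp add: B.scale_zero_left B.zero_closed H.scale_zero_left rep_closed)

lemma rep_inner_adj:
  "\<lbrakk>X \<in> carrier B; \<xi> \<in> carrier H; \<eta> \<in> carrier H\<rbrakk>
   \<Longrightarrow> hinner H (\<pi> (X\<^sup>\<star>\<^bsub>B\<^esub>) \<xi>) \<eta> = hinner H \<xi> (\<pi> X \<eta>)"
  using rep by (simp add: star_rep_def)

lemma rep_inner_square:
  assumes "X \<in> carrier B" "\<xi> \<in> carrier H"
  shows "hinner H (\<pi> (X\<^sup>\<star>\<^bsub>B\<^esub> \<otimes>\<^bsub>B\<^esub> X) \<xi>) \<xi> = complex_of_real ((hnorm H (\<pi> X \<xi>))\<^sup>2)"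
  using assms by (simp add: rep_mult rep_inner_adj B.adj_closed rep_closed H.inner_self del: of_real_power)

text \<open>
  By the choice of \<open>d\<close>, \<open>\<pi>(s)\<^sup>\<star> \<pi>(s) = 1 - (1 - \<pi>(t))\<^sup>\<star> (1 - \<pi>(t)) - \<pi>(d) \<le> 1 - \<pi>(d)\<close>. The error \<open>d\<close> vanishes
  for an exact root and measures how good an approximate one is.
\<close>

lemma rep_norm_le_of_root:
  assumes "s \<in> carrier B" "t \<in> carrier B" and \<xi>: "\<xi> \<in> carrier H"
    and d: "d = (t \<oplus>\<^bsub>B\<^esub> t\<^sup>\<star>\<^bsub>B\<^esub>) \<ominus>\<^bsub>B\<^esub> (s\<^sup>\<star>\<^bsub>B\<^esub> \<otimes>\<^bsub>B\<^esub> s \<oplus>\<^bsub>B\<^esub> t\<^sup>\<star>\<^bsub>B\<^esub> \<otimes>\<^bsub>B\<^esub> t)"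
  shows "(hnorm H (\<pi> s \<xi>))\<^sup>2 \<le> (hnorm H \<xi>)\<^sup>2 + hnorm H (\<pi> d \<xi>) * hnorm H \<xi>"
proof -
  let ?n = "hnorm H"
  note cl = assms(1,2) B.adj_closed B.mult_closed B.add_closed B.scale_closed
  have "d \<in> carrier B" by (simp add: d cl B.diff_closed)
  have "hinner H (\<pi> d \<xi>) \<xi> = hinner H (\<pi> t \<xi>) \<xi> + hinner H \<xi> (\<pi> t \<xi>)
      - of_real ((?n (\<pi> s \<xi>))\<^sup>2) - of_real ((?n (\<pi> t \<xi>))\<^sup>2)"
    unfolding d using \<xi>
    by (simp add: vdiff_def rep_add rep_scale cl H.inner_add_left H.inner_scale_left rep_closed
        H.add_closed H.scale_closed rep_inner_adj rep_inner_square del: of_real_power)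
  moreover have "hinner H \<xi> (\<pi> t \<xi>) = cnj (hinner H (\<pi> t \<xi>) \<xi>)"
    using \<xi> by (intro H.inner_commute rep_closed cl)
  ultimately have "(?n (\<pi> s \<xi>))\<^sup>2 + (?n (\<pi> t \<xi>))\<^sup>2
      = 2 * Re (hinner H (\<pi> t \<xi>) \<xi>) - Re (hinner H (\<pi> d \<xi>) \<xi>)"
    by simp
  moreover have "\<bar>Re (hinner H (\<pi> y \<xi>) \<xi>)\<bar> \<le> ?n (\<pi> y \<xi>) * ?n \<xi>" if "y \<in> carrier B" for y
    using H.cauchy_schwarz[OF rep_closed[OF that \<xi>] \<xi>] abs_Re_le_cmod order_trans by blast
  moreover have "2 * (?n (\<pi> t \<xi>) * ?n \<xi>) \<le> (?n (\<pi> t \<xi>))\<^sup>2 + (?n \<xi>)\<^sup>2"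
    using sum_squares_bound[of "?n (\<pi> t \<xi>)" "?n \<xi>"] by (simp add: mult.assoc)
  ultimately show ?thesis
    using \<open>d \<in> carrier B\<close> assms(2) by (smt (verit))
qed

lemma rep_adj_bound:
  assumes X: "X \<in> carrier B" and bound: "\<And>\<eta>. \<eta> \<in> carrier H \<Longrightarrow> hnorm H (\<pi> X \<eta>) \<le> M * hnorm H \<eta>"
    and \<xi>: "\<xi> \<in> carrier H"
  shows "hnorm H (\<pi> (X\<^sup>\<star>\<^bsub>B\<^esub>) \<xi>) \<le> M * hnorm H \<xi>"
proof -
  let ?\<eta> = "\<pi> (X\<^sup>\<star>\<^bsub>B\<^esub>) \<xi>"
  have \<eta>: "?\<eta> \<in> carrier H" using X \<xi> by (intro rep_closed B.adj_closed)
  have "complex_of_real ((hnorm H ?\<eta>)\<^sup>2) = hinner H \<xi> (\<pi> X ?\<eta>)"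
    using H.inner_self[OF \<eta>] rep_inner_adj[OF X \<xi> \<eta>] by simp
  then have "(hnorm H ?\<eta>)\<^sup>2 = cmod (hinner H \<xi> (\<pi> X ?\<eta>))"
    by (metis norm_of_real abs_of_nonneg zero_le_power2)
  also have "\<dots> \<le> hnorm H \<xi> * hnorm H (\<pi> X ?\<eta>)" by (intro H.cauchy_schwarz \<xi> rep_closed X \<eta>)
  also have "\<dots> \<le> hnorm H \<xi> * (M * hnorm H ?\<eta>)" by (intro mult_left_mono bound \<eta> H.hnorm_nonneg \<xi>)
  finally have le: "hnorm H ?\<eta> * hnorm H ?\<eta> \<le> (M * hnorm H \<xi>) * hnorm H ?\<eta>"
    by (simp add: power2_eq_square mult_ac)
  have "0 \<le> M * hnorm H \<xi>" using bound[OF \<xi>] H.hnorm_nonneg[OF rep_closed[OF X \<xi>]] by linarith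
  then show ?thesis using le H.hnorm_nonneg[OF \<eta>] by (cases "hnorm H ?\<eta> = 0") (auto simp: mult_le_cancel_right)
qed

end

lemma star_representationI:
  assumes "star_algebra B" "star_rep B H \<pi>"
  shows "star_representation B H \<pi>"
  using assms by (auto simp: star_representation_def star_representation_axioms_def star_rep_def)

lemma hnorm_diff_square:
  assumes "hilbert_space H" "x \<in> carrier H" "y \<in> carrier H"
  shows "(hnorm H (x \<ominus>\<^bsub>H\<^esub> of_real c \<odot>\<^bsub>H\<^esub> y))\<^sup>2
    = (hnorm H x)\<^sup>2 - 2 * c * Re (hinner H x y) + c\<^sup>2 * (hnorm H y)\<^sup>2"
proof -
  interpret hilbert_space H by fact
  have "complex_of_real ((hnorm H (x \<ominus>\<^bsub>H\<^esub> of_real c \<odot>\<^bsub>H\<^esub> y))\<^sup>2)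
    = hinner H x x - c * (hinner H x y + cnj (hinner H x y)) + c\<^sup>2 * hinner H y y"
    using assms
    by (subst inner_self[symmetric])
      (simp_all add: vdiff_def add_closed scale_closed scale_scale inner_add_left inner_add_right
        inner_scale_left inner_scale_right inner_commute[of x y] algebra_simps power2_eq_square)
  then have "complex_of_real ((hnorm H (x \<ominus>\<^bsub>H\<^esub> of_real c \<odot>\<^bsub>H\<^esub> y))\<^sup>2)
    = of_real ((hnorm H x)\<^sup>2 - 2 * c * Re (hinner H x y) + c\<^sup>2 * (hnorm H y)\<^sup>2)"
    using assms by (simp add: inner_self complex_add_cnj)
  then show ?thesis by (simp only: of_real_eq_iff)
qed

context star_representation
begin

text \<open>
  Write \<open>T = \<pi>(z)\<^sup>\<star> \<pi>(z)\<close> and \<open>u = \<xi> - T \<xi> / R\<^sup>2\<close>, so that \<open>w\<close> acts by \<open>\<xi> \<mapsto> \<pi>(z) u\<close>. Since \<open>T / R\<^sup>2\<close> is a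
  positive contraction, \<open>\<parallel>u\<parallel> \<le> \<parallel>\<xi>\<parallel>\<close>; and \<open>(1 - T / R\<^sup>2) (T / R\<^sup>2) (1 - T / R\<^sup>2) \<le> 1/4\<close> gives the
  gain of a factor 2. On singular values the map is \<open>t \<mapsto> t - t\<^sup>3 / R\<^sup>2\<close>.
\<close>

lemma rep_norm_cubic_correction:
  assumes z: "z \<in> carrier B" and R: "0 < R"
    and bound: "\<And>\<eta>. \<eta> \<in> carrier H \<Longrightarrow> hnorm H (\<pi> z \<eta>) \<le> R * hnorm H \<eta>" and \<xi>: "\<xi> \<in> carrier H"
    and w: "w = z \<ominus>\<^bsub>B\<^esub> of_real (1 / R\<^sup>2) \<odot>\<^bsub>B\<^esub> (z \<otimes>\<^bsub>B\<^esub> (z\<^sup>\<star>\<^bsub>B\<^esub> \<otimes>\<^bsub>B\<^esub> z))"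
  shows "hnorm H (\<pi> w \<xi>) \<le> R / 2 * hnorm H \<xi>"
    and "(\<And>\<eta>. \<eta> \<in> carrier H \<Longrightarrow> hnorm H (\<pi> z \<eta>) \<le> M * hnorm H \<eta>) \<Longrightarrow> hnorm H (\<pi> w \<xi>) \<le> M * hnorm H \<xi>"
proof -
  let ?n = "hnorm H"
  define c where "c = 1 / R\<^sup>2"
  define T where "T = \<pi> (z\<^sup>\<star>\<^bsub>B\<^esub> \<otimes>\<^bsub>B\<^esub> z)"
  define u where "u = \<xi> \<ominus>\<^bsub>H\<^esub> of_real c \<odot>\<^bsub>H\<^esub> T \<xi>"
  have T: "T \<eta> \<in> carrier H" "T \<eta> = \<pi> (z\<^sup>\<star>\<^bsub>B\<^esub>) (\<pi> z \<eta>)" if "\<eta> \<in> carrier H" for \<eta>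
    using that z by (simp_all add: T_def rep_closed rep_mult B.adj_closed B.mult_closed)
  note cl = z \<xi> T(1) rep_closed H.scale_closed H.diff_closed
  have c: "0 < c" "c * R\<^sup>2 = 1" using R by (simp_all add: c_def)
  have wu: "\<pi> w \<xi> = \<pi> z u" "\<pi> z u = \<pi> z \<xi> \<ominus>\<^bsub>H\<^esub> of_real c \<odot>\<^bsub>H\<^esub> \<pi> z (T \<xi>)"
    unfolding w u_def c_def T_def using z \<xi>
    by (simp_all add: vdiff_def rep_add rep_mult rep_scale rep_vadd rep_vscale rep_closed B.adj_closed
        B.mult_closed B.scale_closed H.scale_closed)
  have u: "u \<in> carrier H" by (simp add: u_def cl)
  have T\<xi>: "(?n (T \<xi>))\<^sup>2 \<le> R\<^sup>2 * (?n (\<pi> z \<xi>))\<^sup>2"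
    using rep_adj_bound[OF z bound rep_closed[OF z \<xi>]] T[OF \<xi>] H.hnorm_nonneg
    by (metis power_mono power_mult_distrib)
  have T\<eta>: "Re (hinner H \<xi> (T \<xi>)) = (?n (\<pi> z \<xi>))\<^sup>2"
    using rep_inner_square[OF z \<xi>] H.inner_commute[OF T(1)[OF \<xi>] \<xi>] by (simp add: T_def)
  have "(?n u)\<^sup>2 = (?n \<xi>)\<^sup>2 - 2 * c * (?n (\<pi> z \<xi>))\<^sup>2 + c * (c * (?n (T \<xi>))\<^sup>2)"
    unfolding u_def
    by (subst hnorm_diff_square[OF H.hilbert_space_axioms \<xi> T(1)[OF \<xi>]])
      (simp add: T\<eta> power2_eq_square)
  also have "\<dots> \<le> (?n \<xi>)\<^sup>2 - 2 * c * (?n (\<pi> z \<xi>))\<^sup>2 + c * (?n (\<pi> z \<xi>))\<^sup>2"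
    using mult_left_mono[OF T\<xi>, of c] c by (intro add_left_mono mult_left_mono) (auto simp: mult.assoc[symmetric])
  also have "\<dots> \<le> (?n \<xi>)\<^sup>2" using c by simp
  finally have nu: "?n u \<le> ?n \<xi>" using H.hnorm_nonneg[OF \<xi>] by (rule power2_le_imp_le)
  show "?n (\<pi> w \<xi>) \<le> M * ?n \<xi>" if M: "\<And>\<eta>. \<eta> \<in> carrier H \<Longrightarrow> ?n (\<pi> z \<eta>) \<le> M * ?n \<eta>"
  proof (cases "?n u = 0")
    case True
    then have "?n (\<pi> w \<xi>) \<le> 0" using M[OF u] by (simp add: wu(1))
    moreover have "0 \<le> M * ?n \<xi>" using M[OF \<xi>] H.hnorm_nonneg[OF rep_closed[OF z \<xi>]] by linarith
    ultimately show ?thesis by linarith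
  next
    case False
    then have "0 < ?n u" using H.hnorm_nonneg[OF u] by linarith
    moreover have "0 \<le> M * ?n u" using M[OF u] H.hnorm_nonneg[OF rep_closed[OF z u]] by linarith
    ultimately have "0 \<le> M" by (simp add: zero_le_mult_iff)
    then show ?thesis using M[OF u] mult_left_mono[OF nu] by (fastforce simp: wu(1))
  qed
  have zT: "Re (hinner H (\<pi> z \<xi>) (\<pi> z (T \<xi>))) = (?n (T \<xi>))\<^sup>2"
    using rep_inner_adj[OF z rep_closed[OF z \<xi>] T(1)[OF \<xi>]] T[OF \<xi>] H.inner_self[OF T(1)[OF \<xi>]]
    by (simp del: of_real_power)
  have "(?n (\<pi> w \<xi>))\<^sup>2 = (?n (\<pi> z \<xi>))\<^sup>2 - 2 * c * (?n (T \<xi>))\<^sup>2 + c\<^sup>2 * (?n (\<pi> z (T \<xi>)))\<^sup>2"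
    unfolding wu
    by (subst hnorm_diff_square[OF H.hilbert_space_axioms]) (simp_all add: cl zT)
  also have "\<dots> \<le> (?n (\<pi> z \<xi>))\<^sup>2 - 2 * c * (?n (T \<xi>))\<^sup>2 + c\<^sup>2 * (R * ?n (T \<xi>))\<^sup>2"
    by (intro add_left_mono mult_left_mono power_mono bound H.hnorm_nonneg) (simp_all add: cl)
  also have "\<dots> = (?n (\<pi> z \<xi>))\<^sup>2 - c * (?n (T \<xi>))\<^sup>2"
  proof -
    have "c\<^sup>2 * (R * ?n (T \<xi>))\<^sup>2 = c * (c * R\<^sup>2) * (?n (T \<xi>))\<^sup>2"
      by (simp add: power2_eq_square)
    then show ?thesis using c by simp
  qed
  also have "\<dots> \<le> ?n \<xi> * ?n (T \<xi>) - c * (?n (T \<xi>))\<^sup>2"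
    using H.cauchy_schwarz[OF \<xi> T(1)[OF \<xi>]] complex_Re_le_cmod[of "hinner H \<xi> (T \<xi>)"] T\<eta> by simp
  also have "\<dots> \<le> (R / 2 * ?n \<xi>)\<^sup>2"
  proof -
    have "0 \<le> (R / 2 * ?n \<xi> - ?n (T \<xi>) / R)\<^sup>2" by simp
    then show ?thesis using R by (simp add: power2_diff c_def power_divide)
  qed
  finally show "?n (\<pi> w \<xi>) \<le> R / 2 * ?n \<xi>"
    by (rule power2_le_imp_le) (simp add: less_imp_le[OF R] H.hnorm_nonneg[OF \<xi>])
qed

end

context hilbert_space
begin

lemma hnorm_le_op_norm:
  assumes T: "bounded_op H T" and x: "x \<in> carrier H"
  shows "hnorm H (T x) \<le> op_norm H T * hnorm H x"
proof (cases "hnorm H x = 0")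
  case True
  obtain C where "hnorm H (T x) \<le> C * hnorm H x"
    using T x unfolding bounded_op_def by blast
  with True show ?thesis by simp
next
  case False
  define c where "c = hnorm H x"
  have c: "0 < c" using False hnorm_nonneg[OF x] by (simp add: c_def)
  let ?y = "of_real (1 / c) \<odot> x"
  obtain C where C: "\<And>y. y \<in> carrier H \<Longrightarrow> hnorm H (T y) \<le> C * hnorm H y"
    using T unfolding bounded_op_def by blast
  have "hnorm H (T y) \<le> \<bar>C\<bar>" if "y \<in> carrier H" "hnorm H y \<le> 1" for y
    using C[OF that(1)] mult_mono[of C "\<bar>C\<bar>" "hnorm H y" 1] that hnorm_nonneg[OF that(1)]
    by (simp add: abs_ge_self)
  then have bdd: "bdd_above {hnorm H (T y) |y. y \<in> carrier H \<and> hnorm H y \<le> 1}"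
    by (intro bdd_aboveI[of _ "\<bar>C\<bar>"]) auto
  have "T ?y = of_real (1 / c) \<odot> T x" "T x \<in> carrier H"
    using T x unfolding bounded_op_def by (blast, blast)
  then have "hnorm H (T x) / c = hnorm H (T ?y)"
    using c by (simp add: hnorm_scale norm_divide)
  also have "\<dots> \<le> op_norm H T"
    unfolding op_norm_def using c x
    by (intro cSup_upper bdd) (auto simp: hnorm_scale norm_divide scale_closed c_def[symmetric] intro!: exI[of _ ?y])
  finally show ?thesis using c by (simp add: field_simps flip: c_def)
qed

lemma op_norm_le:
  assumes "0 \<le> M" and "\<And>x. x \<in> carrier H \<Longrightarrow> hnorm H (T x) \<le> M * hnorm H x"
  shows "op_norm H T \<le> M"
  unfolding op_norm_def
proof (rule cSup_least)
  show "{hnorm H (T x) |x. x \<in> carrier H \<and> hnorm H x \<le> 1} \<noteq> {}"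
    using zero_closed hnorm_zero by (auto intro!: exI[of _ \<zero>])
  fix r assume "r \<in> {hnorm H (T x) |x. x \<in> carrier H \<and> hnorm H x \<le> 1}"
  then obtain x where "x \<in> carrier H" "hnorm H x \<le> 1" "r = hnorm H (T x)" by blast
  then show "r \<le> M" using assms(2)[of x] mult_left_mono[of "hnorm H x" 1 M] assms(1) by simp
qed

end

text \<open>
  For \<open>\<parallel>x\<parallel> < 1\<close> there is an exact root, so \<open>rep_norm_le_of_root\<close> applies with \<open>d = 0\<close>.
\<close>

lemma star_rep_contractive:
  assumes "cstar_algebra A" "star_rep A H \<pi>" and x: "x \<in> carrier A" and \<xi>: "\<xi> \<in> carrier H"
  shows "hnorm H (\<pi> x \<xi>) \<le> nrm A x * hnorm H \<xi>"
proof -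
  interpret A: cstar_algebra A by fact
  interpret S: cstar_seminorm A "nrm A" by (rule A.cstar_seminorm_nrm)
  interpret star_representation A H \<pi>
    by (rule star_representationI[OF A.star_algebra_axioms assms(2)])
  have unit_ball: "hnorm H (\<pi> y \<xi>) \<le> hnorm H \<xi>" if y: "y \<in> carrier A" "nrm A y < 1" for y
  proof -
    obtain b where b: "b \<in> carrier A"
      and eq: "b \<oplus>\<^bsub>A\<^esub> b\<^sup>\<star>\<^bsub>A\<^esub> = y\<^sup>\<star>\<^bsub>A\<^esub> \<otimes>\<^bsub>A\<^esub> y \<oplus>\<^bsub>A\<^esub> b\<^sup>\<star>\<^bsub>A\<^esub> \<otimes>\<^bsub>A\<^esub> b"
      using A.exists_root_one_minus_square[OF y] by blast
    have "(hnorm H (\<pi> y \<xi>))\<^sup>2 \<le> (hnorm H \<xi>)\<^sup>2"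
      using rep_norm_le_of_root[OF y(1) b \<xi> refl] y b \<xi>
      by (simp add: eq vdiff_def A.add_neg A.add_closed A.mult_closed A.adj_closed rep_zero H.hnorm_zero)
    then show ?thesis using H.hnorm_nonneg[OF \<xi>] by (rule power2_le_imp_le)
  qed
  show ?thesis
  proof (rule S.le_of_unit_ball[OF _ x])
    show "hnorm H (\<pi> (c \<odot>\<^bsub>A\<^esub> y) \<xi>) = cmod c * hnorm H (\<pi> y \<xi>)" if "y \<in> carrier A" for c y
      using that \<xi> by (simp add: rep_scale H.hnorm_scale rep_closed)
  qed (simp_all add: unit_ball H.hnorm_nonneg \<xi>)
qed


section \<open>The universal seminorm is a C*-seminorm\<close>

text \<open>The Hilbert spaces range over the same type as in \<^const>\<open>rep_seminorm\<close>.\<close>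

definition uniformly_bounded :: "('b, 'm) star_alg_scheme \<Rightarrow> 'b \<Rightarrow> bool"
  where "uniformly_bounded B X \<longleftrightarrow>
    (\<exists>M. \<forall>(H :: (nat \<Rightarrow> complex \<times> 'b) hilb) \<pi>. star_rep B H \<pi> \<longrightarrow>
      (\<forall>\<xi>\<in>carrier H. hnorm H (\<pi> X \<xi>) \<le> M * hnorm H \<xi>))"

text \<open>
  The assumption says that the supremum defining \<^const>\<open>rep_seminorm\<close> is finite; without it the
  supremum would be an unspecified real number.
\<close>

locale bounded_star_algebra = star_algebra B for B :: "('b, 'm) star_alg_scheme" (structure) +
  assumes bounded: "X \<in> carrier B \<Longrightarrow> uniformly_bounded B X"
begin

text \<open>The zero representation shows that \<^const>\<open>rep_seminorm\<close> is not a supremum over the empty set.\<close>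

lemma exists_zero_rep: "\<exists>(H :: (nat \<Rightarrow> complex \<times> 'b) hilb) \<pi>. star_rep B H \<pi>"
proof -
  define H :: "(nat \<Rightarrow> complex \<times> 'b) hilb" where
    "H = \<lparr>carrier = {undefined}, vadd = \<lambda>_ _. undefined, vzero = undefined,
      vscale = \<lambda>_ _. undefined, hinner = \<lambda>_ _. 0\<rparr>"
  have "comm_group \<lparr>carrier = carrier H, mult = vadd H, one = vzero H\<rparr>"
    by (rule comm_groupI) (auto simp: H_def)
  then have "hilbert_space H"
    by (intro hilbert_space.intro complex_vector_space.intro hilbert_space_axioms.intro)
      (auto simp: H_def hnorm_def)
  then have "star_rep B H (\<lambda>_ _. undefined)"
    by (auto simp: star_rep_def bounded_op_def H_def hnorm_def)
  then show ?thesis by blast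
qed

lemma bdd_above_op_norm:
  assumes "X \<in> carrier B"
  shows "bdd_above {op_norm H (\<pi> X) |(H :: (nat \<Rightarrow> complex \<times> 'b) hilb) \<pi>. star_rep B H \<pi>}"
proof -
  obtain M where M: "hnorm H (\<pi> X \<xi>) \<le> M * hnorm H \<xi>"
    if "star_rep B H \<pi>" "\<xi> \<in> carrier H" for H :: "(nat \<Rightarrow> complex \<times> 'b) hilb" and \<pi> \<xi>
    using bounded[OF assms] unfolding uniformly_bounded_def by blast
  have "op_norm H (\<pi> X) \<le> \<bar>M\<bar>" if rep: "star_rep B H \<pi>"
    for H :: "(nat \<Rightarrow> complex \<times> 'b) hilb" and \<pi>
  proof -
    interpret star_representation B H \<pi> by (rule star_representationI[OF star_algebra_axioms rep])
    show ?thesis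
      by (intro H.op_norm_le order_trans[OF M[OF rep] mult_right_mono[OF abs_ge_self H.hnorm_nonneg]])
        simp_all
  qed
  then show ?thesis by (intro bdd_aboveI[of _ "\<bar>M\<bar>"]) blast
qed

lemma hnorm_rep_le:
  assumes rep: "star_rep B H \<pi>" and X: "X \<in> carrier B" and \<xi>: "\<xi> \<in> carrier H"
  shows "hnorm H (\<pi> X \<xi>) \<le> rep_seminorm B X * hnorm H \<xi>"
proof -
  interpret star_representation B H \<pi> by (rule star_representationI[OF star_algebra_axioms rep])
  have "hnorm H (\<pi> X \<xi>) \<le> op_norm H (\<pi> X) * hnorm H \<xi>"
    by (intro H.hnorm_le_op_norm rep_bounded X \<xi>)
  also have "\<dots> \<le> rep_seminorm B X * hnorm H \<xi>"
    by (intro mult_right_mono op_norm_le_rep_seminorm star_algebra_axioms rep X bdd_above_op_norm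
        H.hnorm_nonneg \<xi>)
  finally show ?thesis .
qed

lemma rep_seminorm_le:
  assumes "0 \<le> M"
    and "\<And>(H :: (nat \<Rightarrow> complex \<times> 'b) hilb) \<pi> \<xi>. star_rep B H \<pi> \<Longrightarrow> \<xi> \<in> carrier H \<Longrightarrow>
      hnorm H (\<pi> X \<xi>) \<le> M * hnorm H \<xi>"
  shows "rep_seminorm B X \<le> M"
  unfolding rep_seminorm_def
proof (rule cSup_least)
  fix r assume "r \<in> {op_norm H (\<pi> X) |(H :: (nat \<Rightarrow> complex \<times> 'b) hilb) \<pi>. star_rep B H \<pi>}"
  then obtain H :: "(nat \<Rightarrow> complex \<times> 'b) hilb" and \<pi>
    where rep: "star_rep B H \<pi>" and r: "r = op_norm H (\<pi> X)" by blast
  interpret hilbert_space H using rep by (simp add: star_rep_def)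
  show "r \<le> M" unfolding r using assms(1) assms(2)[OF rep] by (rule op_norm_le)
qed (use exists_zero_rep in blast)

lemma rep_seminorm_nonneg:
  assumes "X \<in> carrier B"
  shows "0 \<le> rep_seminorm B X"
proof -
  obtain H :: "(nat \<Rightarrow> complex \<times> 'b) hilb" and \<pi> where rep: "star_rep B H \<pi>"
    using exists_zero_rep by blast
  interpret star_representation B H \<pi> by (rule star_representationI[OF star_algebra_axioms rep])
  have "0 = hnorm H (\<pi> X \<zero>\<^bsub>H\<^esub>)"
    using rep_vscale[OF assms H.zero_closed, of 0]
    by (simp add: H.scale_zero_left H.zero_closed rep_closed assms H.hnorm_zero)
  also have "\<dots> \<le> op_norm H (\<pi> X)"
    using rep_bounded[OF assms] unfolding op_norm_def bounded_op_def
  proof (elim conjE exE, intro cSup_upper)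
    fix C assume C: "\<forall>x\<in>carrier H. hnorm H (\<pi> X x) \<le> C * hnorm H x"
    show "hnorm H (\<pi> X \<zero>\<^bsub>H\<^esub>) \<in> {hnorm H (\<pi> X x) |x. x \<in> carrier H \<and> hnorm H x \<le> 1}"
      using H.zero_closed H.hnorm_zero by (auto intro!: exI[of _ "\<zero>\<^bsub>H\<^esub>"])
    have "hnorm H (\<pi> X x) \<le> \<bar>C\<bar>" if "x \<in> carrier H" "hnorm H x \<le> 1" for x
      using C that mult_mono[of C "\<bar>C\<bar>" "hnorm H x" 1] H.hnorm_nonneg[of x] by fastforce
    then show "bdd_above {hnorm H (\<pi> X x) |x. x \<in> carrier H \<and> hnorm H x \<le> 1}"
      by (intro bdd_aboveI[of _ "\<bar>C\<bar>"]) auto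
  qed
  also have "\<dots> \<le> rep_seminorm B X"
    by (intro op_norm_le_rep_seminorm star_algebra_axioms rep assms bdd_above_op_norm)
  finally show ?thesis .
qed

lemma rep_seminorm_scale_le:
  assumes "X \<in> carrier B"
  shows "rep_seminorm B (c \<odot> X) \<le> cmod c * rep_seminorm B X"
proof (rule rep_seminorm_le)
  fix H :: "(nat \<Rightarrow> complex \<times> 'b) hilb" and \<pi> \<xi>
  assume rep: "star_rep B H \<pi>" and \<xi>: "\<xi> \<in> carrier H"
  interpret star_representation B H \<pi> by (rule star_representationI[OF star_algebra_axioms rep])
  show "hnorm H (\<pi> (c \<odot> X) \<xi>) \<le> cmod c * rep_seminorm B X * hnorm H \<xi>"
    using mult_left_mono[OF hnorm_rep_le[OF rep assms \<xi>], of "cmod c"]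
    by (simp add: rep_scale assms \<xi> H.hnorm_scale rep_closed mult.assoc)
qed (simp add: rep_seminorm_nonneg assms)

lemma rep_seminorm_square_le:
  assumes X: "X \<in> carrier B"
  shows "(rep_seminorm B X)\<^sup>2 \<le> rep_seminorm B (X\<^sup>\<star> \<otimes> X)"
proof -
  let ?Y = "X\<^sup>\<star> \<otimes> X"
  have Y: "?Y \<in> carrier B" using X by (simp add: adj_closed mult_closed)
  have "rep_seminorm B X \<le> sqrt (rep_seminorm B ?Y)"
  proof (rule rep_seminorm_le)
    fix H :: "(nat \<Rightarrow> complex \<times> 'b) hilb" and \<pi> \<xi>
    assume rep: "star_rep B H \<pi>" and \<xi>: "\<xi> \<in> carrier H"
    interpret star_representation B H \<pi> by (rule star_representationI[OF star_algebra_axioms rep])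
    have "(hnorm H (\<pi> X \<xi>))\<^sup>2 = cmod (hinner H (\<pi> ?Y \<xi>) \<xi>)"
      using X \<xi> by (simp add: rep_inner_square del: of_real_power)
    also have "\<dots> \<le> hnorm H (\<pi> ?Y \<xi>) * hnorm H \<xi>" by (intro H.cauchy_schwarz rep_closed Y \<xi>)
    also have "\<dots> \<le> rep_seminorm B ?Y * hnorm H \<xi> * hnorm H \<xi>"
      by (intro mult_right_mono hnorm_rep_le[OF rep] Y H.hnorm_nonneg \<xi>)
    also have "\<dots> = (sqrt (rep_seminorm B ?Y) * hnorm H \<xi>)\<^sup>2"
      by (simp add: power_mult_distrib rep_seminorm_nonneg[OF Y] power2_eq_square[of "hnorm H \<xi>"])
    finally show "hnorm H (\<pi> X \<xi>) \<le> sqrt (rep_seminorm B ?Y) * hnorm H \<xi>"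
      by (rule power2_le_imp_le) (simp add: rep_seminorm_nonneg Y H.hnorm_nonneg \<xi>)
  qed (simp add: rep_seminorm_nonneg Y)
  then show ?thesis using rep_seminorm_nonneg X Y by (metis power_mono real_sqrt_pow2)
qed

lemma rep_seminorm_mult:
  assumes X: "X \<in> carrier B" and Y: "Y \<in> carrier B"
  shows "rep_seminorm B (X \<otimes> Y) \<le> rep_seminorm B X * rep_seminorm B Y"
proof (rule rep_seminorm_le)
  fix H :: "(nat \<Rightarrow> complex \<times> 'b) hilb" and \<pi> \<xi>
  assume rep: "star_rep B H \<pi>" and \<xi>: "\<xi> \<in> carrier H"
  interpret star_representation B H \<pi> by (rule star_representationI[OF star_algebra_axioms rep])
  have "hnorm H (\<pi> (X \<otimes> Y) \<xi>) \<le> rep_seminorm B X * hnorm H (\<pi> Y \<xi>)"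
    using hnorm_rep_le[OF rep X rep_closed[OF Y \<xi>]] by (simp add: rep_mult X Y \<xi>)
  also have "\<dots> \<le> rep_seminorm B X * (rep_seminorm B Y * hnorm H \<xi>)"
    by (intro mult_left_mono hnorm_rep_le[OF rep] Y \<xi> rep_seminorm_nonneg X)
  finally show "hnorm H (\<pi> (X \<otimes> Y) \<xi>) \<le> rep_seminorm B X * rep_seminorm B Y * hnorm H \<xi>"
    by (simp add: mult.assoc)
qed (simp add: rep_seminorm_nonneg X Y)

lemma rep_seminorm_add:
  assumes X: "X \<in> carrier B" and Y: "Y \<in> carrier B"
  shows "rep_seminorm B (X \<oplus> Y) \<le> rep_seminorm B X + rep_seminorm B Y"
proof (rule rep_seminorm_le)
  fix H :: "(nat \<Rightarrow> complex \<times> 'b) hilb" and \<pi> \<xi>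
  assume rep: "star_rep B H \<pi>" and \<xi>: "\<xi> \<in> carrier H"
  interpret star_representation B H \<pi> by (rule star_representationI[OF star_algebra_axioms rep])
  show "hnorm H (\<pi> (X \<oplus> Y) \<xi>) \<le> (rep_seminorm B X + rep_seminorm B Y) * hnorm H \<xi>"
    using H.hnorm_triangle[OF rep_closed[OF X \<xi>] rep_closed[OF Y \<xi>]]
      hnorm_rep_le[OF rep X \<xi>] hnorm_rep_le[OF rep Y \<xi>]
    by (simp add: rep_add X Y \<xi> distrib_right)
qed (simp add: rep_seminorm_nonneg X Y)

lemma rep_seminorm_adj_le:
  assumes X: "X \<in> carrier B"
  shows "rep_seminorm B (X\<^sup>\<star>) \<le> rep_seminorm B X"
proof (rule rep_seminorm_le)
  fix H :: "(nat \<Rightarrow> complex \<times> 'b) hilb" and \<pi> \<xi>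
  assume rep: "star_rep B H \<pi>" and \<xi>: "\<xi> \<in> carrier H"
  interpret star_representation B H \<pi> by (rule star_representationI[OF star_algebra_axioms rep])
  show "hnorm H (\<pi> (X\<^sup>\<star>) \<xi>) \<le> rep_seminorm B X * hnorm H \<xi>"
    by (rule rep_adj_bound[OF X hnorm_rep_le[OF rep X] \<xi>])
qed (simp add: rep_seminorm_nonneg X)

end

sublocale bounded_star_algebra \<subseteq> cstar_seminorm B "rep_seminorm B"
proof
  fix X c assume X: "X \<in> carrier B"
  have "cmod c * rep_seminorm B X \<le> rep_seminorm B (c \<odot> X)"
  proof (cases "c = 0")
    case False
    then have "rep_seminorm B X = rep_seminorm B ((1 / c) \<odot> (c \<odot> X))"
      using X by (simp add: scale_scale scale_one)
    also have "\<dots> \<le> cmod (1 / c) * rep_seminorm B (c \<odot> X)"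
      using X by (intro rep_seminorm_scale_le scale_closed)
    finally show ?thesis using False by (simp add: norm_divide field_simps)
  qed (simp add: rep_seminorm_nonneg scale_closed X)
  with rep_seminorm_scale_le[OF X] show "rep_seminorm B (c \<odot> X) = cmod c * rep_seminorm B X"
    by (rule order_antisym)
  have "rep_seminorm B (X\<^sup>\<star> \<otimes> X) \<le> rep_seminorm B (X\<^sup>\<star>) * rep_seminorm B X"
    using X by (intro rep_seminorm_mult adj_closed)
  also have "\<dots> \<le> (rep_seminorm B X)\<^sup>2"
    unfolding power2_eq_square
    using X by (intro mult_right_mono rep_seminorm_adj_le rep_seminorm_nonneg)
  finally show "rep_seminorm B (X\<^sup>\<star> \<otimes> X) = (rep_seminorm B X)\<^sup>2"
    using rep_seminorm_square_le[OF X] by (rule order_antisym)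
qed (simp_all add: rep_seminorm_add rep_seminorm_mult)


section \<open>The enveloping algebra is a C*-algebra\<close>

lemma cauchy_alg_simps:
  "vadd (cauchy_alg B) = (\<lambda>s t n. s n \<oplus>\<^bsub>B\<^esub> t n)" "vzero (cauchy_alg B) = (\<lambda>n. \<zero>\<^bsub>B\<^esub>)"
  "vscale (cauchy_alg B) = (\<lambda>c s n. c \<odot>\<^bsub>B\<^esub> s n)" "amult (cauchy_alg B) = (\<lambda>s t n. s n \<otimes>\<^bsub>B\<^esub> t n)"
  "adj (cauchy_alg B) = (\<lambda>s n. (s n)\<^sup>\<star>\<^bsub>B\<^esub>)"
  by (simp_all add: cauchy_alg_def)

abbreviation cauchy_seqs where "cauchy_seqs B \<equiv> carrier (cauchy_alg B)"

lemma cauchy_seqs_iff: "s \<in> cauchy_seqs B \<longleftrightarrow> (\<forall>n. s n \<in> carrier B) \<and>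
    (\<forall>e>0. \<exists>N. \<forall>m\<ge>N. \<forall>n\<ge>N. rep_seminorm B (s m \<ominus>\<^bsub>B\<^esub> s n) < e)"
  by (simp add: cauchy_alg_def)

lemma cauchy_seqs_closed: "s \<in> cauchy_seqs B \<Longrightarrow> s n \<in> carrier B"
  by (simp add: cauchy_seqs_iff)

abbreviation limit_class where "limit_class B s \<equiv> null_rel B `` {s}"

lemma star_algebra_extend:
  assumes "star_algebra (A :: 'a star_alg)"
  shows "star_algebra (star_alg.extend A m)"
  using assms
  by (simp add: star_algebra_def complex_vector_space_def star_algebra_axioms_def star_alg.extend_def)

lemma envelope_simps:
  "carrier (envelope B) = carrier (quotient_alg (cauchy_alg B) (null_rel B))"
  "vadd (envelope B) = vadd (quotient_alg (cauchy_alg B) (null_rel B))"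
  "vzero (envelope B) = vzero (quotient_alg (cauchy_alg B) (null_rel B))"
  "vscale (envelope B) = vscale (quotient_alg (cauchy_alg B) (null_rel B))"
  "amult (envelope B) = amult (quotient_alg (cauchy_alg B) (null_rel B))"
  "adj (envelope B) = adj (quotient_alg (cauchy_alg B) (null_rel B))"
  "nrm (envelope B) X = the_elem ((\<lambda>s. lim (\<lambda>n. rep_seminorm B (s n))) ` X)"
  by (simp_all add: envelope_def star_alg.extend_def normed_star_alg.fields_def)

context bounded_star_algebra
begin

lemma cauchy_seqsI:
  assumes s: "s \<in> cauchy_seqs B" and t: "t \<in> cauchy_seqs B" and r: "\<And>n. r n \<in> carrier B"
    and bound: "\<And>m n. rep_seminorm B (r m \<ominus> r n)
      \<le> K * (rep_seminorm B (s m \<ominus> s n) + rep_seminorm B (t m \<ominus> t n))"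
  shows "r \<in> cauchy_seqs B"
  unfolding cauchy_seqs_iff
proof (intro conjI allI impI r)
  fix e :: real assume "0 < e"
  define d where "d = e / (2 * (\<bar>K\<bar> + 1))"
  have d: "0 < d" "2 * (\<bar>K\<bar> + 1) * d = e" using \<open>0 < e\<close> by (simp_all add: d_def)
  obtain M N where M: "\<And>m n. \<lbrakk>M \<le> m; M \<le> n\<rbrakk> \<Longrightarrow> rep_seminorm B (s m \<ominus> s n) < d"
    and N: "\<And>m n. \<lbrakk>N \<le> m; N \<le> n\<rbrakk> \<Longrightarrow> rep_seminorm B (t m \<ominus> t n) < d"
    using s t d(1) unfolding cauchy_seqs_iff by meson
  have "rep_seminorm B (r m \<ominus> r n) < e" if "max M N \<le> m" "max M N \<le> n" for m n
  proof -
    let ?x = "rep_seminorm B (s m \<ominus> s n) + rep_seminorm B (t m \<ominus> t n)"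
    have x: "0 \<le> ?x" "?x < 2 * d"
      using M[of m n] N[of m n] that s t
      by (simp_all add: cauchy_seqs_iff p_nonneg diff_closed)
    have "K * ?x \<le> (\<bar>K\<bar> + 1) * ?x" using x(1) by (intro mult_right_mono) auto
    also have "\<dots> < (\<bar>K\<bar> + 1) * (2 * d)" using x(2) by (intro mult_strict_left_mono) auto
    also have "\<dots> = e" using d(2) by (simp only: mult_ac)
    finally show ?thesis using bound[of m n] by simp
  qed
  then show "\<exists>N. \<forall>m\<ge>N. \<forall>n\<ge>N. rep_seminorm B (r m \<ominus> r n) < e" by blast
qed

lemma const_cauchy: "X \<in> carrier B \<Longrightarrow> (\<lambda>_. X) \<in> cauchy_seqs B"
  by (simp add: cauchy_seqs_iff p_diff_self)

lemma cauchy_convergent: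
  assumes "s \<in> cauchy_seqs B"
  shows "convergent (\<lambda>n. rep_seminorm B (s n))"
proof (rule Cauchy_convergent, rule metric_CauchyI)
  fix e :: real assume "0 < e"
  then obtain N where "\<And>m n. \<lbrakk>N \<le> m; N \<le> n\<rbrakk> \<Longrightarrow> rep_seminorm B (s m \<ominus> s n) < e"
    using assms unfolding cauchy_seqs_iff by meson
  then show "\<exists>N. \<forall>m\<ge>N. \<forall>n\<ge>N. dist (rep_seminorm B (s m)) (rep_seminorm B (s n)) < e"
    using p_reverse_triangle cauchy_seqs_closed[OF assms] unfolding dist_real_def
    by (meson le_less_trans)
qed

lemma cauchy_bounded:
  assumes "s \<in> cauchy_seqs B"
  obtains K where "0 \<le> K" "\<And>n. rep_seminorm B (s n) \<le> K"
proof -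
  obtain K where "\<And>n. norm (rep_seminorm B (s n)) \<le> K"
    using convergent_imp_Bseq[OF cauchy_convergent[OF assms]] by (auto simp: Bseq_def)
  then have K: "\<And>n. rep_seminorm B (s n) \<le> K" by (metis abs_ge_self order_trans real_norm_def)
  moreover have "0 \<le> K" using K[of 0] p_nonneg[OF cauchy_seqs_closed[OF assms, of 0]] by linarith
  ultimately show ?thesis using that by blast
qed

lemma cauchy_mult_closed:
  assumes "s \<in> cauchy_seqs B" "t \<in> cauchy_seqs B"
  shows "(\<lambda>n. s n \<otimes> t n) \<in> cauchy_seqs B"
proof -
  note c = cauchy_seqs_closed[OF assms(1)] cauchy_seqs_closed[OF assms(2)]
  obtain K L where K: "0 \<le> K" "\<And>n. rep_seminorm B (s n) \<le> K"
    and L: "0 \<le> L" "\<And>n. rep_seminorm B (t n) \<le> L"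
    using assms by (metis cauchy_bounded)
  show ?thesis
  proof (rule cauchy_seqsI[OF assms])
    fix m n
    have "rep_seminorm B (s m \<otimes> t m \<ominus> s n \<otimes> t n)
        \<le> rep_seminorm B (s m) * rep_seminorm B (t m \<ominus> t n) + rep_seminorm B (s m \<ominus> s n) * rep_seminorm B (t n)"
      by (intro p_mult_diff_mult c)
    also have "\<dots> \<le> max K L * rep_seminorm B (t m \<ominus> t n) + rep_seminorm B (s m \<ominus> s n) * max K L"
      using K L by (intro add_mono mult_mono p_nonneg diff_closed c) (auto simp: le_max_iff_disj)
    finally show "rep_seminorm B (s m \<otimes> t m \<ominus> s n \<otimes> t n)
        \<le> max K L * (rep_seminorm B (s m \<ominus> s n) + rep_seminorm B (t m \<ominus> t n))"
      by (simp add: algebra_simps)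
  qed (simp add: mult_closed c)
qed

lemma cauchy_add_closed:
  "\<lbrakk>s \<in> cauchy_seqs B; t \<in> cauchy_seqs B\<rbrakk> \<Longrightarrow> (\<lambda>n. s n \<oplus> t n) \<in> cauchy_seqs B"
  by (rule cauchy_seqsI[of s t _ 1]) (simp_all add: cauchy_seqs_closed add_closed p_add_diff_add)

lemma cauchy_scale_closed: "s \<in> cauchy_seqs B \<Longrightarrow> (\<lambda>n. c \<odot> s n) \<in> cauchy_seqs B"
  by (rule cauchy_seqsI[of s s _ "cmod c"])
    (simp_all add: cauchy_seqs_closed scale_closed p_scale_diff distrib_left p_nonneg diff_closed)

lemma cauchy_adj_closed: "s \<in> cauchy_seqs B \<Longrightarrow> (\<lambda>n. (s n)\<^sup>\<star>) \<in> cauchy_seqs B"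
  by (rule cauchy_seqsI[of s s _ 1])
    (simp_all add: cauchy_seqs_closed adj_closed p_adj_diff p_nonneg diff_closed)

lemmas cauchy_closed = cauchy_add_closed cauchy_scale_closed cauchy_adj_closed cauchy_mult_closed

lemma star_algebra_cauchy_alg: "star_algebra (cauchy_alg B)"
proof (intro star_algebra.intro complex_vector_space.intro star_algebra_axioms.intro)
  let ?C = "cauchy_alg B"
  note cl = cauchy_seqs_closed cauchy_closed
  show "comm_group \<lparr>carrier = carrier ?C, mult = vadd ?C, one = vzero ?C\<rparr>"
  proof (rule comm_groupI, goal_cases)
    case (6 s)
    then show ?case
      by (intro bexI[of _ "\<lambda>n. (-1) \<odot> s n"])
        (auto simp: cauchy_alg_simps cl add_neg add_commute[of "(-1) \<odot> _"] scale_closed)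
  qed (auto simp: cauchy_alg_simps cl const_cauchy zero_closed add_assoc add_zero
      add_commute[of \<zero>] intro!: ext add_commute)
qed (auto simp: cauchy_alg_simps cauchy_seqs_closed cauchy_closed
    scale_add_right scale_add_left scale_scale scale_one mult_assoc mult_add_left mult_add_right
    scale_mult_left scale_mult_right adj_adj adj_add adj_scale adj_mult)

lemma null_rel_iff: "(s, t) \<in> null_rel B \<longleftrightarrow> s \<in> cauchy_seqs B \<and> t \<in> cauchy_seqs B \<and>
    (\<lambda>n. rep_seminorm B (s n \<ominus> t n)) \<longlonglongrightarrow> 0"
  by (simp add: null_rel_def)

lemma equiv_null_rel: "equiv (cauchy_seqs B) (null_rel B)"
proof (rule equivI)
  show "refl_on (cauchy_seqs B) (null_rel B)"
    by (auto simp: refl_on_def null_rel_iff p_diff_self cauchy_seqs_closed)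
  show "sym (null_rel B)"
    by (auto simp: sym_def null_rel_iff cauchy_seqs_closed p_diff_commute)
  show "trans (null_rel B)"
  proof (rule transI)
    fix r s t assume a: "(r, s) \<in> null_rel B" "(s, t) \<in> null_rel B"
    then have "(\<lambda>n. rep_seminorm B (r n \<ominus> s n) + rep_seminorm B (s n \<ominus> t n)) \<longlonglongrightarrow> 0"
      by (intro tendsto_add_zero) (simp_all add: null_rel_iff)
    then have "(\<lambda>n. rep_seminorm B (r n \<ominus> t n)) \<longlonglongrightarrow> 0"
      using a unfolding null_rel_iff
      by (elim squeeze_zero) (intro p_nonneg p_diff_triangle diff_closed; simp add: cauchy_seqs_closed)+
    then show "(r, t) \<in> null_rel B" using a by (simp add: null_rel_iff)
  qed
qed (auto simp: null_rel_iff)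

sublocale limits: star_congruence "cauchy_alg B" "null_rel B"
proof (rule star_congruence.intro[OF star_algebra_cauchy_alg], unfold_locales)
  show "equiv (cauchy_seqs B) (null_rel B)" by (rule equiv_null_rel)
  note c = cauchy_seqs_closed
  fix s s' t t' c assume a: "(s, s') \<in> null_rel B"
  show "(c \<odot>\<^bsub>cauchy_alg B\<^esub> s, c \<odot>\<^bsub>cauchy_alg B\<^esub> s') \<in> null_rel B"
    using a by (simp add: cauchy_alg_simps null_rel_iff cauchy_closed p_scale_diff cauchy_seqs_closed
        tendsto_mult_right_zero)
  show "(s\<^sup>\<star>\<^bsub>cauchy_alg B\<^esub>, s'\<^sup>\<star>\<^bsub>cauchy_alg B\<^esub>) \<in> null_rel B"
    using a by (simp add: cauchy_alg_simps null_rel_iff cauchy_closed p_adj_diff cauchy_seqs_closed)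
  assume b: "(t, t') \<in> null_rel B"
  have lim: "(\<lambda>n. rep_seminorm B (s n \<ominus> s' n)) \<longlonglongrightarrow> 0" "(\<lambda>n. rep_seminorm B (t n \<ominus> t' n)) \<longlonglongrightarrow> 0"
    and cs: "s \<in> cauchy_seqs B" "s' \<in> cauchy_seqs B" "t \<in> cauchy_seqs B" "t' \<in> cauchy_seqs B"
    using a b by (simp_all add: null_rel_iff)
  note c = cs[THEN cauchy_seqs_closed]
  have "(\<lambda>n. rep_seminorm B ((s n \<oplus> t n) \<ominus> (s' n \<oplus> t' n))) \<longlonglongrightarrow> 0"
    by (rule squeeze_zero[OF tendsto_add_zero[OF lim]])
      (simp_all add: p_nonneg diff_closed add_closed c p_add_diff_add)
  then show "(s \<oplus>\<^bsub>cauchy_alg B\<^esub> t, s' \<oplus>\<^bsub>cauchy_alg B\<^esub> t') \<in> null_rel B"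
    using cs by (simp add: cauchy_alg_simps null_rel_iff cauchy_closed)
  obtain K L where K: "0 \<le> K" "\<And>n. rep_seminorm B (s n) \<le> K"
    and L: "0 \<le> L" "\<And>n. rep_seminorm B (t' n) \<le> L"
    using cs by (metis cauchy_bounded)
  have "rep_seminorm B (s n \<otimes> t n \<ominus> s' n \<otimes> t' n)
      \<le> K * rep_seminorm B (t n \<ominus> t' n) + rep_seminorm B (s n \<ominus> s' n) * L" for n
    using K L
    by (intro order_trans[OF p_mult_diff_mult] add_mono mult_mono p_nonneg diff_closed c) auto
  moreover have "(\<lambda>n. K * rep_seminorm B (t n \<ominus> t' n) + rep_seminorm B (s n \<ominus> s' n) * L) \<longlonglongrightarrow> 0"
    by (intro tendsto_add_zero tendsto_mult_right_zero tendsto_mult_left_zero lim)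
  ultimately have "(\<lambda>n. rep_seminorm B (s n \<otimes> t n \<ominus> s' n \<otimes> t' n)) \<longlonglongrightarrow> 0"
    using p_nonneg diff_closed mult_closed c by (metis (no_types, lifting) squeeze_zero)
  then show "(s \<otimes>\<^bsub>cauchy_alg B\<^esub> t, s' \<otimes>\<^bsub>cauchy_alg B\<^esub> t') \<in> null_rel B"
    using cs by (simp add: cauchy_alg_simps null_rel_iff cauchy_mult_closed)
qed

lemma carrier_envelope: "carrier (envelope B) = limit_class B ` cauchy_seqs B"
  by (simp add: envelope_simps limits.quotient_carrier)

lemma limit_class_closed: "s \<in> cauchy_seqs B \<Longrightarrow> limit_class B s \<in> carrier (envelope B)"
  by (simp add: carrier_envelope)

lemma envelope_ops:
  "vzero (envelope B) = limit_class B (\<lambda>_. \<zero>)"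
  "\<lbrakk>s \<in> cauchy_seqs B; t \<in> cauchy_seqs B\<rbrakk> \<Longrightarrow>
    limit_class B s \<oplus>\<^bsub>envelope B\<^esub> limit_class B t = limit_class B (\<lambda>n. s n \<oplus> t n)"
  "\<lbrakk>s \<in> cauchy_seqs B; t \<in> cauchy_seqs B\<rbrakk> \<Longrightarrow>
    limit_class B s \<otimes>\<^bsub>envelope B\<^esub> limit_class B t = limit_class B (\<lambda>n. s n \<otimes> t n)"
  "s \<in> cauchy_seqs B \<Longrightarrow> c \<odot>\<^bsub>envelope B\<^esub> limit_class B s = limit_class B (\<lambda>n. c \<odot> s n)"
  "s \<in> cauchy_seqs B \<Longrightarrow> (limit_class B s)\<^sup>\<star>\<^bsub>envelope B\<^esub> = limit_class B (\<lambda>n. (s n)\<^sup>\<star>)"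
  by (simp_all add: envelope_simps limits.quotient_simps) (simp_all add: cauchy_alg_simps)

lemma envelope_diff:
  "\<lbrakk>s \<in> cauchy_seqs B; t \<in> cauchy_seqs B\<rbrakk> \<Longrightarrow>
    limit_class B s \<ominus>\<^bsub>envelope B\<^esub> limit_class B t = limit_class B (\<lambda>n. s n \<ominus> t n)"
  by (simp add: vdiff_def envelope_ops cauchy_closed)

lemma limit_class_eq_iff:
  "\<lbrakk>s \<in> cauchy_seqs B; t \<in> cauchy_seqs B\<rbrakk> \<Longrightarrow>
    limit_class B s = limit_class B t \<longleftrightarrow> (\<lambda>n. rep_seminorm B (s n \<ominus> t n)) \<longlonglongrightarrow> 0"
  using eq_equiv_class_iff[OF equiv_null_rel, of s t] by (simp add: null_rel_iff)

lemma tendsto_nrm_limit_class: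
  assumes s: "s \<in> cauchy_seqs B"
  shows "(\<lambda>n. rep_seminorm B (s n)) \<longlonglongrightarrow> nrm (envelope B) (limit_class B s)"
proof -
  have same: "lim (\<lambda>n. rep_seminorm B (t n)) = lim (\<lambda>n. rep_seminorm B (s n))" if "(s, t) \<in> null_rel B" for t
  proof (rule limI)
    have t: "t \<in> cauchy_seqs B" and 0: "(\<lambda>n. rep_seminorm B (s n \<ominus> t n)) \<longlonglongrightarrow> 0"
      using that by (simp_all add: null_rel_iff)
    have "(\<lambda>n. rep_seminorm B (s n) - rep_seminorm B (t n)) \<longlonglongrightarrow> 0"
      by (rule tendsto_rabs_zero_cancel, rule squeeze_zero[OF 0])
        (simp_all add: p_reverse_triangle cauchy_seqs_closed s t)
    from tendsto_diff[OF cauchy_convergent[OF s, unfolded convergent_LIMSEQ_iff] this]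
    show "(\<lambda>n. rep_seminorm B (t n)) \<longlonglongrightarrow> lim (\<lambda>n. rep_seminorm B (s n))" by simp
  qed
  have "(\<lambda>t. lim (\<lambda>n. rep_seminorm B (t n))) ` limit_class B s = {lim (\<lambda>n. rep_seminorm B (s n))}"
  proof
    show "(\<lambda>t. lim (\<lambda>n. rep_seminorm B (t n))) ` limit_class B s \<subseteq> {lim (\<lambda>n. rep_seminorm B (s n))}"
      by (intro image_subsetI) (simp only: singleton_iff Image_singleton_iff same)
  qed (use equiv_class_self[OF equiv_null_rel s] in blast)
  then show ?thesis
    using cauchy_convergent[OF s] by (simp add: envelope_simps convergent_LIMSEQ_iff)
qed

lemma nrm_limit_class_eqI:
  "\<lbrakk>s \<in> cauchy_seqs B; (\<lambda>n. rep_seminorm B (s n)) \<longlonglongrightarrow> r\<rbrakk> \<Longrightarrow> nrm (envelope B) (limit_class B s) = r"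
  using LIMSEQ_unique tendsto_nrm_limit_class by blast

lemma star_algebra_envelope: "star_algebra (envelope B)"
  unfolding envelope_def by (rule star_algebra_extend[OF limits.star_algebra_quotient])

lemma cstar_seminorm_envelope: "cstar_seminorm (envelope B) (nrm (envelope B))"
proof (rule cstar_seminorm.intro[OF star_algebra_envelope], unfold_locales)
  let ?E = "envelope B"
  fix X Y c assume "X \<in> carrier ?E"
  then obtain s where s: "s \<in> cauchy_seqs B" "X = limit_class B s" by (auto simp: carrier_envelope)
  note ls = tendsto_nrm_limit_class[OF s(1), folded s(2)]
  show "nrm ?E (c \<odot>\<^bsub>?E\<^esub> X) = cmod c * nrm ?E X"
    using tendsto_mult_left[OF ls, of "cmod c"]
    by (simp add: s envelope_ops nrm_limit_class_eqI cauchy_closed p_scale cauchy_seqs_closed)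
  show "nrm ?E (X\<^sup>\<star>\<^bsub>?E\<^esub> \<otimes>\<^bsub>?E\<^esub> X) = (nrm ?E X)\<^sup>2"
    using tendsto_power[OF ls, of 2]
    by (simp add: s envelope_ops nrm_limit_class_eqI cauchy_closed p_cstar cauchy_seqs_closed)
  assume "Y \<in> carrier ?E"
  then obtain t where t: "t \<in> cauchy_seqs B" "Y = limit_class B t" by (auto simp: carrier_envelope)
  note lt = tendsto_nrm_limit_class[OF t(1), folded t(2)]
  show "nrm ?E (X \<oplus>\<^bsub>?E\<^esub> Y) \<le> nrm ?E X + nrm ?E Y"
    using tendsto_nrm_limit_class[OF cauchy_closed(1)[OF s(1) t(1)]] tendsto_add[OF ls lt]
    by (simp add: s t envelope_ops)
      (rule LIMSEQ_le, auto simp: p_triangle cauchy_seqs_closed s t)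
  show "nrm ?E (X \<otimes>\<^bsub>?E\<^esub> Y) \<le> nrm ?E X * nrm ?E Y"
    using tendsto_nrm_limit_class[OF cauchy_mult_closed[OF s(1) t(1)]] tendsto_mult[OF ls lt]
    by (simp add: s t envelope_ops)
      (rule LIMSEQ_le, auto simp: p_mult cauchy_seqs_closed s t)
qed

sublocale envelope: cstar_seminorm "envelope B" "nrm (envelope B)"
  by (rule cstar_seminorm_envelope)

lemma to_envelope_closed: "X \<in> carrier B \<Longrightarrow> to_envelope B X \<in> carrier (envelope B)"
  by (simp add: to_envelope_def limit_class_closed const_cauchy)

lemma to_envelope_hom: "to_envelope B \<in> star_hom B (envelope B)"
  by (intro star_homI) (simp_all add: to_envelope_closed, simp_all add: to_envelope_def envelope_ops const_cauchy)

lemma nrm_to_envelope: "X \<in> carrier B \<Longrightarrow> nrm (envelope B) (to_envelope B X) = rep_seminorm B X"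
  by (simp add: to_envelope_def nrm_limit_class_eqI const_cauchy)

lemma nrm_to_envelope_diff:
  "\<lbrakk>X \<in> carrier B; Y \<in> carrier B\<rbrakk> \<Longrightarrow>
    nrm (envelope B) (to_envelope B X \<ominus>\<^bsub>envelope B\<^esub> to_envelope B Y) = rep_seminorm B (X \<ominus> Y)"
  by (simp add: nrm_to_envelope diff_closed flip: star_hom_diff[OF star_algebra_axioms to_envelope_hom])

lemma tendsto_limit_class:
  assumes s: "s \<in> cauchy_seqs B"
  shows "(\<lambda>n. nrm (envelope B) (to_envelope B (s n) \<ominus>\<^bsub>envelope B\<^esub> limit_class B s)) \<longlonglongrightarrow> 0"
proof (rule LIMSEQ_I)
  fix e :: real assume "0 < e"
  then obtain N where N: "\<And>m n. \<lbrakk>N \<le> m; N \<le> n\<rbrakk> \<Longrightarrow> rep_seminorm B (s m \<ominus> s n) < e / 2"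
    using s half_gt_zero[of e] unfolding cauchy_seqs_iff by meson
  have "norm (nrm (envelope B) (to_envelope B (s m) \<ominus>\<^bsub>envelope B\<^esub> limit_class B s) - 0) < e" if m: "N \<le> m" for m
  proof -
    have c: "(\<lambda>_. s m) \<in> cauchy_seqs B" by (rule const_cauchy[OF cauchy_seqs_closed[OF s]])
    have eq: "to_envelope B (s m) \<ominus>\<^bsub>envelope B\<^esub> limit_class B s = limit_class B (\<lambda>n. s m \<ominus> s n)"
      unfolding to_envelope_def by (rule envelope_diff[OF c s])
    have d: "(\<lambda>n. s m \<ominus> s n) \<in> cauchy_seqs B"
      unfolding vdiff_def by (intro cauchy_closed(1) cauchy_closed(2) c s)
    have "nrm (envelope B) (limit_class B (\<lambda>n. s m \<ominus> s n)) \<le> e / 2"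
      using N m by (intro LIMSEQ_le_const2[OF tendsto_nrm_limit_class[OF d]]) (auto intro: less_imp_le)
    moreover have "0 \<le> nrm (envelope B) (limit_class B (\<lambda>n. s m \<ominus> s n))"
      by (intro envelope.p_nonneg limit_class_closed d)
    ultimately show ?thesis using \<open>0 < e\<close> by (simp add: eq)
  qed
  then show "\<exists>N. \<forall>n\<ge>N. norm (nrm (envelope B) (to_envelope B (s n) \<ominus>\<^bsub>envelope B\<^esub> limit_class B s) - 0) < e"
    by blast
qed

lemma to_envelope_dense:
  assumes "X \<in> carrier (envelope B)" "0 < e"
  obtains x where "x \<in> carrier B" "nrm (envelope B) (to_envelope B x \<ominus>\<^bsub>envelope B\<^esub> X) < e"
proof -
  obtain s where s: "s \<in> cauchy_seqs B" "X = limit_class B s"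
    using assms(1) by (auto simp: carrier_envelope)
  have "eventually (\<lambda>n. nrm (envelope B) (to_envelope B (s n) \<ominus>\<^bsub>envelope B\<^esub> X) < e) sequentially"
    using tendsto_limit_class[OF s(1)] assms(2) unfolding s(2) by (rule order_tendstoD)
  then show ?thesis
    using that cauchy_seqs_closed[OF s(1)] eventually_happens'[OF sequentially_bot] by blast
qed

text \<open>
  A Cauchy sequence in the envelope is approximated to within \<open>1 / (n + 1)\<close> by elements of \<open>B\<close>;
  these form a Cauchy sequence, and its class is the limit.
\<close>

lemma cstar_algebra_envelope: "cstar_algebra (envelope B)"
proof (rule cstar_algebra.intro[OF star_algebra_envelope], rule cstar_algebra_axioms.intro)
  let ?E = "envelope B" and ?n = "nrm (envelope B)"
  fix X assume "X \<in> carrier ?E"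
  then obtain s where s: "s \<in> cauchy_seqs B" "X = limit_class B s" by (auto simp: carrier_envelope)
  show "?n X = 0 \<longleftrightarrow> X = \<zero>\<^bsub>?E\<^esub>"
  proof
    assume "?n X = 0"
    then have "(\<lambda>n. rep_seminorm B (s n)) \<longlonglongrightarrow> 0"
      using tendsto_nrm_limit_class[OF s(1)] s(2) by simp
    moreover have "s n \<ominus> \<zero> = s n" for n
      using cauchy_seqs_closed[OF s(1)] scale_scale[OF zero_closed, of "-1" 0]
      by (simp add: vdiff_def scale_zero_left zero_closed add_zero)
    ultimately show "X = \<zero>\<^bsub>?E\<^esub>"
      by (simp add: s envelope_ops limit_class_eq_iff const_cauchy zero_closed)
  qed (simp add: envelope.p_zero)
next
  let ?E = "envelope B" and ?n = "nrm (envelope B)" and ?i = "to_envelope B"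
  fix S :: "nat \<Rightarrow> _" assume S: "\<forall>n. S n \<in> carrier ?E"
    and cauchy: "\<forall>e>0. \<exists>N. \<forall>m\<ge>N. \<forall>n\<ge>N. ?n (S m \<ominus>\<^bsub>?E\<^esub> S n) < e"
  have "\<exists>x. x \<in> carrier B \<and> ?n (?i x \<ominus>\<^bsub>?E\<^esub> S n) < inverse (real (Suc n))" for n
    using to_envelope_dense[OF S[rule_format, of n], of "inverse (real (Suc n))"] by force
  then obtain b where b: "\<And>n. b n \<in> carrier B"
    and near: "\<And>n. ?n (?i (b n) \<ominus>\<^bsub>?E\<^esub> S n) < inverse (real (Suc n))" by metis
  note cl = S[rule_format] to_envelope_closed[OF b]
  have bc: "b \<in> cauchy_seqs B"
    unfolding cauchy_seqs_iff
  proof (intro conjI allI impI b)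
    fix e :: real assume "0 < e"
    then obtain N where N: "\<And>m n. \<lbrakk>N \<le> m; N \<le> n\<rbrakk> \<Longrightarrow> ?n (S m \<ominus>\<^bsub>?E\<^esub> S n) < e / 3"
      using cauchy by (meson zero_less_divide_iff zero_less_numeral)
    obtain M where M: "inverse (real (Suc M)) < e / 3"
      using reals_Archimedean[of "e / 3"] \<open>0 < e\<close> by auto
    have "rep_seminorm B (b m \<ominus> b n) < e" if mn: "max M N \<le> m" "max M N \<le> n" for m n
    proof -
      have small: "inverse (real (Suc k)) < e / 3" if "M \<le> k" for k
        using M that by (elim le_less_trans[rotated]) (simp add: field_simps)
      have "rep_seminorm B (b m \<ominus> b n) \<le> ?n (?i (b m) \<ominus>\<^bsub>?E\<^esub> S m)
          + (?n (S m \<ominus>\<^bsub>?E\<^esub> S n) + ?n (S n \<ominus>\<^bsub>?E\<^esub> ?i (b n)))"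
        unfolding nrm_to_envelope_diff[OF b b, symmetric]
        by (intro order_trans[OF envelope.p_diff_triangle[of _ "S m"]] add_left_mono envelope.p_diff_triangle cl)
      then show ?thesis
        using N[of m n] near[of m] near[of n] small[of m] small[of n] mn
          envelope.p_diff_commute[OF cl(1)[of n] cl(2)[of n]]
        by simp
    qed
    then show "\<exists>N. \<forall>m\<ge>N. \<forall>n\<ge>N. rep_seminorm B (b m \<ominus> b n) < e" by blast
  qed
  have "(\<lambda>n. ?n (S n \<ominus>\<^bsub>?E\<^esub> limit_class B b)) \<longlonglongrightarrow> 0"
  proof (rule squeeze_zero)
    show "(\<lambda>n. inverse (real (Suc n)) + ?n (?i (b n) \<ominus>\<^bsub>?E\<^esub> limit_class B b)) \<longlonglongrightarrow> 0"
      by (intro tendsto_add_zero LIMSEQ_inverse_real_of_nat tendsto_limit_class bc)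
    show "?n (S n \<ominus>\<^bsub>?E\<^esub> limit_class B b)
        \<le> inverse (real (Suc n)) + ?n (?i (b n) \<ominus>\<^bsub>?E\<^esub> limit_class B b)" for n
      using envelope.p_diff_triangle[OF cl(1)[of n] cl(2)[of n] limit_class_closed[OF bc]] near[of n]
        envelope.p_diff_commute[OF cl(1)[of n] cl(2)[of n]] by simp
  qed (intro envelope.p_nonneg envelope.diff_closed cl limit_class_closed bc)
  then show "\<exists>X\<in>carrier ?E. (\<lambda>n. ?n (S n \<ominus>\<^bsub>?E\<^esub> X)) \<longlonglongrightarrow> 0"
    using limit_class_closed[OF bc] by blast
qed (simp_all add: envelope.p_nonneg envelope.p_scale envelope.p_triangle envelope.p_mult envelope.p_cstar)

end


section \<open>Extension of star-homomorphisms to the enveloping algebras\<close>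

lemma star_rep_comp:
  assumes f: "f \<in> star_hom B C" and rep: "star_rep C H \<pi>"
  shows "star_rep B H (\<lambda>X. \<pi> (f X))"
  using rep by (simp add: star_rep_def star_homD[OF f])

context bounded_star_algebra
begin

lemma seminorm_le_of_root:
  assumes s: "s \<in> carrier B" and t: "t \<in> carrier B"
    and d: "d = (t \<oplus> t\<^sup>\<star>) \<ominus> (s\<^sup>\<star> \<otimes> s \<oplus> t\<^sup>\<star> \<otimes> t)"
  shows "(rep_seminorm B s)\<^sup>2 \<le> 1 + rep_seminorm B d"
proof -
  have dc: "d \<in> carrier B"
    by (simp add: d s t diff_closed add_closed mult_closed adj_closed)
  have "rep_seminorm B s \<le> sqrt (1 + rep_seminorm B d)"
  proof (rule rep_seminorm_le)
    fix H :: "(nat \<Rightarrow> complex \<times> 'b) hilb" and \<pi> \<xi>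
    assume rep: "star_rep B H \<pi>" and \<xi>: "\<xi> \<in> carrier H"
    interpret star_representation B H \<pi> by (rule star_representationI[OF star_algebra_axioms rep])
    have "(hnorm H (\<pi> s \<xi>))\<^sup>2 \<le> (hnorm H \<xi>)\<^sup>2 + rep_seminorm B d * hnorm H \<xi> * hnorm H \<xi>"
      using rep_norm_le_of_root[OF s t \<xi> d] hnorm_rep_le[OF rep dc \<xi>]
        mult_right_mono[OF hnorm_rep_le[OF rep dc \<xi>] H.hnorm_nonneg[OF \<xi>]] by linarith
    also have "\<dots> = (sqrt (1 + rep_seminorm B d) * hnorm H \<xi>)\<^sup>2"
      by (simp add: power_mult_distrib p_nonneg[OF dc] distrib_right power2_eq_square[of "hnorm H \<xi>"])
    finally show "hnorm H (\<pi> s \<xi>) \<le> sqrt (1 + rep_seminorm B d) * hnorm H \<xi>"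
      by (rule power2_le_imp_le) (simp add: p_nonneg dc H.hnorm_nonneg \<xi>)
  qed (simp add: p_nonneg dc)
  then have "(rep_seminorm B s)\<^sup>2 \<le> (sqrt (1 + rep_seminorm B d))\<^sup>2"
    by (intro power_mono p_nonneg s)
  then show ?thesis by (simp add: p_nonneg dc)
qed

text \<open>
  Automatic continuity. If \<open>\<parallel>x\<parallel> < 1\<close> then \<open>1 - x\<^sup>\<star> x = (1 - b)\<^sup>\<star> (1 - b)\<close> for some \<open>b\<close> in \<open>D\<close>, and \<open>f\<close>
  preserves this identity; along representing Cauchy sequences the error \<open>d\<close> of the previous lemma tends to 0.
\<close>

lemma hom_to_envelope_contractive:
  assumes D: "cstar_algebra D" and f: "f \<in> star_hom D (envelope B)" and x: "x \<in> carrier D"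
  shows "nrm (envelope B) (f x) \<le> nrm D x"
proof -
  interpret D: cstar_algebra D by (rule D)
  interpret S: cstar_seminorm D "nrm D" by (rule D.cstar_seminorm_nrm)
  note f = star_homD[OF f]
  have "nrm (envelope B) (f x) \<le> nrm D x * 1"
  proof (rule S.le_of_unit_ball[OF _ x])
    fix y assume y: "y \<in> carrier D" "nrm D y < 1"
    obtain b where b: "b \<in> carrier D"
      and eq: "b \<oplus>\<^bsub>D\<^esub> b\<^sup>\<star>\<^bsub>D\<^esub> = y\<^sup>\<star>\<^bsub>D\<^esub> \<otimes>\<^bsub>D\<^esub> y \<oplus>\<^bsub>D\<^esub> b\<^sup>\<star>\<^bsub>D\<^esub> \<otimes>\<^bsub>D\<^esub> b"
      using D.exists_root_one_minus_square[OF y] by blast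
    obtain s t where s: "s \<in> cauchy_seqs B" "f y = limit_class B s"
      and t: "t \<in> cauchy_seqs B" "f b = limit_class B t"
      using f(1)[OF y(1)] f(1)[OF b] by (auto simp: carrier_envelope)
    have "f (b \<oplus>\<^bsub>D\<^esub> b\<^sup>\<star>\<^bsub>D\<^esub>) = limit_class B (\<lambda>n. t n \<oplus> (t n)\<^sup>\<star>)"
      by (simp add: f b D.adj_closed t envelope_ops cauchy_closed)
    moreover have "f (y\<^sup>\<star>\<^bsub>D\<^esub> \<otimes>\<^bsub>D\<^esub> y \<oplus>\<^bsub>D\<^esub> b\<^sup>\<star>\<^bsub>D\<^esub> \<otimes>\<^bsub>D\<^esub> b)
        = limit_class B (\<lambda>n. (s n)\<^sup>\<star> \<otimes> s n \<oplus> (t n)\<^sup>\<star> \<otimes> t n)"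
      by (simp add: f b y D.adj_closed D.mult_closed s t envelope_ops cauchy_closed)
    ultimately have lim:
      "(\<lambda>n. rep_seminorm B ((t n \<oplus> (t n)\<^sup>\<star>) \<ominus> ((s n)\<^sup>\<star> \<otimes> s n \<oplus> (t n)\<^sup>\<star> \<otimes> t n))) \<longlonglongrightarrow> 0"
      using eq s t by (simp add: cauchy_closed flip: limit_class_eq_iff)
    have "(nrm (envelope B) (f y))\<^sup>2 \<le> 1 + 0"
    proof (rule LIMSEQ_le)
      show "(\<lambda>n. (rep_seminorm B (s n))\<^sup>2) \<longlonglongrightarrow> (nrm (envelope B) (f y))\<^sup>2"
        unfolding s(2) by (intro tendsto_power tendsto_nrm_limit_class s(1))
      show "(\<lambda>n. 1 + rep_seminorm B ((t n \<oplus> (t n)\<^sup>\<star>) \<ominus> ((s n)\<^sup>\<star> \<otimes> s n \<oplus> (t n)\<^sup>\<star> \<otimes> t n))) \<longlonglongrightarrow> 1 + 0"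
        by (intro tendsto_add tendsto_const lim)
      show "\<exists>N. \<forall>n\<ge>N. (rep_seminorm B (s n))\<^sup>2
          \<le> 1 + rep_seminorm B ((t n \<oplus> (t n)\<^sup>\<star>) \<ominus> ((s n)\<^sup>\<star> \<otimes> s n \<oplus> (t n)\<^sup>\<star> \<otimes> t n))"
        using seminorm_le_of_root[OF cauchy_seqs_closed[OF s(1)] cauchy_seqs_closed[OF t(1)] refl] by blast
    qed
    then show "nrm (envelope B) (f y) \<le> 1" by (simp add: power2_le_imp_le[of _ 1])
  qed (simp_all add: f envelope.p_scale)
  then show ?thesis by simp
qed

end

definition envelope_map ::
    "('b, 'm) star_alg_scheme \<Rightarrow> ('c, 'n) star_alg_scheme \<Rightarrow> ('b \<Rightarrow> 'c) \<Rightarrow>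
     (nat \<Rightarrow> 'b) set \<Rightarrow> (nat \<Rightarrow> 'c) set"
  where "envelope_map B C f =
    restrict (\<lambda>X. \<Union>s\<in>X. null_rel C `` {\<lambda>n. f (s n)}) (carrier (envelope B))"

locale bounded_hom = B: bounded_star_algebra B + C: bounded_star_algebra C
  for B :: "('b, 'm) star_alg_scheme" and C :: "('c, 'n) star_alg_scheme" +
  fixes f :: "'b \<Rightarrow> 'c"
  assumes hom: "f \<in> star_hom B C"
begin

lemmas homD = star_homD[OF hom]
lemmas hom_diff = star_hom_diff[OF B.star_algebra_axioms hom]

lemma seminorm_hom_le:
  assumes X: "X \<in> carrier B"
  shows "rep_seminorm C (f X) \<le> rep_seminorm B X"
proof (rule C.rep_seminorm_le)
  fix H :: "(nat \<Rightarrow> complex \<times> 'c) hilb" and \<pi> \<xi>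
  assume rep: "star_rep C H \<pi>" and \<xi>: "\<xi> \<in> carrier H"
  show "hnorm H (\<pi> (f X) \<xi>) \<le> rep_seminorm B X * hnorm H \<xi>"
    by (rule B.hnorm_rep_le[OF star_rep_comp[OF hom rep] X \<xi>])
qed (rule B.p_nonneg[OF X])

lemma seminorm_hom_diff_le:
  "\<lbrakk>X \<in> carrier B; Y \<in> carrier B\<rbrakk> \<Longrightarrow> rep_seminorm C (f X \<ominus>\<^bsub>C\<^esub> f Y) \<le> rep_seminorm B (X \<ominus>\<^bsub>B\<^esub> Y)"
  using seminorm_hom_le[OF B.diff_closed[of X Y]] by (simp add: hom_diff)

lemma hom_cauchy:
  assumes s: "s \<in> cauchy_seqs B"
  shows "(\<lambda>n. f (s n)) \<in> cauchy_seqs C"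
  using s unfolding cauchy_seqs_iff by (meson homD(1) le_less_trans seminorm_hom_diff_le)

lemma hom_null_rel: "(s, t) \<in> null_rel B \<Longrightarrow> (\<lambda>n. f (s n), \<lambda>n. f (t n)) \<in> null_rel C"
  using seminorm_hom_diff_le cauchy_seqs_closed[of s B] cauchy_seqs_closed[of t B]
  by (auto simp: B.null_rel_iff C.null_rel_iff hom_cauchy homD C.p_nonneg C.diff_closed elim: squeeze_zero)

lemma hom_cauchy_alg: "(\<lambda>s n. f (s n)) \<in> star_hom (cauchy_alg B) (cauchy_alg C)"
  by (rule star_homI) (simp_all add: hom_cauchy, simp_all add: cauchy_alg_simps homD cauchy_seqs_closed)

lemma envelope_map_hom: "envelope_map B C f \<in> star_hom (envelope B) (envelope C)"
proof (rule star_hom_cong[OF B.star_algebra_envelope])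
  show "(\<lambda>X. \<Union>s\<in>X. limit_class C (\<lambda>n. f (s n))) \<in> star_hom (envelope B) (envelope C)"
    using quotient_hom[OF B.limits.star_congruence_axioms C.limits.star_congruence_axioms
        hom_cauchy_alg hom_null_rel]
    unfolding star_hom_def envelope_simps .
qed (simp add: envelope_map_def)

lemma envelope_map_limit_class:
  "s \<in> cauchy_seqs B \<Longrightarrow> envelope_map B C f (limit_class B s) = limit_class C (\<lambda>n. f (s n))"
  using quotient_hom_class[OF B.limits.star_congruence_axioms C.limits.star_congruence_axioms hom_null_rel]
  by (simp add: envelope_map_def B.limit_class_closed)

lemma envelope_map_extends: "extends_to_envelope B C f (envelope_map B C f)"
  unfolding extends_to_envelope_def to_envelope_def
  by (simp add: envelope_map_limit_class B.const_cauchy)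

lemma extended_hom_envelope_map: "extended_hom B C f (envelope_map B C f)"
  using envelope_map_hom envelope_map_extends by (simp add: extended_hom_def envelope_map_def)

end

text \<open>Both maps are contractive, hence continuous, and the image of \<open>B\<close> is dense.\<close>

lemma envelope_hom_eqI:
  assumes "bounded_star_algebra B" "bounded_star_algebra C"
    and F: "F \<in> star_hom (envelope B) (envelope C)" and G: "G \<in> star_hom (envelope B) (envelope C)"
    and agree: "\<And>x. x \<in> carrier B \<Longrightarrow> F (to_envelope B x) = G (to_envelope B x)"
    and X: "X \<in> carrier (envelope B)"
  shows "F X = G X"
proof -
  interpret B: bounded_star_algebra B by fact
  interpret C: bounded_star_algebra C by fact
  let ?n = "nrm (envelope C)"
  note c = star_homD(1)[OF F] star_homD(1)[OF G] B.to_envelope_closed X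
  have "?n (F X \<ominus>\<^bsub>envelope C\<^esub> G X) \<le> 0 + e" if e: "0 < e" for e
  proof -
    obtain x where x: "x \<in> carrier B"
      and near: "nrm (envelope B) (to_envelope B x \<ominus>\<^bsub>envelope B\<^esub> X) < e / 2"
      by (rule B.to_envelope_dense[OF X, of "e / 2"]) (use e in auto)
    have le: "?n (K (to_envelope B x) \<ominus>\<^bsub>envelope C\<^esub> K X) \<le> e / 2"
      if K: "K \<in> star_hom (envelope B) (envelope C)" for K
      using C.hom_to_envelope_contractive[OF B.cstar_algebra_envelope K
          B.envelope.diff_closed[OF B.to_envelope_closed[OF x] X]] near
      by (simp add: B.to_envelope_closed x X star_hom_diff[OF B.star_algebra_envelope K])
    have "?n (F X \<ominus>\<^bsub>envelope C\<^esub> G X) \<le> ?n (F X \<ominus>\<^bsub>envelope C\<^esub> F (to_envelope B x))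
        + ?n (G (to_envelope B x) \<ominus>\<^bsub>envelope C\<^esub> G X)"
      using C.envelope.p_diff_triangle[of "F X" "F (to_envelope B x)" "G X"] agree[OF x] c x by simp
    then show ?thesis
      using le[OF F] le[OF G] C.envelope.p_diff_commute[of "F X" "F (to_envelope B x)"] c x by simp
  qed
  then have "?n (F X \<ominus>\<^bsub>envelope C\<^esub> G X) \<le> 0" by (rule field_le_epsilon)
  moreover have d: "F X \<ominus>\<^bsub>envelope C\<^esub> G X \<in> carrier (envelope C)"
    by (intro C.envelope.diff_closed c(1)[OF X] c(2)[OF X])
  ultimately have "?n (F X \<ominus>\<^bsub>envelope C\<^esub> G X) = 0"
    using C.envelope.p_nonneg[OF d] by linarith
  then have "F X \<ominus>\<^bsub>envelope C\<^esub> G X = \<zero>\<^bsub>envelope C\<^esub>"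
    using cstar_algebra.norm_eq_zero[OF C.cstar_algebra_envelope d] by simp
  then show ?thesis by (rule C.envelope.diff_eq_zero[OF c(1)[OF X] c(2)[OF X]])
qed

lemma (in bounded_hom) extended_hom_unique: "extended_hom B C f F \<Longrightarrow> F = envelope_map B C f"
  using envelope_hom_eqI[OF B.bounded_star_algebra_axioms C.bounded_star_algebra_axioms _ envelope_map_hom]
    envelope_map_extends
  by (intro extensionalityI[of _ "carrier (envelope B)"])
    (auto simp: extended_hom_def extends_to_envelope_def envelope_map_def)

lemma (in bounded_hom) extended_hom_ex1: "\<exists>!F. extended_hom B C f F"
  using extended_hom_envelope_map extended_hom_unique by blast

lemma envelope_map_inverse:
  assumes "bounded_hom B C f" "bounded_hom C B g"
    and inv: "\<And>x. x \<in> carrier B \<Longrightarrow> g (f x) = x" and X: "X \<in> carrier (envelope B)"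
  shows "envelope_map C B g (envelope_map B C f X) = X"
proof -
  interpret f: bounded_hom B C f by fact
  interpret g: bounded_hom C B g by fact
  have "(\<lambda>X. X) \<in> star_hom (envelope B) (envelope B)" by (rule star_homI) auto
  moreover have "envelope_map C B g (envelope_map B C f (to_envelope B x)) = to_envelope B x"
    if "x \<in> carrier B" for x
    using f.envelope_map_extends g.envelope_map_extends that inv[OF that] f.homD(1)
    by (simp add: extends_to_envelope_def)
  ultimately show ?thesis
    using envelope_hom_eqI[OF f.B.bounded_star_algebra_axioms f.B.bounded_star_algebra_axioms
        star_hom_comp[OF f.envelope_map_hom g.envelope_map_hom] _ _ X] by blast
qed

lemma envelope_map_Aut:
  assumes "bounded_hom B B f" "bounded_hom B B g"
    and "\<And>x. x \<in> carrier B \<Longrightarrow> g (f x) = x" "\<And>x. x \<in> carrier B \<Longrightarrow> f (g x) = x"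
  shows "envelope_map B B f \<in> carrier (star_Aut (envelope B))"
proof -
  have "bij_betw (envelope_map B B f) (carrier (envelope B)) (carrier (envelope B))"
    using envelope_map_inverse[OF assms(1,2,3)] envelope_map_inverse[OF assms(2,1,4)]
      star_homD(1)[OF bounded_hom.envelope_map_hom[OF assms(1)]]
      star_homD(1)[OF bounded_hom.envelope_map_hom[OF assms(2)]]
    by (intro bij_betw_byWitness[where f' = "envelope_map B B g"]) auto
  then show ?thesis
    using bounded_hom.envelope_map_hom[OF assms(1)]
    by (simp add: star_Aut_def Bij_def envelope_map_def)
qed

locale bounded_action = bounded_star_algebra B + group G
  for B :: "('b, 'm) star_alg_scheme" and G :: "('g, 'k) monoid_scheme" +
  fixes \<alpha> :: "'g \<Rightarrow> 'b \<Rightarrow> 'b"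
  assumes action_hom: "g \<in> carrier G \<Longrightarrow> \<alpha> g \<in> star_hom B B"
    and action_one: "x \<in> carrier B \<Longrightarrow> \<alpha> (one G) x = x"
    and action_mult:
      "\<lbrakk>g \<in> carrier G; h \<in> carrier G; x \<in> carrier B\<rbrakk> \<Longrightarrow> \<alpha> (mult G g h) x = \<alpha> g (\<alpha> h x)"
begin

lemma bounded_hom_action: "g \<in> carrier G \<Longrightarrow> bounded_hom B B (\<alpha> g)"
  by (intro bounded_hom.intro bounded_star_algebra_axioms bounded_hom_axioms.intro action_hom)

lemma envelope_map_action_Aut:
  assumes g: "g \<in> carrier G"
  shows "envelope_map B B (\<alpha> g) \<in> carrier (star_Aut (envelope B))"
proof (rule envelope_map_Aut)
  show "\<alpha> (m_inv G g) (\<alpha> g x) = x" "\<alpha> g (\<alpha> (m_inv G g) x) = x" if "x \<in> carrier B" for x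
    using g that action_one by (simp_all flip: action_mult)
qed (simp_all add: bounded_hom_action g)

lemma extension_unique:
  assumes "g \<in> carrier G" "F \<in> carrier (star_Aut (envelope B))" "extends_to_envelope B B (\<alpha> g) F"
  shows "F = envelope_map B B (\<alpha> g)"
  using assms bounded_hom.extended_hom_unique[OF bounded_hom_action]
  by (simp add: star_Aut_def Bij_def extended_hom_def)

lemma extension_ex1:
  assumes "g \<in> carrier G"
  shows "\<exists>!F. F \<in> carrier (star_Aut (envelope B)) \<and> extends_to_envelope B B (\<alpha> g) F"
  by (rule ex1I, rule conjI[OF envelope_map_action_Aut[OF assms]
        bounded_hom.envelope_map_extends[OF bounded_hom_action[OF assms]]],
      elim conjE, rule extension_unique[OF assms])

lemma envelope_map_action_mult:
  assumes g: "g \<in> carrier G" and h: "h \<in> carrier G" and X: "X \<in> carrier (envelope B)"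
  shows "envelope_map B B (\<alpha> (mult G g h)) X = envelope_map B B (\<alpha> g) (envelope_map B B (\<alpha> h) X)"
proof -
  let ?F = "\<lambda>g. envelope_map B B (\<alpha> g)"
  have hom: "?F k \<in> star_hom (envelope B) (envelope B)" if "k \<in> carrier G" for k
    by (rule bounded_hom.envelope_map_hom[OF bounded_hom_action[OF that]])
  note ext = bounded_hom.envelope_map_extends[OF bounded_hom_action, unfolded extends_to_envelope_def, rule_format]
  show ?thesis
    by (rule envelope_hom_eqI[OF bounded_star_algebra_axioms bounded_star_algebra_axioms
          hom[OF m_closed[OF g h]] star_hom_comp[OF hom[OF h] hom[OF g]] _ X])
      (simp add: ext action_mult g h star_homD(1)[OF action_hom])
qed

lemma extended_action_envelope_map:
  "extended_action G B \<alpha> (restrict (\<lambda>g. envelope_map B B (\<alpha> g)) (carrier G))"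
proof -
  let ?E = "carrier (envelope B)"
  have Bij: "envelope_map B B (\<alpha> g) \<in> Bij ?E" if "g \<in> carrier G" for g
    using envelope_map_action_Aut[OF that] by (simp add: star_Aut_def)
  have "envelope_map B B (\<alpha> (mult G g h)) = compose ?E (envelope_map B B (\<alpha> g)) (envelope_map B B (\<alpha> h))"
    if "g \<in> carrier G" "h \<in> carrier G" for g h
    using envelope_map_action_mult[OF that]
    by (intro extensionalityI[of _ ?E]) (simp_all add: compose_def envelope_map_def[of B B "\<alpha> (mult G g h)"])
  then show ?thesis
    using envelope_map_action_Aut Bij bounded_hom.envelope_map_extends[OF bounded_hom_action]
    by (auto simp: extended_action_def hom_def star_Aut_def BijGroup_def)
qed

lemma extended_action_unique:
  assumes "extended_action G B \<alpha> \<beta>"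
  shows "\<beta> = restrict (\<lambda>g. envelope_map B B (\<alpha> g)) (carrier G)"
  using assms extension_unique
  by (intro extensionalityI[of _ "carrier G"]) (auto simp: extended_action_def hom_def Pi_iff)

lemma extended_action_ex1: "\<exists>!\<beta>. extended_action G B \<alpha> \<beta>"
  using extended_action_envelope_map extended_action_unique by blast

end

lemma extended_intertwining:
  assumes "bounded_star_algebra B" "bounded_star_algebra C"
    and \<rho>: "extended_hom B C f \<rho>" and \<beta>: "extended_action G B \<alpha> \<beta>" and \<gamma>: "extended_action G C \<alpha>' \<gamma>"
    and g: "g \<in> carrier G"
    and hom: "f \<in> star_hom B C" "\<alpha> g \<in> star_hom B B"
    and inter: "\<And>x. x \<in> carrier B \<Longrightarrow> f (\<alpha> g x) = \<alpha>' g (f x)" and X: "X \<in> carrier (envelope B)"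
  shows "\<rho> (\<beta> g X) = \<gamma> g (\<rho> X)"
proof -
  have h: "\<rho> \<in> star_hom (envelope B) (envelope C)" "\<beta> g \<in> star_hom (envelope B) (envelope B)"
    "\<gamma> g \<in> star_hom (envelope C) (envelope C)"
    using \<rho> \<beta> \<gamma> g by (auto simp: extended_hom_def extended_action_def hom_def star_Aut_def)
  show ?thesis
    using \<rho> \<beta> \<gamma> g star_homD(1)[OF hom(1)] star_homD(1)[OF hom(2)]
    by (intro envelope_hom_eqI[OF assms(1,2) star_hom_comp[OF h(2,1)] star_hom_comp[OF h(1,3)] _ X])
      (simp add: extended_hom_def extended_action_def extends_to_envelope_def inter)
qed


section \<open>Extensions of surjections are surjective\<close>

context bounded_star_algebra
begin

text \<open>This is \<open>z (1 - z\<^sup>\<star> z / R\<^sup>2)\<close>, written without a unit.\<close>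

definition cubic_correction :: "real \<Rightarrow> 'b \<Rightarrow> 'b"
  where "cubic_correction R z = z \<ominus> of_real (1 / R\<^sup>2) \<odot> (z \<otimes> (z\<^sup>\<star> \<otimes> z))"

lemma cubic_correction_closed: "z \<in> carrier B \<Longrightarrow> cubic_correction R z \<in> carrier B"
  by (simp add: cubic_correction_def diff_closed scale_closed mult_closed adj_closed)

lemma add_diff_cancel: "\<lbrakk>x \<in> carrier B; y \<in> carrier B\<rbrakk> \<Longrightarrow> (x \<oplus> y) \<ominus> x = y"
  by (simp add: vdiff_def add_commute[of x y] add_assoc scale_closed add_neg add_zero)

lemma seminorm_cubic_correction:
  assumes z: "z \<in> carrier B" and R: "0 < R" and le: "rep_seminorm B z \<le> R"
  shows "rep_seminorm B (cubic_correction R z) \<le> R / 2"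
    and "rep_seminorm B (cubic_correction R z) \<le> rep_seminorm B z"
    and "rep_seminorm B (cubic_correction R z \<ominus> z) \<le> (rep_seminorm B z) ^ 3 / R\<^sup>2"
proof -
  have bound: "hnorm H (\<pi> z \<eta>) \<le> R * hnorm H \<eta>"
    if "star_rep B H \<pi>" "\<eta> \<in> carrier H" for H :: "(nat \<Rightarrow> complex \<times> 'b) hilb" and \<pi> \<eta>
  proof -
    interpret star_representation B H \<pi> by (rule star_representationI[OF star_algebra_axioms that(1)])
    show ?thesis
      using hnorm_rep_le[OF that(1) z that(2)] mult_right_mono[OF le H.hnorm_nonneg[OF that(2)]] by linarith
  qed
  show "rep_seminorm B (cubic_correction R z) \<le> R / 2"
  proof (rule rep_seminorm_le)
    fix H :: "(nat \<Rightarrow> complex \<times> 'b) hilb" and \<pi> \<xi>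
    assume rep: "star_rep B H \<pi>" and \<xi>: "\<xi> \<in> carrier H"
    interpret star_representation B H \<pi> by (rule star_representationI[OF star_algebra_axioms rep])
    show "hnorm H (\<pi> (cubic_correction R z) \<xi>) \<le> R / 2 * hnorm H \<xi>"
      by (rule rep_norm_cubic_correction(1)[OF z R bound[OF rep] \<xi> cubic_correction_def])
  qed (use R in simp)
  show "rep_seminorm B (cubic_correction R z) \<le> rep_seminorm B z"
  proof (rule rep_seminorm_le)
    fix H :: "(nat \<Rightarrow> complex \<times> 'b) hilb" and \<pi> \<xi>
    assume rep: "star_rep B H \<pi>" and \<xi>: "\<xi> \<in> carrier H"
    interpret star_representation B H \<pi> by (rule star_representationI[OF star_algebra_axioms rep])
    show "hnorm H (\<pi> (cubic_correction R z) \<xi>) \<le> rep_seminorm B z * hnorm H \<xi>"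
      by (rule rep_norm_cubic_correction(2)[OF z R bound[OF rep] \<xi> cubic_correction_def hnorm_rep_le[OF rep z]])
  qed (rule p_nonneg[OF z])
  let ?y = "z \<otimes> (z\<^sup>\<star> \<otimes> z)"
  have y: "?y \<in> carrier B" using z by (simp add: mult_closed adj_closed)
  have "rep_seminorm B (cubic_correction R z \<ominus> z) = 1 / R\<^sup>2 * rep_seminorm B ?y"
    unfolding cubic_correction_def
    by (subst vdiff_def[of _ z]) (simp add: add_diff_cancel z y scale_closed p_scale norm_divide norm_power)
  also have "rep_seminorm B ?y \<le> rep_seminorm B z * (rep_seminorm B z)\<^sup>2"
    using p_mult[OF z, of "z\<^sup>\<star> \<otimes> z"] z by (simp add: mult_closed adj_closed p_cstar)
  finally show "rep_seminorm B (cubic_correction R z \<ominus> z) \<le> (rep_seminorm B z) ^ 3 / R\<^sup>2"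
    using R by (simp add: divide_right_mono power3_eq_cube power2_eq_square mult.assoc)
qed

end

context bounded_hom
begin

lemma hom_cubic_correction:
  "z \<in> carrier B \<Longrightarrow> f (B.cubic_correction R z) = C.cubic_correction R (f z)"
  by (simp add: B.cubic_correction_def C.cubic_correction_def hom_diff homD B.scale_closed
      B.mult_closed B.adj_closed)

text \<open>
  A large lift \<open>z\<close> of an element of the unit ball is halved repeatedly by the cubic correction with
  \<open>R = 2 ^ (n + 1), \<dots>, 4\<close>, which changes \<open>f z\<close> by at most \<open>1 / R\<^sup>2\<close> each time. These changes add up
  to at most \<open>1 / 4\<^sup>2 + 1 / 4\<^sup>3 + \<dots> < 1 / 4\<close>; the bound is stated in a form suited to induction.
\<close>

lemma shrink_lift:
  assumes "z \<in> carrier B" "rep_seminorm B z \<le> 2 ^ (n + 1)" "rep_seminorm C (f z) \<le> 1"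
  shows "\<exists>x\<in>carrier B. rep_seminorm B x \<le> 2 \<and> rep_seminorm C (f x \<ominus>\<^bsub>C\<^esub> f z) \<le> 1/4 - 1/4 ^ (n + 1)"
  using assms
proof (induction n arbitrary: z)
  case 0
  then show ?case by (intro bexI[of _ z]) (simp_all add: C.p_diff_self homD)
next
  case (Suc n)
  let ?R = "2 ^ (n + 2) :: real"
  let ?w = "B.cubic_correction ?R z"
  have R: "1 \<le> ?R" by (rule one_le_power) simp
  have z: "z \<in> carrier B" "f z \<in> carrier C" using Suc.prems homD by simp_all
  have w: "?w \<in> carrier B" by (rule B.cubic_correction_closed[OF z(1)])
  have "rep_seminorm B ?w \<le> 2 ^ (n + 1)"
    using B.seminorm_cubic_correction(1)[OF z(1), of ?R] Suc.prems by simp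
  moreover have "rep_seminorm C (f ?w) \<le> 1"
    using C.seminorm_cubic_correction(2)[OF z(2), of ?R] Suc.prems R
    by (simp add: hom_cubic_correction z)
  ultimately obtain x where x: "x \<in> carrier B" "rep_seminorm B x \<le> 2"
    "rep_seminorm C (f x \<ominus>\<^bsub>C\<^esub> f ?w) \<le> 1/4 - 1/4 ^ (n + 1)"
    using Suc.IH[OF w] by blast
  have "rep_seminorm C (f ?w \<ominus>\<^bsub>C\<^esub> f z) \<le> (rep_seminorm C (f z)) ^ 3 / ?R\<^sup>2"
    using C.seminorm_cubic_correction(3)[OF z(2), of ?R] Suc.prems R
    by (simp add: hom_cubic_correction z)
  also have "\<dots> \<le> 1 ^ 3 / ?R\<^sup>2"
    using Suc.prems by (intro divide_right_mono power_mono C.p_nonneg z) simp_all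
  also have "?R\<^sup>2 = 4 ^ (n + 2)" by (simp add: power_mult_distrib power2_eq_square flip: power_mult_distrib)
  finally have "rep_seminorm C (f ?w \<ominus>\<^bsub>C\<^esub> f z) \<le> 1 / 4 ^ (n + 2)" by simp
  moreover have "1/4 - 1/4 ^ (n + 1) + 1 / 4 ^ (n + 2) \<le> 1/4 - (1::real)/4 ^ (Suc n + 1)"
    by (simp add: field_simps)
  ultimately have "rep_seminorm C (f x \<ominus>\<^bsub>C\<^esub> f z) \<le> 1/4 - 1/4 ^ (Suc n + 1)"
    using C.p_diff_triangle[OF homD(1)[OF x(1)] homD(1)[OF w] z(2)] x(3) by linarith
  then show ?case using x by blast
qed

lemma approximate_lift:
  assumes surj: "f ` carrier B = carrier C" and y: "y \<in> carrier C" and d: "0 < d" "rep_seminorm C y \<le> d"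
  obtains x where "x \<in> carrier B" "rep_seminorm B x \<le> 2 * d" "rep_seminorm C (f x \<ominus>\<^bsub>C\<^esub> y) \<le> d / 4"
proof -
  let ?y = "of_real (1 / d) \<odot>\<^bsub>C\<^esub> y"
  have "?y \<in> f ` carrier B" using y surj by (simp add: C.scale_closed)
  then obtain z where z: "z \<in> carrier B" "f z = ?y" by auto
  obtain n where "rep_seminorm B z < 2 ^ n" using real_arch_pow[of 2 "rep_seminorm B z"] by auto
  also have "(2::real) ^ n \<le> 2 ^ (n + 1)" by (intro power_increasing) auto
  finally have "rep_seminorm B z \<le> 2 ^ (n + 1)" by simp
  moreover have "rep_seminorm C (f z) \<le> 1" using d y by (simp add: z C.p_scale norm_divide)
  ultimately obtain x where x: "x \<in> carrier B" "rep_seminorm B x \<le> 2"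
    and near: "rep_seminorm C (f x \<ominus>\<^bsub>C\<^esub> f z) \<le> 1/4 - 1/4 ^ (n + 1)"
    using shrink_lift[OF z(1)] by blast
  have "of_real d \<odot>\<^bsub>C\<^esub> f z = y"
    using d y by (simp add: z C.scale_scale C.scale_one flip: of_real_mult)
  then have "rep_seminorm C (f (of_real d \<odot>\<^bsub>B\<^esub> x) \<ominus>\<^bsub>C\<^esub> y) = d * rep_seminorm C (f x \<ominus>\<^bsub>C\<^esub> f z)"
    using d C.p_scale_diff[OF homD(1)[OF x(1)] homD(1)[OF z(1)], of "of_real d"] homD(4)[OF x(1)] by simp
  also have "\<dots> \<le> d * (1/4)"
    using near d by (intro mult_left_mono order_trans[OF near]) auto
  finally show ?thesis
    using x d by (intro that[of "of_real d \<odot>\<^bsub>B\<^esub> x"]) (simp_all add: B.scale_closed B.p_scale)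
qed

text \<open>
  Successive corrections: \<open>S (k + 1)\<close> differs from \<open>S k\<close> by an approximate lift of what is missing to
  the next approximation of the target.
\<close>

lemma envelope_map_surj:
  assumes surj: "f ` carrier B = carrier C"
  shows "envelope_map B C f ` carrier (envelope B) = carrier (envelope C)"
proof
  show "envelope_map B C f ` carrier (envelope B) \<subseteq> carrier (envelope C)"
    using star_homD(1)[OF envelope_map_hom] by blast
  show "carrier (envelope C) \<subseteq> envelope_map B C f ` carrier (envelope B)"
  proof
    fix Y assume Y: "Y \<in> carrier (envelope C)"
    let ?n = "nrm (envelope C)" and ?i = "to_envelope C"
    \<comment> \<open>The rate makes consecutive approximations differ by at most \<open>(1/2) ^ (k + 1)\<close>.\<close>
    have "\<exists>y. y \<in> carrier C \<and> ?n (?i y \<ominus>\<^bsub>envelope C\<^esub> Y) < (1/2) ^ (k + 2)" for k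
      using C.to_envelope_dense[OF Y, of "(1/2) ^ (k + 2)"] by force
    then obtain y where y: "\<And>k. y k \<in> carrier C"
      and near: "\<And>k. ?n (?i (y k) \<ominus>\<^bsub>envelope C\<^esub> Y) < (1/2) ^ (k + 2)" by metis
    have iy: "?i (y k) \<in> carrier (envelope C)" for k by (rule C.to_envelope_closed[OF y])
    have step: "rep_seminorm C (y (Suc k) \<ominus>\<^bsub>C\<^esub> y k) \<le> (1/2) ^ (k + 1)" for k
    proof -
      have "rep_seminorm C (y (Suc k) \<ominus>\<^bsub>C\<^esub> y k)
          \<le> ?n (?i (y (Suc k)) \<ominus>\<^bsub>envelope C\<^esub> Y) + ?n (?i (y k) \<ominus>\<^bsub>envelope C\<^esub> Y)"
        using C.envelope.p_diff_triangle[OF iy[of "Suc k"] Y iy[of k]]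
          C.envelope.p_diff_commute[OF Y iy[of k]] by (simp add: C.nrm_to_envelope_diff y)
      moreover have "(1/2::real) ^ (Suc k + 2) \<le> (1/2) ^ (k + 2)"
        "(1/2::real) ^ (k + 1) = (1/2) ^ (k + 2) + (1/2) ^ (k + 2)" by simp_all
      ultimately show ?thesis using near[of k] near[of "Suc k"] by linarith
    qed
    have "\<exists>S. \<forall>k. (S k \<in> carrier B \<and> rep_seminorm C (f (S k) \<ominus>\<^bsub>C\<^esub> y k) \<le> (1/2) ^ k) \<and>
        rep_seminorm B (S (Suc k) \<ominus>\<^bsub>B\<^esub> S k) \<le> 4 * (1/2) ^ k"
    proof (rule dependent_nat_choice)
      obtain x where x: "x \<in> carrier B" "f x = y 0" using y[of 0] surj by force
      then have "rep_seminorm C (f x \<ominus>\<^bsub>C\<^esub> y 0) = 0" by (simp add: C.p_diff_self y)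
      then show "\<exists>x. x \<in> carrier B \<and> rep_seminorm C (f x \<ominus>\<^bsub>C\<^esub> y 0) \<le> (1/2) ^ 0"
        using x by (intro exI[of _ x]) simp
    next
      fix S k assume "S \<in> carrier B \<and> rep_seminorm C (f S \<ominus>\<^bsub>C\<^esub> y k) \<le> (1/2) ^ k"
      then have S: "S \<in> carrier B" "f S \<in> carrier C" "rep_seminorm C (f S \<ominus>\<^bsub>C\<^esub> y k) \<le> (1/2) ^ k"
        by (simp_all add: homD)
      \<comment> \<open>The part of the next target that \<open>S\<close> misses; an approximate lift reduces the bound on it to a quarter.\<close>
      let ?d = "y (Suc k) \<ominus>\<^bsub>C\<^esub> f S"
      have "rep_seminorm C ?d \<le> 2 * (1/2) ^ k"
        using C.p_diff_triangle[OF y y S(2), of "Suc k" k] step[of k] S(3) C.p_diff_commute[OF y S(2), of k]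
          power_decreasing[of k "k + 1" "1/2::real"] by linarith
      then obtain x where x: "x \<in> carrier B" "rep_seminorm B x \<le> 2 * (2 * (1/2) ^ k)"
        "rep_seminorm C (f x \<ominus>\<^bsub>C\<^esub> ?d) \<le> 2 * (1/2) ^ k / 4"
        using approximate_lift[OF surj C.diff_closed[OF y S(2)], of "2 * (1/2) ^ k"] by force
      have fx: "f x \<in> carrier C" by (rule homD(1)[OF x(1)])
      have "y (Suc k) = ?d \<oplus>\<^bsub>C\<^esub> f S" by (simp add: C.diff_add_cancel y S)
      then have "f (S \<oplus>\<^bsub>B\<^esub> x) \<ominus>\<^bsub>C\<^esub> y (Suc k) = (f S \<oplus>\<^bsub>C\<^esub> f x) \<ominus>\<^bsub>C\<^esub> (f S \<oplus>\<^bsub>C\<^esub> ?d)"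
        using S x y by (simp add: homD C.add_commute[of "f S" ?d] C.diff_closed)
      then have "rep_seminorm C (f (S \<oplus>\<^bsub>B\<^esub> x) \<ominus>\<^bsub>C\<^esub> y (Suc k)) \<le> rep_seminorm C (f x \<ominus>\<^bsub>C\<^esub> ?d)"
        using C.p_add_diff_add[OF S(2) fx S(2) C.diff_closed[OF y S(2)]] by (simp add: C.p_diff_self S)
      then show "\<exists>T. (T \<in> carrier B \<and> rep_seminorm C (f T \<ominus>\<^bsub>C\<^esub> y (Suc k)) \<le> (1/2) ^ Suc k) \<and>
          rep_seminorm B (T \<ominus>\<^bsub>B\<^esub> S) \<le> 4 * (1/2) ^ k"
        using S x by (intro exI[of _ "S \<oplus>\<^bsub>B\<^esub> x"]) (simp add: B.add_closed B.add_diff_cancel)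
    qed
    then obtain S where S: "\<And>k. S k \<in> carrier B"
      "\<And>k. rep_seminorm C (f (S k) \<ominus>\<^bsub>C\<^esub> y k) \<le> (1/2) ^ k"
      "\<And>k. rep_seminorm B (S (Suc k) \<ominus>\<^bsub>B\<^esub> S k) \<le> 4 * (1/2) ^ k" by blast
    have Sc: "S \<in> cauchy_seqs B"
      unfolding cauchy_seqs_iff
      by (intro conjI allI impI S(1)
          geometric_steps_Cauchy[of "\<lambda>m n. rep_seminorm B (S m \<ominus>\<^bsub>B\<^esub> S n)" 4 "1/2"])
        (simp_all add: S B.p_diff_triangle B.p_diff_self, rule B.p_diff_commute[OF S(1) S(1)])
    let ?Z = "limit_class C (\<lambda>k. f (S k))"
    have fSc: "(\<lambda>k. f (S k)) \<in> cauchy_seqs C" by (rule hom_cauchy[OF Sc])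
    have Z: "?Z \<in> carrier (envelope C)" by (rule C.limit_class_closed[OF fSc])
    have iS: "?i (f (S k)) \<in> carrier (envelope C)" for k by (rule C.to_envelope_closed[OF homD(1)[OF S(1)]])
    have "?n (?Z \<ominus>\<^bsub>envelope C\<^esub> Y) \<le> 0"
    proof (rule LIMSEQ_le_const)
      have half: "(\<lambda>k. (1/2::real) ^ k) \<longlonglongrightarrow> 0" by (rule LIMSEQ_realpow_zero) auto
      show "(\<lambda>k. ?n (?i (f (S k)) \<ominus>\<^bsub>envelope C\<^esub> ?Z) + ((1/2) ^ k + (1/2) ^ (k + 2))) \<longlonglongrightarrow> 0"
        by (intro tendsto_add_zero C.tendsto_limit_class fSc half LIMSEQ_ignore_initial_segment)
      have "?n (?Z \<ominus>\<^bsub>envelope C\<^esub> Y)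
          \<le> ?n (?i (f (S k)) \<ominus>\<^bsub>envelope C\<^esub> ?Z) + ((1/2) ^ k + (1/2) ^ (k + 2))" for k
        using C.envelope.p_diff_triangle[OF Z iS[of k] Y] C.envelope.p_diff_triangle[OF iS[of k] iy[of k] Y]
          C.envelope.p_diff_commute[OF Z iS[of k]] near[of k] S(2)[of k]
          C.nrm_to_envelope_diff[OF homD(1)[OF S(1)] y, of k k] by linarith
      then show "\<exists>N. \<forall>k\<ge>N. ?n (?Z \<ominus>\<^bsub>envelope C\<^esub> Y)
          \<le> ?n (?i (f (S k)) \<ominus>\<^bsub>envelope C\<^esub> ?Z) + ((1/2) ^ k + (1/2) ^ (k + 2))" by blast
    qed
    then have "?n (?Z \<ominus>\<^bsub>envelope C\<^esub> Y) = 0"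
      using C.envelope.p_nonneg[OF C.envelope.diff_closed[OF Z Y]] by linarith
    then have "?Z = Y"
      using cstar_algebra.norm_eq_zero[OF C.cstar_algebra_envelope C.envelope.diff_closed[OF Z Y]]
        C.envelope.diff_eq_zero[OF Z Y] by blast
    then show "Y \<in> envelope_map B C f ` carrier (envelope B)"
      using envelope_map_limit_class[OF Sc] B.limit_class_closed[OF Sc] by blast
  qed
qed

end


section \<open>The star-algebra of words\<close>

lemma unital_words_iff:
  "w \<in> insert [] (alt_words A J) \<longleftrightarrow> set w \<subseteq> J \<times> carrier A \<and> distinct_adj (map fst w)"
  by (auto simp: alt_words_def)

lemma word_mult_Nil [simp]: "word_mult A [] v = v" "word_mult A u [] = u"
  by (simp_all add: word_mult_def)

lemma word_mult_append_left: "q \<noteq> [] \<Longrightarrow> word_mult A (p @ q) w = p @ word_mult A q w"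
  by (simp add: word_mult_def butlast_append)

lemma word_mult_append_right: "q \<noteq> [] \<Longrightarrow> word_mult A w (q @ p) = word_mult A w q @ p"
  by (cases q) (auto simp: word_mult_def)

lemma word_mult_snoc_Cons:
  "word_mult A (u @ [(i, a)]) ((j, b) # v)
    = (if i = j then u @ (j, a \<otimes>\<^bsub>A\<^esub> b) # v else u @ (i, a) # (j, b) # v)"
  by (simp add: word_mult_def)

lemma word_mult_eq_Nil_iff [simp]: "word_mult A u v = [] \<longleftrightarrow> u = [] \<and> v = []"
  by (simp add: word_mult_def)

lemma word_adj_append: "word_adj A (u @ v) = word_adj A v @ word_adj A u"
  by (simp add: word_adj_def)

lemma word_adj_Cons: "word_adj A ((j, a) # v) = word_adj A v @ [(j, a\<^sup>\<star>\<^bsub>A\<^esub>)]"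
  by (simp add: word_adj_def)

lemma word_adj_Nil [simp]: "word_adj A [] = []"
  by (simp add: word_adj_def)

context star_algebra
begin

lemma word_mult_closed:
  assumes u: "u \<in> insert [] (alt_words A J)" and v: "v \<in> insert [] (alt_words A J)"
  shows "word_mult A u v \<in> insert [] (alt_words A J)"
proof (cases u rule: rev_cases)
  case (snoc p x)
  obtain i a where x: "x = (i, a)" by (cases x)
  show ?thesis
  proof (cases v)
    case (Cons y q)
    obtain j b where y: "y = (j, b)" by (cases y)
    show ?thesis
      using u v unfolding unital_words_iff snoc x Cons y word_mult_snoc_Cons
      by (auto simp: distinct_adj_append_iff distinct_adj_Cons mult_closed)
  qed (use u in simp)
qed (use v in simp)

lemma word_mult_closed_alt:
  "\<lbrakk>u \<in> alt_words A J; v \<in> alt_words A J\<rbrakk> \<Longrightarrow> word_mult A u v \<in> alt_words A J"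
  using word_mult_closed[of u J v] by (auto simp: alt_words_def)

text \<open>
  If the middle word has at least two letters the two merges do not interact; for a single letter
  the outer words contribute only their adjacent letters.
\<close>

lemma word_mult_assoc:
  assumes "snd ` set u \<subseteq> carrier A" "snd ` set v \<subseteq> carrier A" "snd ` set w \<subseteq> carrier A"
  shows "word_mult A (word_mult A u v) w = word_mult A u (word_mult A v w)"
proof -
  consider "u = []" | "v = []" | "w = []" | p q where "p \<noteq> []" "q \<noteq> []" "v = p @ q"
    | x p y z q where "u = p @ [x]" "v = [y]" "w = z # q"
  proof -
    assume split: "u = [] \<Longrightarrow> thesis" "v = [] \<Longrightarrow> thesis" "w = [] \<Longrightarrow> thesis"
      "\<And>p q. \<lbrakk>p \<noteq> []; q \<noteq> []; v = p @ q\<rbrakk> \<Longrightarrow> thesis"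
      "\<And>p x y z q. \<lbrakk>u = p @ [x]; v = [y]; w = z # q\<rbrakk> \<Longrightarrow> thesis"
    show thesis
    proof (cases v)
      case (Cons y r)
      show ?thesis
      proof (cases "r = []")
        case True
        then show ?thesis using Cons split by (cases u rule: rev_cases; cases w) auto
      next
        case False
        then show ?thesis using Cons split(4)[of "[y]" r] by simp
      qed
    next
      case Nil
      then show ?thesis by (rule split(2))
    qed
  qed
  then show ?thesis
  proof cases
    case (4 p q)
    then show ?thesis
      by (simp add: word_mult_append_left word_mult_append_right)
  next
    case (5 x p y z q)
    have "word_mult A (word_mult A [x] [y]) [z] = word_mult A [x] (word_mult A [y] [z])"
      using assms 5 by (auto simp: word_mult_def mult_assoc)
    moreover have "word_mult A (word_mult A u v) w = p @ word_mult A (word_mult A [x] [y]) [z] @ q"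
      using word_mult_append_right[of "[z]" A _ q] 5 by (simp add: word_mult_append_left)
    moreover have "word_mult A u (word_mult A v w) = p @ word_mult A [x] (word_mult A [y] [z]) @ q"
      using word_mult_append_right[of "[z]" A "[y]" q] 5
      by (simp add: word_mult_append_left word_mult_append_right)
    ultimately show ?thesis by simp
  qed simp_all
qed

lemma word_mult_assoc_words:
  "\<lbrakk>u \<in> insert [] (alt_words A J); v \<in> insert [] (alt_words A J); w \<in> insert [] (alt_words A J)\<rbrakk>
   \<Longrightarrow> word_mult A (word_mult A u v) w = word_mult A u (word_mult A v w)"
  unfolding unital_words_iff by (intro word_mult_assoc) auto

lemma word_adj_closed:
  "w \<in> insert [] (alt_words A J) \<Longrightarrow> word_adj A w \<in> insert [] (alt_words A J)"
  unfolding unital_words_iff word_adj_def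
  by (auto simp: adj_closed rev_map[symmetric] o_def)

lemma word_adj_adj: "w \<in> insert [] (alt_words A J) \<Longrightarrow> word_adj A (word_adj A w) = w"
  unfolding unital_words_iff word_adj_def
  by (auto simp: rev_map[symmetric] adj_adj intro!: map_idI)

lemma word_adj_mult:
  assumes "u \<in> insert [] (alt_words A J)" "v \<in> insert [] (alt_words A J)"
  shows "word_adj A (word_mult A u v) = word_mult A (word_adj A v) (word_adj A u)"
proof (cases u rule: rev_cases)
  case (snoc p x)
  show ?thesis
  proof (cases v)
    case (Cons y q)
    obtain i a j b where xy: "x = (i, a)" "y = (j, b)" by (cases x, cases y)
    show ?thesis
      using assms unfolding unital_words_iff snoc Cons xy
      by (auto simp: word_mult_snoc_Cons word_adj_append word_adj_Cons adj_mult)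
  qed simp
qed simp

end

lemma keys_induct [consumes 1, case_names zero add single]:
  fixes p :: "'a \<Rightarrow>\<^sub>0 'b::comm_monoid_add"
  assumes "Poly_Mapping.keys p \<subseteq> W" and zero: "P 0"
    and add: "\<And>p q. \<lbrakk>Poly_Mapping.keys p \<subseteq> W; Poly_Mapping.keys q \<subseteq> W; P p; P q\<rbrakk> \<Longrightarrow> P (p + q)"
    and single: "\<And>w c. w \<in> W \<Longrightarrow> P (Poly_Mapping.single w c)"
  shows "P p"
proof -
  have "Poly_Mapping.keys (\<Sum>w\<in>F. Poly_Mapping.single w (g w)) \<subseteq> W \<and>
      P (\<Sum>w\<in>F. Poly_Mapping.single w (g w))" if "finite F" "F \<subseteq> W" for F and g :: "'a \<Rightarrow> 'b"
    using that
  proof (induction F rule: finite_induct)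
    case (insert w F)
    have "Poly_Mapping.keys (Poly_Mapping.single w (g w)) \<subseteq> W" using insert by auto
    then show ?case
      using insert add single Poly_Mapping.keys_add[of "Poly_Mapping.single w (g w)"] by simp blast
  qed (simp add: zero)
  moreover have "p = (\<Sum>w\<in>Poly_Mapping.keys p. Poly_Mapping.single w (Poly_Mapping.lookup p w))"
    by (rule poly_mapping_eqI)
      (auto simp: lookup_sum lookup_single when_def in_keys_iff sum.If_cases if_distrib cong: if_cong)
  ultimately show ?thesis using assms(1) by (metis finite_keys)
qed

text \<open>The product and the adjoint of \<^const>\<open>word_alg\<close> do not depend on the set of words.\<close>

definition word_prod where "word_prod A = amult (word_alg A UNIV)"
definition word_star where "word_star A = adj (word_alg A UNIV)"

lemma word_alg_simps:
  "carrier (word_alg A W) = {p. Poly_Mapping.keys p \<subseteq> W}" "vadd (word_alg A W) = (+)"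
  "vzero (word_alg A W) = 0" "vscale (word_alg A W) = fscale"
  "amult (word_alg A W) = word_prod A" "adj (word_alg A W) = word_star A"
  by (simp_all add: word_alg_def word_prod_def word_star_def)

lemma word_prod_superset:
  assumes "finite F" "finite G" "Poly_Mapping.keys p \<subseteq> F" "Poly_Mapping.keys q \<subseteq> G"
  shows "word_prod A p q = (\<Sum>u\<in>F. \<Sum>v\<in>G.
    Poly_Mapping.single (word_mult A u v) (Poly_Mapping.lookup p u * Poly_Mapping.lookup q v))"
proof -
  have "word_prod A p q = (\<Sum>u\<in>Poly_Mapping.keys p. \<Sum>v\<in>G.
      Poly_Mapping.single (word_mult A u v) (Poly_Mapping.lookup p u * Poly_Mapping.lookup q v))"
    unfolding word_prod_def word_alg_def star_alg.simps
    using assms by (intro sum.cong refl sum.mono_neutral_left) (auto simp: in_keys_iff)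
  also have "\<dots> = (\<Sum>u\<in>F. \<Sum>v\<in>G.
      Poly_Mapping.single (word_mult A u v) (Poly_Mapping.lookup p u * Poly_Mapping.lookup q v))"
    using assms by (intro sum.mono_neutral_left) (auto simp: in_keys_iff)
  finally show ?thesis .
qed

lemma word_prod_add_left: "word_prod A (p + p') q = word_prod A p q + word_prod A p' q"
  using Poly_Mapping.keys_add[of p p']
  by (simp add: word_prod_superset[of "Poly_Mapping.keys p \<union> Poly_Mapping.keys p'" "Poly_Mapping.keys q"]
      lookup_add distrib_right single_add sum.distrib)

lemma word_prod_add_right: "word_prod A p (q + q') = word_prod A p q + word_prod A p q'"
  using Poly_Mapping.keys_add[of q q']
  by (simp add: word_prod_superset[of "Poly_Mapping.keys p" "Poly_Mapping.keys q \<union> Poly_Mapping.keys q'"]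
      lookup_add distrib_left single_add sum.distrib)

lemma word_prod_fscale_left: "word_prod A (fscale c p) q = fscale c (word_prod A p q)"
  using keys_fscale[of c p]
  by (simp add: word_prod_superset[of "Poly_Mapping.keys p" "Poly_Mapping.keys q"]
      lookup_fscale fscale_sum fscale_single mult.assoc)

lemma word_prod_fscale_right: "word_prod A p (fscale c q) = fscale c (word_prod A p q)"
  using keys_fscale[of c q]
  by (simp add: word_prod_superset[of "Poly_Mapping.keys p" "Poly_Mapping.keys q"]
      lookup_fscale fscale_sum fscale_single mult.left_commute)

lemma word_prod_single [simp]:
  "word_prod A (Poly_Mapping.single u a) (Poly_Mapping.single v b)
    = Poly_Mapping.single (word_mult A u v) (a * b)"
  by (simp add: word_prod_superset[of "{u}" "{v}"])

lemma word_prod_zero [simp]: "word_prod A 0 q = 0" "word_prod A p 0 = 0"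
  by (simp_all add: word_prod_def word_alg_def)

lemma word_star_superset:
  assumes "finite F" "Poly_Mapping.keys p \<subseteq> F"
  shows "word_star A p
    = (\<Sum>w\<in>F. Poly_Mapping.single (word_adj A w) (cnj (Poly_Mapping.lookup p w)))"
  unfolding word_star_def word_alg_def star_alg.simps
  using assms by (intro sum.mono_neutral_left) (auto simp: in_keys_iff)

lemma word_star_add: "word_star A (p + q) = word_star A p + word_star A q"
  using Poly_Mapping.keys_add[of p q]
  by (simp add: word_star_superset[of "Poly_Mapping.keys p \<union> Poly_Mapping.keys q"]
      lookup_add single_add sum.distrib)

lemma word_star_fscale: "word_star A (fscale c p) = fscale (cnj c) (word_star A p)"
  using keys_fscale[of c p]
  by (simp add: word_star_superset[of "Poly_Mapping.keys p"] lookup_fscale fscale_sum fscale_single)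

lemma word_star_single [simp]:
  "word_star A (Poly_Mapping.single w c) = Poly_Mapping.single (word_adj A w) (cnj c)"
  by (simp add: word_star_superset[of "{w}"])

lemma word_star_zero [simp]: "word_star A 0 = 0"
  by (simp add: word_star_def word_alg_def)

text \<open>The words of the two free products: the nonempty ones, or all of them.\<close>

locale word_star_algebra = star_algebra A for A :: "('a, 'm) star_alg_scheme" (structure) +
  fixes J :: "'j set" and W :: "('j, 'a) word set"
  assumes words: "W = alt_words A J \<or> W = insert [] (alt_words A J)"
begin

lemma W_unital: "w \<in> W \<Longrightarrow> w \<in> insert [] (alt_words A J)"
  using words by blast

lemma W_mult_closed: "\<lbrakk>u \<in> W; v \<in> W\<rbrakk> \<Longrightarrow> word_mult A u v \<in> W"
  using words word_mult_closed word_mult_closed_alt by (metis (no_types, lifting))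

lemma W_adj_closed: "w \<in> W \<Longrightarrow> word_adj A w \<in> W"
  using word_adj_closed[OF W_unital, of w] words by (elim disjE) (auto simp: alt_words_def word_adj_def)

lemma W_assoc:
  "\<lbrakk>u \<in> W; v \<in> W; w \<in> W\<rbrakk> \<Longrightarrow> word_mult A (word_mult A u v) w = word_mult A u (word_mult A v w)"
  by (rule word_mult_assoc_words[OF W_unital W_unital W_unital])

lemma keys_add_subset:
  "\<lbrakk>Poly_Mapping.keys p \<subseteq> W; Poly_Mapping.keys q \<subseteq> W\<rbrakk> \<Longrightarrow> Poly_Mapping.keys (p + q) \<subseteq> W"
  using Poly_Mapping.keys_add[of p q] by blast

lemma keys_word_prod:
  assumes p: "Poly_Mapping.keys p \<subseteq> W" and q: "Poly_Mapping.keys q \<subseteq> W"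
  shows "Poly_Mapping.keys (word_prod A p q) \<subseteq> W"
  using p
proof (induction rule: keys_induct)
  case (single u a)
  show ?case
    using q by (induction rule: keys_induct) (simp_all add: word_prod_add_right keys_add_subset W_mult_closed single)
qed (simp_all add: word_prod_add_left keys_add_subset)

lemma keys_word_star: "Poly_Mapping.keys p \<subseteq> W \<Longrightarrow> Poly_Mapping.keys (word_star A p) \<subseteq> W"
  by (induction rule: keys_induct) (simp_all add: word_star_add keys_add_subset W_adj_closed)

lemma word_prod_assoc:
  assumes p: "Poly_Mapping.keys p \<subseteq> W" and q: "Poly_Mapping.keys q \<subseteq> W" and r: "Poly_Mapping.keys r \<subseteq> W"
  shows "word_prod A (word_prod A p q) r = word_prod A p (word_prod A q r)"
  using p
proof (induction rule: keys_induct)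
  case (single u a)
  show ?case
    using q
  proof (induction rule: keys_induct)
    case (single v b)
    show ?case
      using r by (induction rule: keys_induct) (simp_all add: word_prod_add_right W_assoc single \<open>u \<in> W\<close> mult.assoc)
  qed (simp_all add: word_prod_add_left word_prod_add_right)
qed (simp_all add: word_prod_add_left)

lemma word_star_word_prod:
  assumes p: "Poly_Mapping.keys p \<subseteq> W" and q: "Poly_Mapping.keys q \<subseteq> W"
  shows "word_star A (word_prod A p q) = word_prod A (word_star A q) (word_star A p)"
  using p
proof (induction rule: keys_induct)
  case (single u a)
  show ?case
    using q
    by (induction rule: keys_induct)
      (simp_all add: word_prod_add_left word_prod_add_right word_star_add word_adj_mult[OF W_unital W_unital] single
        mult.commute)
qed (simp_all add: word_prod_add_left word_prod_add_right word_star_add)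

lemma word_star_word_star: "Poly_Mapping.keys p \<subseteq> W \<Longrightarrow> word_star A (word_star A p) = p"
  by (induction rule: keys_induct) (simp_all add: word_star_add word_adj_adj[OF W_unital])

sublocale word_alg: star_algebra "word_alg A W"
proof -
  interpret module fscale by (rule module_fscale)
  have keys: "Poly_Mapping.keys (fscale c p) \<subseteq> W" if "Poly_Mapping.keys p \<subseteq> W" for c p
    using keys_fscale[of c p] that by (rule order_trans)
  show "star_algebra (word_alg A W)"
  proof (intro star_algebra.intro complex_vector_space.intro star_algebra_axioms.intro, unfold word_alg_simps)
    show "comm_group \<lparr>carrier = {p :: ('j, 'a) word \<Rightarrow>\<^sub>0 complex. Poly_Mapping.keys p \<subseteq> W}, mult = (+), one = 0\<rparr>"
    proof (rule comm_groupI, goal_cases)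
      case (6 p)
      then show ?case by (intro bexI[of _ "- p"]) auto
    qed (simp_all add: keys_add_subset add.assoc add.commute)
  qed (simp_all add: keys scale_left_distrib scale_right_distrib word_prod_fscale_left
      word_prod_fscale_right word_prod_add_left word_prod_add_right word_star_add word_star_fscale
      keys_word_prod keys_word_star word_prod_assoc word_star_word_prod word_star_word_star)
qed

end


section \<open>The algebraic free products are star-algebras\<close>

lemma span_semilinear_image:
  fixes F :: "('w \<Rightarrow>\<^sub>0 complex) \<Rightarrow> ('v \<Rightarrow>\<^sub>0 complex)"
  assumes add: "\<And>p q. F (p + q) = F p + F q"
    and scale: "\<And>c p. F (fscale c p) = fscale (\<kappa> c) (F p)"
    and S: "\<And>s. s \<in> S \<Longrightarrow> F s \<in> module.span fscale T" and p: "p \<in> module.span fscale S"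
  shows "F p \<in> module.span fscale T"
proof -
  interpret module fscale by (rule module_fscale)
  show ?thesis
    using p
  proof (induction rule: span_induct_alt)
    case base
    have "F 0 = 0" using add[of 0 0] by simp
    then show ?case by (simp add: module.span_zero[OF module_fscale])
  next
    case (step c x y)
    then show ?case by (simp add: add scale module.span_add[OF module_fscale] module.span_scale[OF module_fscale] S)
  qed
qed

text \<open>
  The assumptions make the span of \<open>S\<close> a *-ideal: by bilinearity it suffices to multiply the spanning
  relations by single words.
\<close>

lemma (in word_star_algebra) star_congruence_span_rel:
  assumes left: "\<And>s w. \<lbrakk>s \<in> S; w \<in> W\<rbrakk> \<Longrightarrow> word_prod A (Poly_Mapping.single w 1) s \<in> module.span fscale S"
    and right: "\<And>s w. \<lbrakk>s \<in> S; w \<in> W\<rbrakk> \<Longrightarrow> word_prod A s (Poly_Mapping.single w 1) \<in> module.span fscale S"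
    and star: "\<And>s. s \<in> S \<Longrightarrow> word_star A s \<in> module.span fscale S"
  shows "star_congruence (word_alg A W) (span_rel W S)"
proof -
  interpret module fscale by (rule module_fscale)
  have L: "word_prod A p s \<in> span S" if p: "Poly_Mapping.keys p \<subseteq> W" and s: "s \<in> span S" for p s
  proof (rule span_semilinear_image[OF word_prod_add_right word_prod_fscale_right _ s])
    fix t assume t: "t \<in> S"
    show "word_prod A p t \<in> span S"
      using p
    proof (induction rule: keys_induct)
      case (single w c)
      then show ?case
        using span_scale[OF left[OF t single], of c]
        by (simp add: fscale_single flip: word_prod_fscale_left)
    qed (simp_all add: word_prod_add_left span_zero span_add)
  qed
  have R: "word_prod A s q \<in> span S" if q: "Poly_Mapping.keys q \<subseteq> W" and s: "s \<in> span S" for q s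
  proof (rule span_semilinear_image[OF word_prod_add_left word_prod_fscale_left _ s])
    fix t assume t: "t \<in> S"
    show "word_prod A t q \<in> span S"
      using q
    proof (induction rule: keys_induct)
      case (single w c)
      then show ?case
        using span_scale[OF right[OF t single], of c]
        by (simp add: fscale_single flip: word_prod_fscale_right)
    qed (simp_all add: word_prod_add_right span_zero span_add)
  qed
  have diff_left: "word_prod A (p - p') q = word_prod A p q - word_prod A p' q" for p p' q
    using word_prod_add_left[of A "p - p'" p' q] by simp
  have diff_right: "word_prod A p (q - q') = word_prod A p q - word_prod A p q'" for p q q'
    using word_prod_add_right[of A p "q - q'" q'] by simp
  have diff_star: "word_star A (p - q) = word_star A p - word_star A q" for p q
    using word_star_add[of A "p - q" q] by simp
  show ?thesis
  proof (rule star_congruence.intro[OF word_alg.star_algebra_axioms], unfold_locales, unfold word_alg_simps)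
    show "equiv {p. Poly_Mapping.keys p \<subseteq> W} (span_rel W S)" by (rule equiv_span_rel)
    fix p p' q q' c assume p: "(p, p') \<in> span_rel W S"
    then have kp: "Poly_Mapping.keys p \<subseteq> W" "Poly_Mapping.keys p' \<subseteq> W" "p - p' \<in> span S"
      by (simp_all add: span_rel_def)
    show "(fscale c p, fscale c p') \<in> span_rel W S"
      using kp span_scale[OF kp(3), of c] keys_fscale[of c p] keys_fscale[of c p']
      by (auto simp: span_rel_def scale_right_diff_distrib)
    show "(word_star A p, word_star A p') \<in> span_rel W S"
      using kp span_semilinear_image[OF word_star_add word_star_fscale star kp(3)]
      by (simp add: span_rel_def keys_word_star diff_star)
    assume q: "(q, q') \<in> span_rel W S"
    then have kq: "Poly_Mapping.keys q \<subseteq> W" "Poly_Mapping.keys q' \<subseteq> W" "q - q' \<in> span S"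
      by (simp_all add: span_rel_def)
    show "(p + q, p' + q') \<in> span_rel W S"
      using kp kq span_add[OF kp(3) kq(3)] by (simp add: span_rel_def keys_add_subset algebra_simps)
    have "word_prod A p q - word_prod A p' q' = word_prod A p (q - q') + word_prod A (p - p') q'"
      by (simp add: diff_left diff_right)
    then show "(word_prod A p q, word_prod A p' q') \<in> span_rel W S"
      using kp kq L[OF kp(1) kq(3)] R[OF kq(2) kp(3)]
      by (simp add: span_rel_def keys_word_prod span_add)
  qed
qed

text \<open>
  Multiplication by a word and the adjoint affect a marked letter of a word either not at all or by
  a map \<open>L\<close> that is additive and homogeneous up to \<open>\<kappa>\<close>, so they carry relations to relations.
\<close>

lemma multilinear_rels_image:
  fixes A :: "('a, 'm) star_alg_scheme" and F :: "(('j, 'a) word \<Rightarrow>\<^sub>0 complex) \<Rightarrow> (('j, 'a) word \<Rightarrow>\<^sub>0 complex)"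
  assumes add: "\<And>p q. F (p + q) = F p + F q"
    and single: "\<And>w c. F (Poly_Mapping.single w c) = Poly_Mapping.single (\<phi> w) (\<kappa> c)" and one: "\<kappa> 1 = 1"
    and letter: "\<And>u j a v. u @ (j, a) # v \<in> alt_words A J \<Longrightarrow>
      \<exists>u' v' L. \<forall>x\<in>carrier A. \<phi> (u @ (j, x) # v) = u' @ (j, L x) # v' \<and>
        u' @ (j, L x) # v' \<in> alt_words A J \<and>
        (\<forall>y\<in>carrier A. L (x \<oplus>\<^bsub>A\<^esub> y) = L x \<oplus>\<^bsub>A\<^esub> L y) \<and> (\<forall>c. L (c \<odot>\<^bsub>A\<^esub> x) = \<kappa> c \<odot>\<^bsub>A\<^esub> L x)"
    and A: "star_algebra A" and s: "s \<in> multilinear_rels A J"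
  shows "F s \<in> multilinear_rels A J"
proof -
  interpret star_algebra A by (rule A)
  have diff: "F (p - q) = F p - F q" for p q
    using add[of "p - q" q] by simp
  have carrier: "a \<in> carrier A" if "u @ (j, a) # v \<in> alt_words A J" for u j a v
    using that by (auto simp: alt_words_def)
  from s consider
    (add) u v j a b where "u @ (j, a) # v \<in> alt_words A J" "b \<in> carrier A"
      "s = Poly_Mapping.single (u @ (j, a \<oplus>\<^bsub>A\<^esub> b) # v) 1
         - Poly_Mapping.single (u @ (j, a) # v) 1 - Poly_Mapping.single (u @ (j, b) # v) 1"
  | (scale) u v j a c where "u @ (j, a) # v \<in> alt_words A J"
      "s = Poly_Mapping.single (u @ (j, c \<odot>\<^bsub>A\<^esub> a) # v) 1 - Poly_Mapping.single (u @ (j, a) # v) c"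
    unfolding multilinear_rels_def by blast
  then show ?thesis
  proof cases
    case add
    obtain u' v' L where L: "\<And>x. x \<in> carrier A \<Longrightarrow> \<phi> (u @ (j, x) # v) = u' @ (j, L x) # v'"
      "\<And>x. x \<in> carrier A \<Longrightarrow> u' @ (j, L x) # v' \<in> alt_words A J"
      "\<And>x y. \<lbrakk>x \<in> carrier A; y \<in> carrier A\<rbrakk> \<Longrightarrow> L (x \<oplus>\<^bsub>A\<^esub> y) = L x \<oplus>\<^bsub>A\<^esub> L y"
      using letter[OF add(1)] by blast
    have a: "a \<in> carrier A" by (rule carrier[OF add(1)])
    have "F s = Poly_Mapping.single (u' @ (j, L a \<oplus>\<^bsub>A\<^esub> L b) # v') 1
        - Poly_Mapping.single (u' @ (j, L a) # v') 1 - Poly_Mapping.single (u' @ (j, L b) # v') 1"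
      by (simp add: add(2,3) diff single one L(1,3) a add_closed)
    then show ?thesis
      unfolding multilinear_rels_def using L(2)[OF a] carrier[OF L(2)[OF add(2)]] by blast
  next
    case scale
    obtain u' v' L where L: "\<And>x. x \<in> carrier A \<Longrightarrow> \<phi> (u @ (j, x) # v) = u' @ (j, L x) # v'"
      "\<And>x. x \<in> carrier A \<Longrightarrow> u' @ (j, L x) # v' \<in> alt_words A J"
      "\<And>x. x \<in> carrier A \<Longrightarrow> L (c \<odot>\<^bsub>A\<^esub> x) = \<kappa> c \<odot>\<^bsub>A\<^esub> L x"
      using letter[OF scale(1)] by blast
    have a: "a \<in> carrier A" by (rule carrier[OF scale(1)])
    have "F s = Poly_Mapping.single (u' @ (j, \<kappa> c \<odot>\<^bsub>A\<^esub> L a) # v') 1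
        - Poly_Mapping.single (u' @ (j, L a) # v') (\<kappa> c)"
      by (simp add: scale(2) diff single one L(1,3) a scale_closed)
    then show ?thesis unfolding multilinear_rels_def using L(2)[OF a] by blast
  qed
qed

context star_algebra
begin

lemma replace_letter:
  "\<lbrakk>u @ (j, a) # v \<in> alt_words A J; x \<in> carrier A\<rbrakk> \<Longrightarrow> u @ (j, x) # v \<in> alt_words A J"
  by (auto simp: alt_words_def)

lemma word_mult_marked_letter_left:
  assumes w: "w \<in> insert [] (alt_words A J)"
  obtains u' L where "\<forall>x. word_mult A w (u @ (j, x) # v) = u' @ (j, L x) # v"
    and "L = (\<lambda>x. x) \<or> (\<exists>c\<in>carrier A. L = (\<lambda>x. c \<otimes> x))"
proof (cases "u = []")
  case False
  then show ?thesis
    by (intro that[of "word_mult A w u" "\<lambda>x. x"]) (simp_all add: word_mult_append_right)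
next
  case True
  show ?thesis
  proof (cases w rule: rev_cases)
    case Nil
    then show ?thesis by (intro that[of u "\<lambda>x. x"]) simp_all
  next
    case (snoc p y)
    obtain i c where y: "y = (i, c)" by (cases y)
    have "c \<in> carrier A" using w unfolding unital_words_iff snoc y by simp
    then show ?thesis
      using that[of p "\<lambda>x. c \<otimes> x"] that[of "p @ [y]" "\<lambda>x. x"]
      by (cases "i = j") (auto simp: True snoc y word_mult_snoc_Cons)
  qed
qed

lemma word_mult_marked_letter_right:
  assumes w: "w \<in> insert [] (alt_words A J)"
  obtains v' L where "\<forall>x. word_mult A (u @ (j, x) # v) w = u @ (j, L x) # v'"
    and "L = (\<lambda>x. x) \<or> (\<exists>c\<in>carrier A. L = (\<lambda>x. x \<otimes> c))"
proof (cases "v = []")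
  case False
  then show ?thesis
    using word_mult_append_left[of v A "u @ [(j, _)]" w]
    by (intro that[of "\<lambda>x. x" "word_mult A v w"]) simp_all
next
  case True
  show ?thesis
  proof (cases w)
    case Nil
    then show ?thesis by (intro that[of "\<lambda>x. x" v]) simp_all
  next
    case (Cons y q)
    obtain i c where y: "y = (i, c)" by (cases y)
    have "c \<in> carrier A" using w unfolding unital_words_iff Cons y by simp
    then show ?thesis
      using that[of "\<lambda>x. x \<otimes> c" q] that[of "\<lambda>x. x" "y # q"]
      by (cases "i = j") (auto simp: True Cons y word_mult_snoc_Cons)
  qed
qed

lemma word_mult_nonempty_closed:
  "\<lbrakk>u \<in> insert [] (alt_words A J); v \<in> insert [] (alt_words A J); u \<noteq> [] \<or> v \<noteq> []\<rbrakk>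
    \<Longrightarrow> word_mult A u v \<in> alt_words A J"
  using word_mult_closed[of u J v] by auto

lemma multilinear_rels_left:
  assumes w: "w \<in> insert [] (alt_words A J)" and s: "s \<in> multilinear_rels A J"
  shows "word_prod A (Poly_Mapping.single w 1) s \<in> multilinear_rels A J"
proof (rule multilinear_rels_image[where \<phi> = "word_mult A w" and \<kappa> = "\<lambda>c. c", OF _ _ _ _ star_algebra_axioms s])
  fix u j a v assume u: "u @ (j, a) # v \<in> alt_words A J"
  obtain u' L where eq: "\<forall>x. word_mult A w (u @ (j, x) # v) = u' @ (j, L x) # v"
    and L: "L = (\<lambda>x. x) \<or> (\<exists>c\<in>carrier A. L = (\<lambda>x. c \<otimes> x))"
    by (rule word_mult_marked_letter_left[OF w])
  have "word_mult A w (u @ (j, x) # v) \<in> alt_words A J" if "x \<in> carrier A" for x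
    using w replace_letter[OF u that] by (intro word_mult_nonempty_closed) auto
  then show "\<exists>u' v' L. \<forall>x\<in>carrier A. word_mult A w (u @ (j, x) # v) = u' @ (j, L x) # v' \<and>
      u' @ (j, L x) # v' \<in> alt_words A J \<and> (\<forall>y\<in>carrier A. L (x \<oplus> y) = L x \<oplus> L y) \<and>
      (\<forall>c. L (c \<odot> x) = c \<odot> L x)"
    using L by (intro exI[of _ u'] exI[of _ v] exI[of _ L]) (auto simp: eq mult_add_right scale_mult_right)
qed (simp_all add: word_prod_add_right)

lemma multilinear_rels_right:
  assumes w: "w \<in> insert [] (alt_words A J)" and s: "s \<in> multilinear_rels A J"
  shows "word_prod A s (Poly_Mapping.single w 1) \<in> multilinear_rels A J"
proof (rule multilinear_rels_image[where \<phi> = "\<lambda>u. word_mult A u w" and \<kappa> = "\<lambda>c. c", OF _ _ _ _ star_algebra_axioms s])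
  fix u j a v assume u: "u @ (j, a) # v \<in> alt_words A J"
  obtain v' L where eq: "\<forall>x. word_mult A (u @ (j, x) # v) w = u @ (j, L x) # v'"
    and L: "L = (\<lambda>x. x) \<or> (\<exists>c\<in>carrier A. L = (\<lambda>x. x \<otimes> c))"
    by (rule word_mult_marked_letter_right[OF w])
  have "word_mult A (u @ (j, x) # v) w \<in> alt_words A J" if "x \<in> carrier A" for x
    using w replace_letter[OF u that] by (intro word_mult_nonempty_closed) auto
  then show "\<exists>u' v' L. \<forall>x\<in>carrier A. word_mult A (u @ (j, x) # v) w = u' @ (j, L x) # v' \<and>
      u' @ (j, L x) # v' \<in> alt_words A J \<and> (\<forall>y\<in>carrier A. L (x \<oplus> y) = L x \<oplus> L y) \<and>
      (\<forall>c. L (c \<odot> x) = c \<odot> L x)"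
    using L by (intro exI[of _ u] exI[of _ v'] exI[of _ L]) (auto simp: eq mult_add_left scale_mult_left)
qed (simp_all add: word_prod_add_left)

lemma multilinear_rels_star:
  assumes s: "s \<in> multilinear_rels A J"
  shows "word_star A s \<in> multilinear_rels A J"
proof (rule multilinear_rels_image[where \<phi> = "word_adj A" and \<kappa> = cnj, OF _ _ _ _ star_algebra_axioms s])
  fix u j a v assume u: "u @ (j, a) # v \<in> alt_words A J"
  have eq: "word_adj A (u @ (j, x) # v) = word_adj A v @ (j, x\<^sup>\<star>) # word_adj A u" for x
    by (simp add: word_adj_append word_adj_Cons)
  have "word_adj A (u @ (j, x) # v) \<in> alt_words A J" if "x \<in> carrier A" for x
    using word_adj_closed[of "u @ (j, x) # v" J] replace_letter[OF u that] by (auto simp: eq)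
  then show "\<exists>u' v' L. \<forall>x\<in>carrier A. word_adj A (u @ (j, x) # v) = u' @ (j, L x) # v' \<and>
      u' @ (j, L x) # v' \<in> alt_words A J \<and> (\<forall>y\<in>carrier A. L (x \<oplus> y) = L x \<oplus> L y) \<and>
      (\<forall>c. L (c \<odot> x) = cnj c \<odot> L x)"
    by (intro exI[of _ "word_adj A v"] exI[of _ "word_adj A u"] exI[of _ "\<lambda>x. x\<^sup>\<star>"])
      (auto simp: eq adj_add adj_scale)
qed (simp_all add: word_star_add)

lemma star_congruence_free_rel: "star_congruence (word_alg A (alt_words A J)) (free_rel A J)"
proof -
  interpret word_star_algebra A J "alt_words A J" by unfold_locales simp
  interpret module fscale by (rule module_fscale)
  show ?thesis
    unfolding free_rel_def
    by (rule star_congruence_span_rel)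
      (auto intro!: span_base multilinear_rels_left multilinear_rels_right multilinear_rels_star)
qed

lemma is_unit_unit_of:
  assumes "unital A"
  shows "is_unit A (unit_of A)"
proof -
  obtain e where e: "is_unit A e" using assms by (auto simp: unital_def)
  moreover have "d = e" if "is_unit A d" for d
    using e that by (metis is_unit_def)
  ultimately show ?thesis unfolding unit_of_def by (metis theI)
qed

lemma adj_unit:
  assumes "is_unit A e"
  shows "e\<^sup>\<star> = e"
proof -
  have e: "e \<in> carrier A" "e\<^sup>\<star> \<otimes> e = e\<^sup>\<star>"
    using assms by (auto simp: is_unit_def adj_closed)
  have "e\<^sup>\<star> = e\<^sup>\<star> \<otimes> (e\<^sup>\<star>)\<^sup>\<star>" using e by (simp add: adj_adj)
  also have "\<dots> = (e\<^sup>\<star> \<otimes> e)\<^sup>\<star>" using e(1) by (simp add: adj_mult adj_closed adj_adj)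
  also have "\<dots> = e" using e by (simp add: adj_adj)
  finally show ?thesis .
qed

lemma star_congruence_unital_free_rel:
  assumes "unital A"
  shows "star_congruence (word_alg A (insert [] (alt_words A J))) (unital_free_rel A J)"
proof -
  let ?W = "insert [] (alt_words A J)" and ?e = "unit_of A"
  interpret word_star_algebra A J ?W by unfold_locales simp
  interpret module fscale by (rule module_fscale)
  note unit = is_unit_unit_of[OF assms]
  have diff_left: "word_prod A (p - p') q = word_prod A p q - word_prod A p' q" for p p' q
    using word_prod_add_left[of A "p - p'" p' q] by simp
  have diff_right: "word_prod A p (q - q') = word_prod A p q - word_prod A p q'" for p q q'
    using word_prod_add_right[of A p "q - q'" q'] by simp
  have diff_star: "word_star A (p - q) = word_star A p - word_star A q" for p q
    using word_star_add[of A "p - q" q] by simp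
  have e: "[(j, ?e)] \<in> ?W" if "j \<in> J" for j
    using that unit by (auto simp: letter_alt_words is_unit_def)
  have rel: "Poly_Mapping.single (word_mult A (word_mult A u [(j, ?e)]) v) 1
      - Poly_Mapping.single (word_mult A u v) 1 \<in> unit_rels A J"
    if "u \<in> ?W" "v \<in> ?W" "j \<in> J" for u v j
    using that unfolding unit_rels_def by blast
  have unit_rel: "word_prod A (Poly_Mapping.single w 1) s \<in> unit_rels A J \<and>
      word_prod A s (Poly_Mapping.single w 1) \<in> unit_rels A J \<and> word_star A s \<in> unit_rels A J"
    if s: "s \<in> unit_rels A J" and w: "w \<in> ?W" for s w
  proof -
    obtain u v j where uvj: "u \<in> ?W" "v \<in> ?W" "j \<in> J"
      and s: "s = Poly_Mapping.single (word_mult A (word_mult A u [(j, ?e)]) v) 1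
        - Poly_Mapping.single (word_mult A u v) 1"
      using s unfolding unit_rels_def by blast
    note cl = uvj w e[OF uvj(3)] word_mult_closed word_adj_closed
    have "word_mult A w (word_mult A (word_mult A u [(j, ?e)]) v)
        = word_mult A (word_mult A (word_mult A w u) [(j, ?e)]) v"
      "word_mult A w (word_mult A u v) = word_mult A (word_mult A w u) v"
      by (simp_all only: word_mult_assoc_words[where J = J] cl)
    moreover have "word_mult A (word_mult A (word_mult A u [(j, ?e)]) v) w
        = word_mult A (word_mult A u [(j, ?e)]) (word_mult A v w)"
      "word_mult A (word_mult A u v) w = word_mult A u (word_mult A v w)"
      by (simp_all only: word_mult_assoc_words[where J = J] cl)
    moreover have "word_adj A (word_mult A (word_mult A u [(j, ?e)]) v)
        = word_mult A (word_mult A (word_adj A v) [(j, ?e)]) (word_adj A u)"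
    proof -
      have "word_adj A [(j, ?e)] = [(j, ?e)]" by (simp add: word_adj_def adj_unit[OF unit])
      then show ?thesis
        by (simp only: word_adj_mult[where J = J] word_mult_assoc_words[where J = J] cl)
    qed
    moreover have "word_adj A (word_mult A u v) = word_mult A (word_adj A v) (word_adj A u)"
      by (simp only: word_adj_mult[where J = J] cl)
    ultimately show ?thesis
      using rel[of "word_mult A w u" v j] rel[of u "word_mult A v w" j]
        rel[of "word_adj A v" "word_adj A u" j]
      by (simp only: s diff_left diff_right diff_star word_prod_single word_star_single mult_1 complex_cnj_one cl)
  qed
  show ?thesis
    unfolding unital_free_rel_def
    by (rule star_congruence_span_rel)
      (use unit_rel in \<open>auto intro!: span_base multilinear_rels_left multilinear_rels_right multilinear_rels_star\<close>)
qed

end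


section \<open>The algebraic actions and the projection\<close>

lemma relabel_zero [simp]: "relabel g 0 = 0"
  by (simp add: relabel_def)

lemma relabel_comp: "relabel (\<lambda>j. g (h j)) p = relabel g (relabel h p)"
proof -
  have "Poly_Mapping.keys p \<subseteq> UNIV" by simp
  then show ?thesis
    by (induction rule: keys_induct)
      (simp_all add: relabel_add map_prod_def case_prod_beta' comp_def)
qed

lemma relabel_id: "relabel id p = p"
proof -
  have "Poly_Mapping.keys p \<subseteq> UNIV" by simp
  then show ?thesis
    by (induction rule: keys_induct) (simp_all add: relabel_add map_prod_def id_def case_prod_beta')
qed

context word_star_algebra
begin

lemma relabel_W: "\<lbrakk>g permutes J; w \<in> W\<rbrakk> \<Longrightarrow> map (map_prod g id) w \<in> W"
  using words relabel_alt_words[of g J w A] by auto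

lemma keys_relabel:
  assumes "g permutes J" "Poly_Mapping.keys p \<subseteq> W"
  shows "Poly_Mapping.keys (relabel g p) \<subseteq> W"
  using assms(2)
  by (induction rule: keys_induct) (simp_all add: relabel_add keys_add_subset relabel_W[OF assms(1)])

lemma relabel_hom:
  assumes g: "g permutes J"
  shows "relabel g \<in> star_hom (word_alg A W) (word_alg A W)"
proof (rule star_homI, unfold word_alg_simps)
  fix p q :: "('j, 'a) word \<Rightarrow>\<^sub>0 complex" and c assume p: "p \<in> {p. Poly_Mapping.keys p \<subseteq> W}"
  show "relabel g p \<in> {p. Poly_Mapping.keys p \<subseteq> W}" using p keys_relabel[OF g] by simp
  show "relabel g (fscale c p) = fscale c (relabel g p)" by (rule relabel_fscale)
  have adj: "map (map_prod g id) (word_adj A w) = word_adj A (map (map_prod g id) w)" for w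
    by (simp add: word_adj_def rev_map map_prod.comp)
  show "relabel g (word_star A p) = word_star A (relabel g p)"
    using p unfolding mem_Collect_eq
    by (induction rule: keys_induct) (simp_all add: word_star_add relabel_add adj)
  assume q: "q \<in> {p. Poly_Mapping.keys p \<subseteq> W}"
  show "relabel g (p + q) = relabel g p + relabel g q" by (rule relabel_add)
  show "relabel g (word_prod A p q) = word_prod A (relabel g p) (relabel g q)"
    using p unfolding mem_Collect_eq
  proof (induction rule: keys_induct)
    case (single u a)
    show ?case
      using q unfolding mem_Collect_eq
      by (induction rule: keys_induct)
        (simp_all add: word_prod_add_right relabel_add relabel_word_mult[OF permutes_inj[OF g]])
  qed (simp_all add: word_prod_add_left relabel_add)
qed

lemma relabel_quotient_hom:
  assumes g: "g permutes J" and S: "relabel g ` S \<subseteq> S"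
    and R: "star_congruence (word_alg A W) (span_rel W S)"
  shows "(\<lambda>X. \<Union>p\<in>X. span_rel W S `` {relabel g p})
    \<in> star_hom (quotient_alg (word_alg A W) (span_rel W S)) (quotient_alg (word_alg A W) (span_rel W S))"
  using relabel_W[OF g] by (intro quotient_hom[OF R R relabel_hom[OF g]] relabel_span_rel S) auto

end

context star_algebra
begin

lemma free_word_algebra: "word_star_algebra A J (alt_words A J)"
  by unfold_locales simp

lemma unital_word_algebra: "word_star_algebra A J (insert [] (alt_words A J))"
  by unfold_locales simp

lemma carrier_free_prod:
  "carrier (free_prod A J) = (\<lambda>p. free_rel A J `` {p}) ` {p. Poly_Mapping.keys p \<subseteq> alt_words A J}"
  unfolding free_prod_def
  by (simp add: star_congruence.quotient_carrier[OF star_congruence_free_rel] word_alg_simps)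

lemma carrier_unital_free_prod:
  "carrier (unital_free_prod A J)
    = (\<lambda>p. unital_free_rel A J `` {p}) ` {p. Poly_Mapping.keys p \<subseteq> insert [] (alt_words A J)}"
  unfolding unital_free_prod_def by (auto simp: quotient_alg_def quotient_def word_alg_simps)

lemma unital_rels_relabel:
  "g permutes J \<Longrightarrow>
    relabel g ` (multilinear_rels A J \<union> unit_rels A J) \<subseteq> multilinear_rels A J \<union> unit_rels A J"
  using relabel_multilinear_rels[of g J A] relabel_unit_rels[of g J A] by blast

lemma free_perm_class:
  assumes g: "g permutes J" and p: "Poly_Mapping.keys p \<subseteq> alt_words A J"
  shows "free_perm A J g (free_rel A J `` {p}) = free_rel A J `` {relabel g p}"
  unfolding free_perm_def free_rel_def
  using relabel_alt_words[OF g, of _ A] by (intro relabel_class relabel_multilinear_rels g p) auto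

lemma unital_free_perm_class:
  assumes g: "g permutes J" and p: "Poly_Mapping.keys p \<subseteq> insert [] (alt_words A J)"
  shows "unital_free_perm A J g (unital_free_rel A J `` {p}) = unital_free_rel A J `` {relabel g p}"
  unfolding unital_free_perm_def unital_free_rel_def
  using relabel_alt_words[OF g, of _ A] by (intro relabel_class unital_rels_relabel g p) auto

lemma free_perm_hom: "g permutes J \<Longrightarrow> free_perm A J g \<in> star_hom (free_prod A J) (free_prod A J)"
  using word_star_algebra.relabel_quotient_hom[OF free_word_algebra _ relabel_multilinear_rels
      star_congruence_free_rel[unfolded free_rel_def], of g]
  unfolding free_perm_def[abs_def] free_prod_def free_rel_def by blast

lemma unital_free_perm_hom:
  "\<lbrakk>unital A; g permutes J\<rbrakk> \<Longrightarrow> unital_free_perm A J g \<in> star_hom (unital_free_prod A J) (unital_free_prod A J)"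
  using word_star_algebra.relabel_quotient_hom[OF unital_word_algebra _ unital_rels_relabel
      star_congruence_unital_free_rel[unfolded unital_free_rel_def], of g]
  unfolding unital_free_perm_def[abs_def] unital_free_prod_def unital_free_rel_def by blast

lemma free_rel_subset: "free_rel A J \<subseteq> unital_free_rel A J"
  using module.span_mono[OF module_fscale, of "multilinear_rels A J" "multilinear_rels A J \<union> unit_rels A J"]
  by (auto simp: free_rel_def unital_free_rel_def span_rel_def)

lemma free_proj_class:
  assumes "unital A" "Poly_Mapping.keys p \<subseteq> alt_words A J"
  shows "free_proj A J (free_rel A J `` {p}) = unital_free_rel A J `` {p}"
  unfolding free_proj_def
  using free_rel_subset assms(2)
  by (intro quotient_hom_class[OF star_congruence_free_rel star_congruence_unital_free_rel[OF assms(1)]])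
    (auto simp: word_alg_simps)

lemma free_proj_hom:
  assumes "unital A"
  shows "free_proj A J \<in> star_hom (free_prod A J) (unital_free_prod A J)"
proof -
  have "(\<lambda>p. p) \<in> star_hom (word_alg A (alt_words A J)) (word_alg A (insert [] (alt_words A J)))"
    by (rule star_homI) (auto simp: word_alg_simps)
  from quotient_hom[OF star_congruence_free_rel star_congruence_unital_free_rel[OF assms] this]
  show ?thesis
    unfolding free_proj_def[abs_def] free_prod_def unital_free_prod_def using free_rel_subset by blast
qed

text \<open>With at least one index \<open>j\<close>, the empty word is equivalent to the letter \<open>i\<^sub>j(1)\<close>.\<close>

lemma free_proj_surj:
  assumes "unital A" "J \<noteq> {}"
  shows "free_proj A J ` carrier (free_prod A J) = carrier (unital_free_prod A J)"
proof
  show "free_proj A J ` carrier (free_prod A J) \<subseteq> carrier (unital_free_prod A J)"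
    using star_homD(1)[OF free_proj_hom[OF assms(1)]] by blast
  interpret module fscale by (rule module_fscale)
  obtain j where j: "j \<in> J" using assms(2) by blast
  let ?e = "[(j, unit_of A)]" and ?W = "insert [] (alt_words A J)"
  have e: "?e \<in> alt_words A J"
    using is_unit_unit_of[OF assms(1)] j by (simp add: letter_alt_words is_unit_def)
  have "\<exists>q. Poly_Mapping.keys q \<subseteq> alt_words A J \<and> (p, q) \<in> unital_free_rel A J"
    if "Poly_Mapping.keys p \<subseteq> ?W" for p
    using that
  proof (induction rule: keys_induct)
    case zero
    then show ?case by (intro exI[of _ 0]) (simp add: unital_free_rel_def span_rel_def span_zero)
  next
    case (add p q)
    then obtain p' q' where *: "Poly_Mapping.keys p' \<subseteq> alt_words A J" "(p, p') \<in> unital_free_rel A J"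
      "Poly_Mapping.keys q' \<subseteq> alt_words A J" "(q, q') \<in> unital_free_rel A J" by blast
    then have "(p + q, p' + q') \<in> unital_free_rel A J"
      using star_congruence.add_cong[OF star_congruence_unital_free_rel[OF assms(1)]]
      by (simp add: word_alg_simps)
    moreover have "Poly_Mapping.keys (p' + q') \<subseteq> alt_words A J"
      using * Poly_Mapping.keys_add[of p' q'] by blast
    ultimately show ?case by blast
  next
    case (single w c)
    show ?case
    proof (cases "w = []")
      case True
      have "Poly_Mapping.single ?e 1 - Poly_Mapping.single [] 1 \<in> unit_rels A J"
        unfolding unit_rels_def using j by (auto intro!: exI[of _ "[]"] exI[of _ j])
      then have "fscale (- c) (Poly_Mapping.single ?e 1 - Poly_Mapping.single [] 1)
          \<in> span (multilinear_rels A J \<union> unit_rels A J)"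
        by (intro span_scale span_base) simp
      then have "(Poly_Mapping.single w c, Poly_Mapping.single ?e c) \<in> unital_free_rel A J"
        using e by (simp add: True unital_free_rel_def span_rel_def scale_right_diff_distrib fscale_single
            single_uminus algebra_simps)
      then show ?thesis using e by (intro exI[of _ "Poly_Mapping.single ?e c"]) simp
    next
      case False
      then show ?thesis
        using single by (intro exI[of _ "Poly_Mapping.single w c"])
          (auto simp: unital_free_rel_def span_rel_def span_zero)
    qed
  qed
  then show "carrier (unital_free_prod A J) \<subseteq> free_proj A J ` carrier (free_prod A J)"
    unfolding carrier_unital_free_prod carrier_free_prod
    using free_proj_class[OF assms(1)]
      star_congruence.class_eqI[OF star_congruence_unital_free_rel[OF assms(1), of J]]
    by (fastforce simp: image_iff)
qed

end

section \<open>Uniform boundedness of the free products\<close>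

lemma uniformly_boundedI:
  assumes "\<And>(H :: (nat \<Rightarrow> complex \<times> 'b) hilb) \<pi> \<xi>. \<lbrakk>star_rep B H \<pi>; \<xi> \<in> carrier H\<rbrakk> \<Longrightarrow>
    hnorm H (\<pi> (X :: 'b) \<xi>) \<le> M * hnorm H \<xi>"
  shows "uniformly_bounded B X"
  using assms unfolding uniformly_bounded_def by blast

lemma uniformly_boundedE:
  assumes "uniformly_bounded B (X :: 'b)"
  obtains M where "0 \<le> M"
    and "\<forall>(H :: (nat \<Rightarrow> complex \<times> 'b) hilb) \<pi>. star_rep B H \<pi> \<longrightarrow>
      (\<forall>\<xi>\<in>carrier H. hnorm H (\<pi> X \<xi>) \<le> M * hnorm H \<xi>)"
proof -
  obtain M where M: "hnorm H (\<pi> X \<xi>) \<le> M * hnorm H \<xi>"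
    if "star_rep B H \<pi>" "\<xi> \<in> carrier H" for H :: "(nat \<Rightarrow> complex \<times> 'b) hilb" and \<pi> \<xi>
    using assms unfolding uniformly_bounded_def by blast
  have "hnorm H (\<pi> X \<xi>) \<le> \<bar>M\<bar> * hnorm H \<xi>"
    if rep: "star_rep B H \<pi>" and \<xi>: "\<xi> \<in> carrier H"
    for H :: "(nat \<Rightarrow> complex \<times> 'b) hilb" and \<pi> \<xi>
  proof -
    interpret hilbert_space H using rep by (simp add: star_rep_def)
    show ?thesis
      using M[OF rep \<xi>] mult_right_mono[OF abs_ge_self hnorm_nonneg[OF \<xi>], of M] by linarith
  qed
  then show ?thesis by (intro that[of "\<bar>M\<bar>"]) simp_all
qed

context star_algebra
begin

lemma uniformly_bounded_zero: "uniformly_bounded A \<zero>"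
proof (rule uniformly_boundedI)
  fix H :: "(nat \<Rightarrow> complex \<times> 'a) hilb" and \<pi> \<xi>
  assume rep: "star_rep A H \<pi>" and \<xi>: "\<xi> \<in> carrier H"
  interpret star_representation A H \<pi> by (rule star_representationI[OF star_algebra_axioms rep])
  show "hnorm H (\<pi> \<zero> \<xi>) \<le> 0 * hnorm H \<xi>" by (simp add: rep_zero \<xi> H.hnorm_zero)
qed

lemma uniformly_bounded_add:
  assumes X: "X \<in> carrier A" "uniformly_bounded A X" and Y: "Y \<in> carrier A" "uniformly_bounded A Y"
  shows "uniformly_bounded A (X \<oplus> Y)"
proof -
  obtain M where M: "0 \<le> M" "\<forall>(H :: (nat \<Rightarrow> complex \<times> 'a) hilb) \<pi>. star_rep A H \<pi> \<longrightarrow>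
      (\<forall>\<xi>\<in>carrier H. hnorm H (\<pi> X \<xi>) \<le> M * hnorm H \<xi>)"
    by (rule uniformly_boundedE[OF X(2)])
  obtain N where N: "0 \<le> N" "\<forall>(H :: (nat \<Rightarrow> complex \<times> 'a) hilb) \<pi>. star_rep A H \<pi> \<longrightarrow>
      (\<forall>\<xi>\<in>carrier H. hnorm H (\<pi> Y \<xi>) \<le> N * hnorm H \<xi>)"
    by (rule uniformly_boundedE[OF Y(2)])
  show ?thesis
  proof (rule uniformly_boundedI)
    fix H :: "(nat \<Rightarrow> complex \<times> 'a) hilb" and \<pi> \<xi>
    assume rep: "star_rep A H \<pi>" and \<xi>: "\<xi> \<in> carrier H"
    interpret star_representation A H \<pi> by (rule star_representationI[OF star_algebra_axioms rep])
    show "hnorm H (\<pi> (X \<oplus> Y) \<xi>) \<le> (M + N) * hnorm H \<xi>"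
      using H.hnorm_triangle[OF rep_closed[OF X(1) \<xi>] rep_closed[OF Y(1) \<xi>]] M(2)[rule_format, OF rep \<xi>] N(2)[rule_format, OF rep \<xi>]
      by (simp add: rep_add X Y \<xi> distrib_right)
  qed
qed

lemma uniformly_bounded_mult:
  assumes X: "X \<in> carrier A" "uniformly_bounded A X" and Y: "Y \<in> carrier A" "uniformly_bounded A Y"
  shows "uniformly_bounded A (X \<otimes> Y)"
proof -
  obtain M where M: "0 \<le> M" "\<forall>(H :: (nat \<Rightarrow> complex \<times> 'a) hilb) \<pi>. star_rep A H \<pi> \<longrightarrow>
      (\<forall>\<xi>\<in>carrier H. hnorm H (\<pi> X \<xi>) \<le> M * hnorm H \<xi>)"
    by (rule uniformly_boundedE[OF X(2)])
  obtain N where N: "0 \<le> N" "\<forall>(H :: (nat \<Rightarrow> complex \<times> 'a) hilb) \<pi>. star_rep A H \<pi> \<longrightarrow>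
      (\<forall>\<xi>\<in>carrier H. hnorm H (\<pi> Y \<xi>) \<le> N * hnorm H \<xi>)"
    by (rule uniformly_boundedE[OF Y(2)])
  show ?thesis
  proof (rule uniformly_boundedI)
    fix H :: "(nat \<Rightarrow> complex \<times> 'a) hilb" and \<pi> \<xi>
    assume rep: "star_rep A H \<pi>" and \<xi>: "\<xi> \<in> carrier H"
    interpret star_representation A H \<pi> by (rule star_representationI[OF star_algebra_axioms rep])
    show "hnorm H (\<pi> (X \<otimes> Y) \<xi>) \<le> (M * N) * hnorm H \<xi>"
      using M(2)[rule_format, OF rep rep_closed[OF Y(1) \<xi>]] mult_left_mono[OF N(2)[rule_format, OF rep \<xi>] M(1)]
      by (simp add: rep_mult X Y \<xi> mult.assoc)
  qed
qed

lemma uniformly_bounded_scale: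
  assumes X: "X \<in> carrier A" "uniformly_bounded A X"
  shows "uniformly_bounded A (c \<odot> X)"
proof -
  obtain M where M: "0 \<le> M" "\<forall>(H :: (nat \<Rightarrow> complex \<times> 'a) hilb) \<pi>. star_rep A H \<pi> \<longrightarrow>
      (\<forall>\<xi>\<in>carrier H. hnorm H (\<pi> X \<xi>) \<le> M * hnorm H \<xi>)"
    by (rule uniformly_boundedE[OF X(2)])
  show ?thesis
  proof (rule uniformly_boundedI)
    fix H :: "(nat \<Rightarrow> complex \<times> 'a) hilb" and \<pi> \<xi>
    assume rep: "star_rep A H \<pi>" and \<xi>: "\<xi> \<in> carrier H"
    interpret star_representation A H \<pi> by (rule star_representationI[OF star_algebra_axioms rep])
    show "hnorm H (\<pi> (c \<odot> X) \<xi>) \<le> (cmod c * M) * hnorm H \<xi>"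
      using mult_left_mono[OF M(2)[rule_format, OF rep \<xi>], of "cmod c"]
      by (simp add: rep_scale X \<xi> H.hnorm_scale rep_closed mult.assoc)
  qed
qed

lemma uniformly_bounded_projection:
  assumes X: "X \<in> carrier A" "X\<^sup>\<star> \<otimes> X = X"
  shows "uniformly_bounded A X"
proof (rule uniformly_boundedI)
  fix H :: "(nat \<Rightarrow> complex \<times> 'a) hilb" and \<pi> \<xi>
  assume rep: "star_rep A H \<pi>" and \<xi>: "\<xi> \<in> carrier H"
  interpret star_representation A H \<pi> by (rule star_representationI[OF star_algebra_axioms rep])
  have "(hnorm H (\<pi> X \<xi>))\<^sup>2 = cmod (hinner H (\<pi> X \<xi>) \<xi>)"
    using rep_inner_square[OF X(1) \<xi>] X by (simp del: of_real_power)
  also have "\<dots> \<le> hnorm H (\<pi> X \<xi>) * hnorm H \<xi>"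
    by (intro H.cauchy_schwarz rep_closed X \<xi>)
  finally show "hnorm H (\<pi> X \<xi>) \<le> 1 * hnorm H \<xi>"
    using H.hnorm_nonneg[OF rep_closed[OF X(1) \<xi>]] H.hnorm_nonneg[OF \<xi>]
    by (cases "hnorm H (\<pi> X \<xi>) = 0") (auto simp: power2_eq_square mult_le_cancel_left)
qed

end

lemma uniformly_bounded_hom_cstar:
  assumes A: "cstar_algebra A" and f: "f \<in> star_hom A B" and a: "a \<in> carrier A"
  shows "uniformly_bounded B (f a)"
proof -
  show ?thesis
    by (rule uniformly_boundedI)
      (rule star_rep_contractive[OF A star_rep_comp[OF f] a])
qed

text \<open>
  A word is a product of letters \<open>i\<^sub>j(a)\<close>, and each \<open>i\<^sub>j\<close> turns representations of the quotient into
  representations of the C*-algebra \<open>A\<close>, where they are contractive. The empty word is a projection.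
\<close>

lemma bounded_word_quotient:
  fixes A :: "'a normed_star_alg" and J :: "'j set"
  assumes A: "cstar_algebra A" and W: "word_star_algebra A J W"
    and R: "star_congruence (word_alg A W) (span_rel W S)" and S: "multilinear_rels A J \<subseteq> S"
  shows "bounded_star_algebra (quotient_alg (word_alg A W) (span_rel W S))"
proof -
  interpret A: cstar_algebra A by (rule A)
  interpret word_star_algebra A J W by (rule W)
  interpret R: star_congruence "word_alg A W" "span_rel W S" by (rule R)
  interpret module fscale by (rule module_fscale)
  let ?Q = "quotient_alg (word_alg A W) (span_rel W S)"
  interpret Q: star_algebra ?Q by (rule R.star_algebra_quotient)
  define cls where "cls p = span_rel W S `` {p}" for p
  define elem where "elem w = Poly_Mapping.single w (1 :: complex)" for w :: "('j, 'a) word"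
  have alt: "w \<in> W" if "w \<in> alt_words A J" for w using words that by auto
  have rel: "cls p = cls q" if "p - q \<in> S" "Poly_Mapping.keys p \<subseteq> W" "Poly_Mapping.keys q \<subseteq> W" for p q
    unfolding cls_def using that by (intro R.class_eqI) (simp add: span_rel_def span_base)
  have cls_closed: "cls p \<in> carrier ?Q" if "Poly_Mapping.keys p \<subseteq> W" for p
    using that unfolding cls_def by (intro R.class_closed) (simp add: word_alg_simps)
  have ops: "cls p \<oplus>\<^bsub>?Q\<^esub> cls q = cls (p + q)" "cls p \<otimes>\<^bsub>?Q\<^esub> cls q = cls (word_prod A p q)"
    "c \<odot>\<^bsub>?Q\<^esub> cls p = cls (fscale c p)" "(cls p)\<^sup>\<star>\<^bsub>?Q\<^esub> = cls (word_star A p)"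
    if "Poly_Mapping.keys p \<subseteq> W" "Poly_Mapping.keys q \<subseteq> W" for p q c
    using R.quotient_add[of p q] R.quotient_mult[of p q] R.quotient_scale[of p c] R.quotient_adj[of p] that
    by (simp_all add: cls_def word_alg_simps)
  have keys_elem: "Poly_Mapping.keys (elem w) \<subseteq> W" if "w \<in> W" for w using that by (simp add: elem_def)
  have letter_hom: "(\<lambda>a. cls (elem [(j, a)])) \<in> star_hom A ?Q" if j: "j \<in> J" for j
  proof (rule star_homI)
    fix x y c assume x: "x \<in> carrier A"
    have k: "Poly_Mapping.keys (elem [(j, a)]) \<subseteq> W" if "a \<in> carrier A" for a
      using that j by (intro keys_elem alt letter_alt_words)
    have w: "[] @ (j, x) # [] \<in> alt_words A J" using x j by (simp add: letter_alt_words)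
    show "cls (elem [(j, x)]) \<in> carrier ?Q" by (intro cls_closed k x)
    have "Poly_Mapping.single ([] @ (j, c \<odot>\<^bsub>A\<^esub> x) # []) 1 - Poly_Mapping.single ([] @ (j, x) # []) c
        \<in> multilinear_rels A J"
      unfolding multilinear_rels_def using w by blast
    then have "elem [(j, c \<odot>\<^bsub>A\<^esub> x)] - fscale c (elem [(j, x)]) \<in> multilinear_rels A J"
      by (simp add: elem_def fscale_single)
    then have "cls (elem [(j, c \<odot>\<^bsub>A\<^esub> x)]) = cls (fscale c (elem [(j, x)]))"
      using S x by (intro rel k A.scale_closed order_trans[OF keys_fscale k]) auto
    then show "cls (elem [(j, c \<odot>\<^bsub>A\<^esub> x)]) = c \<odot>\<^bsub>?Q\<^esub> cls (elem [(j, x)])"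
      by (simp add: ops(3)[OF k[OF x] k[OF x]])
    show "cls (elem [(j, x\<^sup>\<star>\<^bsub>A\<^esub>)]) = (cls (elem [(j, x)]))\<^sup>\<star>\<^bsub>?Q\<^esub>"
      by (simp add: ops(4)[OF k[OF x] k[OF x]]) (simp add: elem_def word_adj_def)
    assume y: "y \<in> carrier A"
    have "Poly_Mapping.single ([] @ (j, x \<oplus>\<^bsub>A\<^esub> y) # []) 1 - Poly_Mapping.single ([] @ (j, x) # []) 1
        - Poly_Mapping.single ([] @ (j, y) # []) 1 \<in> multilinear_rels A J"
      unfolding multilinear_rels_def using w y by blast
    then have "elem [(j, x \<oplus>\<^bsub>A\<^esub> y)] - elem [(j, x)] - elem [(j, y)] \<in> multilinear_rels A J"
      by (simp add: elem_def)
    then have "cls (elem [(j, x \<oplus>\<^bsub>A\<^esub> y)]) = cls (elem [(j, x)] + elem [(j, y)])"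
      using S x y by (intro rel k A.add_closed keys_add_subset) (auto simp: diff_diff_eq)
    then show "cls (elem [(j, x \<oplus>\<^bsub>A\<^esub> y)]) = cls (elem [(j, x)]) \<oplus>\<^bsub>?Q\<^esub> cls (elem [(j, y)])"
      by (simp add: ops(1)[OF k[OF x] k[OF y]])
    show "cls (elem [(j, x \<otimes>\<^bsub>A\<^esub> y)]) = cls (elem [(j, x)]) \<otimes>\<^bsub>?Q\<^esub> cls (elem [(j, y)])"
      by (simp add: ops(2)[OF k[OF x] k[OF y]]) (simp add: elem_def word_mult_def)
  qed
  have word: "uniformly_bounded ?Q (cls (elem w))" if "w \<in> W" for w
    using that
  proof (induction w)
    case Nil
    then show ?case
      using ops[OF keys_elem keys_elem, of "[]" "[]"]
      by (intro Q.uniformly_bounded_projection cls_closed keys_elem) (simp_all add: elem_def)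
  next
    case (Cons x w)
    obtain j a where x: "x = (j, a)" by (cases x)
    have ja: "j \<in> J" "a \<in> carrier A" using W_unital[OF Cons.prems] unfolding unital_words_iff x by simp_all
    have letter: "uniformly_bounded ?Q (cls (elem [x]))"
      using uniformly_bounded_hom_cstar[OF A letter_hom ja(2)] ja by (simp add: x)
    show ?case
    proof (cases "w = []")
      case False
      have w: "w \<in> W"
        using W_unital[OF Cons.prems] False by (intro alt) (auto simp: alt_words_def distinct_adj_Cons)
      have xW: "[x] \<in> W" using ja by (simp add: x alt letter_alt_words)
      have "fst x \<noteq> fst (hd w)"
        using W_unital[OF Cons.prems] False by (auto simp: alt_words_def distinct_adj_Cons hd_map)
      then have "word_mult A [x] w = x # w" by (simp add: word_mult_def)
      then have "cls (elem (x # w)) = cls (elem [x]) \<otimes>\<^bsub>?Q\<^esub> cls (elem w)"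
        by (simp add: ops(2)[OF keys_elem[OF xW] keys_elem[OF w]]) (simp add: elem_def)
      then show ?thesis
        using letter Cons.IH[OF w] xW w
        by (simp add: Q.uniformly_bounded_mult cls_closed keys_elem)
    qed (use letter in simp)
  qed
  have "uniformly_bounded ?Q (cls p)" if "Poly_Mapping.keys p \<subseteq> W" for p
    using that
  proof (induction rule: keys_induct)
    case zero
    then show ?case using Q.uniformly_bounded_zero by (simp add: R.quotient_zero cls_def word_alg_simps)
  next
    case (add p q)
    then show ?case
      using Q.uniformly_bounded_add[of "cls p" "cls q"] by (simp add: cls_closed ops(1))
  next
    case (single w c)
    then have "cls (Poly_Mapping.single w c) = c \<odot>\<^bsub>?Q\<^esub> cls (elem w)"
      using ops(3)[OF keys_elem keys_elem, of w w c] by (simp add: elem_def fscale_single)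
    then show ?case
      using single by (simp add: Q.uniformly_bounded_scale cls_closed keys_elem word)
  qed
  then show ?thesis
    by (intro bounded_star_algebra.intro Q.star_algebra_axioms bounded_star_algebra_axioms.intro)
      (auto simp: R.quotient_carrier word_alg_simps cls_def)
qed

lemma bounded_free_prod:
  fixes A :: "'a normed_star_alg"
  assumes "cstar_algebra A"
  shows "bounded_star_algebra (free_prod A J)"
proof -
  interpret cstar_algebra A by fact
  show ?thesis
    unfolding free_prod_def free_rel_def
    by (rule bounded_word_quotient[OF assms free_word_algebra star_congruence_free_rel[unfolded free_rel_def]]) simp
qed

lemma bounded_unital_free_prod:
  fixes A :: "'a normed_star_alg"
  assumes "cstar_algebra A" "unital A"
  shows "bounded_star_algebra (unital_free_prod A J)"
proof -
  interpret cstar_algebra A by fact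
  show ?thesis
    unfolding unital_free_prod_def unital_free_rel_def
    by (rule bounded_word_quotient[OF assms(1) unital_word_algebra
          star_congruence_unital_free_rel[OF assms(2), unfolded unital_free_rel_def]]) simp
qed


section \<open>Extension to the free product C*-algebras\<close>

lemma group_finitary_perms: "group (finitary_perms J)"
proof (rule groupI)
  fix g h assume gh: "g \<in> carrier (finitary_perms J)" "h \<in> carrier (finitary_perms J)"
  have "{j. g (h j) \<noteq> j} \<subseteq> {j. g j \<noteq> j} \<union> {j. h j \<noteq> j}" by auto
  then show "mult (finitary_perms J) g h \<in> carrier (finitary_perms J)"
    using gh by (auto simp: finitary_perms_def permutes_compose intro: finite_subset)
next
  fix g assume g: "g \<in> carrier (finitary_perms J)"
  then have p: "g permutes J" by (simp add: finitary_perms_def)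
  have "{j. inv_into UNIV g j \<noteq> j} = {j. g j \<noteq> j}" using permutes_inv_eq[OF p] by metis
  then have "inv_into UNIV g \<in> carrier (finitary_perms J)"
    using g by (simp add: finitary_perms_def permutes_inv)
  moreover have "inv_into UNIV g \<circ> g = id" using permutes_inv_o[OF p] by simp
  ultimately show "\<exists>h\<in>carrier (finitary_perms J). mult (finitary_perms J) h g = one (finitary_perms J)"
    by (intro bexI[of _ "inv_into UNIV g"]) (simp_all add: finitary_perms_def)
qed (auto simp: finitary_perms_def permutes_id comp_assoc)

lemma finitary_perms_simps:
  "g \<in> carrier (finitary_perms J) \<Longrightarrow> g permutes J"
  "mult (finitary_perms J) g h = (\<lambda>j. g (h j))" "one (finitary_perms J) = id"
  by (simp_all add: finitary_perms_def comp_def)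

lemma bounded_action_free_perm:
  fixes A :: "'a normed_star_alg"
  assumes "cstar_algebra A"
  shows "bounded_action (free_prod A J) (finitary_perms J) (free_perm A J)"
proof -
  interpret cstar_algebra A by fact
  show ?thesis
    by (intro bounded_action.intro bounded_free_prod[OF assms] group_finitary_perms bounded_action_axioms.intro)
      (auto simp: finitary_perms_simps free_perm_hom carrier_free_prod free_perm_class permutes_compose[unfolded comp_def]
        relabel_comp relabel_id permutes_id word_star_algebra.keys_relabel[OF free_word_algebra])
qed

lemma bounded_action_unital_free_perm:
  fixes A :: "'a normed_star_alg"
  assumes "cstar_algebra A" "unital A"
  shows "bounded_action (unital_free_prod A J) (finitary_perms J) (unital_free_perm A J)"
proof -
  interpret cstar_algebra A by fact
  show ?thesis
    by (intro bounded_action.intro bounded_unital_free_prod[OF assms] group_finitary_perms bounded_action_axioms.intro)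
      (auto simp: finitary_perms_simps unital_free_perm_hom assms carrier_unital_free_prod unital_free_perm_class
        permutes_compose[unfolded comp_def] relabel_comp relabel_id permutes_id
        word_star_algebra.keys_relabel[OF unital_word_algebra])
qed

lemma bounded_hom_free_proj:
  fixes A :: "'a normed_star_alg"
  assumes "cstar_algebra A" "unital A"
  shows "bounded_hom (free_prod A J) (unital_free_prod A J) (free_proj A J)"
proof -
  interpret cstar_algebra A by fact
  show ?thesis
    by (intro bounded_hom.intro bounded_free_prod bounded_unital_free_prod bounded_hom_axioms.intro
        free_proj_hom assms)
qed

lemma (in star_algebra) free_proj_free_perm:
  assumes "unital A" and g: "g permutes J" and X: "X \<in> carrier (free_prod A J)"
  shows "free_proj A J (free_perm A J g X) = unital_free_perm A J g (free_proj A J X)"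
proof -
  obtain p where p: "Poly_Mapping.keys p \<subseteq> alt_words A J" "X = free_rel A J `` {p}"
    using X by (auto simp: carrier_free_prod)
  have "Poly_Mapping.keys p \<subseteq> insert [] (alt_words A J)" using p(1) by blast
  then show ?thesis
    using p word_star_algebra.keys_relabel[OF free_word_algebra g p(1)]
    by (simp add: free_perm_class g free_proj_class assms(1) unital_free_perm_class)
qed

theorem proposition3p1:
  fixes A :: "'a normed_star_alg" and J :: "'j set"
  assumes "cstar_algebra A"
  shows
    "(\<exists>!\<beta>. extended_action (finitary_perms J) (free_prod A J) (free_perm A J) \<beta>) \<and>
     (\<forall>g\<in>carrier (finitary_perms J).
        \<exists>!f. f \<in> carrier (star_Aut (envelope (free_prod A J))) \<and>
             extends_to_envelope (free_prod A J) (free_prod A J) (free_perm A J g) f) \<and>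
     (unital A \<longrightarrow>
       (\<exists>!\<gamma>. extended_action (finitary_perms J) (unital_free_prod A J) (unital_free_perm A J) \<gamma>) \<and>
       (\<forall>g\<in>carrier (finitary_perms J).
          \<exists>!f. f \<in> carrier (star_Aut (envelope (unital_free_prod A J))) \<and>
               extends_to_envelope (unital_free_prod A J) (unital_free_prod A J)
                 (unital_free_perm A J g) f) \<and>
       (\<exists>!\<rho>. extended_hom (free_prod A J) (unital_free_prod A J) (free_proj A J) \<rho>) \<and>
       (\<forall>\<rho> \<beta> \<gamma>.
          extended_hom (free_prod A J) (unital_free_prod A J) (free_proj A J) \<rho> \<and>
          extended_action (finitary_perms J) (free_prod A J) (free_perm A J) \<beta> \<and>
          extended_action (finitary_perms J) (unital_free_prod A J) (unital_free_perm A J) \<gamma> \<longrightarrow>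
          (J \<noteq> {} \<longrightarrow>
             \<rho> ` carrier (envelope (free_prod A J)) = carrier (envelope (unital_free_prod A J))) \<and>
          (\<forall>g\<in>carrier (finitary_perms J). \<forall>x\<in>carrier (envelope (free_prod A J)).
             \<rho> (\<beta> g x) = \<gamma> g (\<rho> x))))"
proof -
  interpret cstar_algebra A by fact
  let ?B = "free_prod A J" and ?C = "unital_free_prod A J" and ?G = "finitary_perms J"
  interpret \<beta>: bounded_action ?B ?G "free_perm A J"
    by (rule bounded_action_free_perm[OF assms])
  let ?\<beta> = "restrict (\<lambda>g. envelope_map ?B ?B (free_perm A J g)) (carrier ?G)"
  let ?\<gamma> = "restrict (\<lambda>g. envelope_map ?C ?C (unital_free_perm A J g)) (carrier ?G)"
  let ?\<rho> = "envelope_map ?B ?C (free_proj A J)"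
  have unital_case: "(\<exists>!\<gamma>. extended_action ?G ?C (unital_free_perm A J) \<gamma>) \<and>
      (\<forall>g\<in>carrier ?G. \<exists>!f. f \<in> carrier (star_Aut (envelope ?C)) \<and>
        extends_to_envelope ?C ?C (unital_free_perm A J g) f) \<and>
      (\<exists>!\<rho>. extended_hom ?B ?C (free_proj A J) \<rho>) \<and>
      (\<forall>\<rho> \<beta> \<gamma>. extended_hom ?B ?C (free_proj A J) \<rho> \<and> extended_action ?G ?B (free_perm A J) \<beta> \<and>
        extended_action ?G ?C (unital_free_perm A J) \<gamma> \<longrightarrow>
          (J \<noteq> {} \<longrightarrow> \<rho> ` carrier (envelope ?B) = carrier (envelope ?C)) \<and>
          (\<forall>g\<in>carrier ?G. \<forall>x\<in>carrier (envelope ?B). \<rho> (\<beta> g x) = \<gamma> g (\<rho> x)))"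
    if unital: "unital A"
  proof -
    interpret \<gamma>: bounded_action ?C ?G "unital_free_perm A J"
      by (rule bounded_action_unital_free_perm[OF assms unital])
    interpret \<rho>: bounded_hom ?B ?C "free_proj A J"
      by (rule bounded_hom_free_proj[OF assms unital])
    have surj: "J \<noteq> {} \<longrightarrow> ?\<rho> ` carrier (envelope ?B) = carrier (envelope ?C)"
      using \<rho>.envelope_map_surj[OF free_proj_surj[OF unital]] by blast
    have inter: "\<forall>g\<in>carrier ?G. \<forall>x\<in>carrier (envelope ?B). ?\<rho> (?\<beta> g x) = ?\<gamma> g (?\<rho> x)"
    proof (intro ballI)
      fix g x assume g: "g \<in> carrier ?G" and x: "x \<in> carrier (envelope ?B)"
      show "?\<rho> (?\<beta> g x) = ?\<gamma> g (?\<rho> x)"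
        by (rule extended_intertwining[OF \<beta>.bounded_star_algebra_axioms \<gamma>.bounded_star_algebra_axioms
              \<rho>.extended_hom_envelope_map \<beta>.extended_action_envelope_map \<gamma>.extended_action_envelope_map
              g, OF \<rho>.hom \<beta>.action_hom[OF g] _ x])
          (rule free_proj_free_perm[OF unital finitary_perms_simps(1)[OF g]])
    qed
    have "\<forall>\<rho> \<beta> \<gamma>. extended_hom ?B ?C (free_proj A J) \<rho> \<and> extended_action ?G ?B (free_perm A J) \<beta> \<and>
        extended_action ?G ?C (unital_free_perm A J) \<gamma> \<longrightarrow>
          (J \<noteq> {} \<longrightarrow> \<rho> ` carrier (envelope ?B) = carrier (envelope ?C)) \<and>
          (\<forall>g\<in>carrier ?G. \<forall>x\<in>carrier (envelope ?B). \<rho> (\<beta> g x) = \<gamma> g (\<rho> x))"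
      \<comment> \<open>By uniqueness it suffices to consider the extensions that were constructed.\<close>
      by (intro allI impI, elim conjE, drule \<rho>.extended_hom_unique, drule \<beta>.extended_action_unique,
          drule \<gamma>.extended_action_unique, hypsubst, rule conjI[OF surj inter])
    then show ?thesis
      using \<gamma>.extended_action_ex1 \<gamma>.extension_ex1 \<rho>.extended_hom_ex1 by (intro conjI ballI)
  qed
  show ?thesis
    by (rule conjI[OF \<beta>.extended_action_ex1], rule conjI, rule ballI, erule \<beta>.extension_ex1,
        rule impI, erule unital_case)
qed

end
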